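(* In the following, a Cayley form of a surface (resp. curve) means a form $F$ of the stated degree whose restriction to the quadric $\{Q=0\}$ defines the corresponding tangential (resp. honest) Cayley 3-fold; uniqueness is up to multiplication by a nonzero scalar. (a) Let $S\subset\mathbb P^3$ be a smooth quadric surface. There is no tangential Cayley form $F$ of $S$ (of degree $2$) satisfying the strong Cayley equation $\{F,F\}\equiv 0$. The unique Cayley form $F_2$ of $S$ such that $\{F_2,F_2\}\equiv 0\pmod Q$ is harmonic. (b) Let $C\subset\mathbb P^3$ be either the union of two skew lines (degree $2$) or a twisted cubic curve (degree $3$). There is no Cayley form $F$ of $C$ satisfying the strong Cayley equation $\{F,F\}\equiv 0$; moreover, the unique Cayley form $F_2$ of $C$ such that $\{F_2,F_2\}\equiv 0\pmod Q$ is not harmonic. (c) Let $C\subset\mathbb P^3$ be a smooth plane conic. Then the harmonic Cayley form $F$ of $C$ (of degree $2$) satisfies the strong Cayley equation $\{F,F\}\equiv 0$.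
   Context: Let $k$ be $\mathbb C$ or an algebraically closed field of characteristic $0$, $V=k^4$, $\mathbb P=\mathbb P(\Lambda^2 V)\cong\mathbb P^5$ with coordinates $p_{ij}$ ($0\le i<j\le 3$), $Q(p)=p_{01}p_{23}-p_{02}p_{13}+p_{03}p_{12}$. The quadric $\{Q=0\}$ is the Grassmannian $G(1,3)$ of lines in $\mathbb P^3$. Cayley bracket: with $F_{ij}=\partial F/\partial p_{ij}$, $\{F,G\}=F_{01}G_{23}+F_{23}G_{01}-F_{02}G_{13}-F_{13}G_{02}+F_{03}G_{12}+F_{12}G_{03}.$ $F$ is harmonic if $\Delta F=0$, where $\Delta=\frac{\partial}{\partial p_{01}}\frac{\partial}{\partial p_{23}}-\frac{\partial}{\partial p_{02}}\frac{\partial}{\partial p_{13}}+\frac{\partial}{\partial p_{03}}\frac{\partial}{\partial p_{12}}$. Every homogeneous form is congruent modulo $Q$ to a unique harmonic form. The honest Cayley 3-fold of a curve $C\subset\mathbb P^3$ is the set of lines meeting $C$; it is cut out on $\{Q=0\}$, as a reduced divisor, by a form of degree $\deg C$. The tangential Cayley 3-fold of a surface $S\subset\mathbb P^3$ is the closure of the set of lines tangent to $S$ at smooth points; for a smooth quadric surface it is cut out, as a reduced divisor, by a form of degree $2$. The Cayley forms of given degree of a given curve or surface are determined up to scalars and up to adding multiples of $Q$. *)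

theory Defs
  imports
    "HOL-Analysis.Cartesian_Space"
    "HOL-Computational_Algebra.Polynomial"
    "HOL-Library.Poly_Mapping"
begin

section \<open>Polynomials in finitely many variables\<close>

text \<open>The multiplication of \<^typ>\<open>('v \<Rightarrow>\<^sub>0 nat) \<Rightarrow>\<^sub>0 'a\<close> is convolution, so this type is the
  polynomial ring over \<open>'a\<close> in variables indexed by \<open>'v\<close>; the keys are exponent vectors.\<close>

type_synonym ('v, 'a) mpoly = "('v \<Rightarrow>\<^sub>0 nat) \<Rightarrow>\<^sub>0 'a"

definition Var :: "'v \<Rightarrow> ('v, 'a::comm_ring_1) mpoly" where
  "Var v = Poly_Mapping.single (Poly_Mapping.single v 1) 1"

definition Const :: "'a::comm_ring_1 \<Rightarrow> ('v, 'a) mpoly" where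
  "Const c = Poly_Mapping.single 0 c"

definition eval_poly :: "('v::finite, 'a::comm_ring_1) mpoly \<Rightarrow> 'a ^ 'v \<Rightarrow> 'a" where
  "eval_poly F x =
     (\<Sum>m \<in> Poly_Mapping.keys F.
        Poly_Mapping.lookup F m * (\<Prod>v\<in>UNIV. (x $ v) ^ Poly_Mapping.lookup m v))"

definition partial :: "'v \<Rightarrow> ('v, 'a::comm_ring_1) mpoly \<Rightarrow> ('v, 'a) mpoly" where
  "partial v F =
     (\<Sum>m \<in> Poly_Mapping.keys F.
        Poly_Mapping.single (m - Poly_Mapping.single v 1)
          (of_nat (Poly_Mapping.lookup m v) * Poly_Mapping.lookup F m))"

definition is_form :: "nat \<Rightarrow> ('v::finite, 'a::comm_ring_1) mpoly \<Rightarrow> bool" where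
  "is_form d F \<longleftrightarrow>
     (\<forall>m \<in> Poly_Mapping.keys F. (\<Sum>v\<in>UNIV. Poly_Mapping.lookup m v) = d)"

definition gradient :: "('v::finite, 'a::comm_ring_1) mpoly \<Rightarrow> 'a ^ 'v \<Rightarrow> 'a ^ 'v" where
  "gradient F x = (\<chi> v. eval_poly (partial v F) x)"


section \<open>Projective sets\<close>

text \<open>A subset of a projective space is represented by the set of all non-zero vectors
  representing its points, that is, by its punctured affine cone.\<close>

definition proj_zeros :: "('v::finite, 'a::field) mpoly set \<Rightarrow> ('a ^ 'v) set" where
  "proj_zeros \<F> = {x. x \<noteq> 0 \<and> (\<forall>F\<in>\<F>. eval_poly F x = 0)}"

definition zariski_closure :: "('a::field ^ 'v::finite) set \<Rightarrow> ('a ^ 'v) set" where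
  "zariski_closure Z =
     proj_zeros {G. (\<exists>d. is_form d G) \<and> (\<forall>x\<in>Z. eval_poly G x = 0)}"


section \<open>Pluecker coordinates\<close>

datatype pl = P01 | P02 | P03 | P12 | P13 | P23

instance pl :: finite
proof
  have "(UNIV :: pl set) \<subseteq> {P01, P02, P03, P12, P13, P23}"
    using pl.exhaust by blast
  then show "finite (UNIV :: pl set)"
    by (rule finite_subset) simp
qed

text \<open>The homogeneous coordinates \<open>x\<^sub>0, \<dots>, x\<^sub>3\<close> of \<open>\<P>\<^sup>3\<close> are indexed by the elements
  \<open>0, 1, 2, 3\<close> of the four-element type \<open>4\<close> (in which \<open>4 = 0\<close>).\<close>

definition plucker :: "'a::field ^ 4 \<Rightarrow> 'a ^ 4 \<Rightarrow> 'a ^ pl" where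
  "plucker x y = (\<chi> I. case I of
       P01 \<Rightarrow> x $ 0 * y $ 1 - x $ 1 * y $ 0
     | P02 \<Rightarrow> x $ 0 * y $ 2 - x $ 2 * y $ 0
     | P03 \<Rightarrow> x $ 0 * y $ 3 - x $ 3 * y $ 0
     | P12 \<Rightarrow> x $ 1 * y $ 2 - x $ 2 * y $ 1
     | P13 \<Rightarrow> x $ 1 * y $ 3 - x $ 3 * y $ 1
     | P23 \<Rightarrow> x $ 2 * y $ 3 - x $ 3 * y $ 2)"

definition lines :: "('a::field ^ 4) set set" where
  "lines = {L. vec.subspace L \<and> vec.dim L = 2}"

text \<open>Non-zero multiples of a Pluecker vector are obtained by rescaling \<open>x\<close>, so the following
  consists of all representatives of the points of the Grassmannian given by lines in \<open>\<L>\<close>.\<close>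

definition plucker_vectors :: "('a::field ^ 4) set set \<Rightarrow> ('a ^ pl) set" where
  "plucker_vectors \<L> = {plucker x y | x y. vec.span {x, y} \<in> \<L> \<inter> lines}"

definition pluckerQ :: "(pl, 'a::field) mpoly" where
  "pluckerQ = Var P01 * Var P23 - Var P02 * Var P13 + Var P03 * Var P12"

definition cayley_bracket ::
  "(pl, 'a::field) mpoly \<Rightarrow> (pl, 'a) mpoly \<Rightarrow> (pl, 'a) mpoly" where
  "cayley_bracket F G =
       partial P01 F * partial P23 G + partial P23 F * partial P01 G
     - partial P02 F * partial P13 G - partial P13 F * partial P02 G
     + partial P03 F * partial P12 G + partial P12 F * partial P03 G"

definition laplacian :: "(pl, 'a::field) mpoly \<Rightarrow> (pl, 'a) mpoly" where
  "laplacian F =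
     partial P01 (partial P23 F) - partial P02 (partial P13 F) + partial P03 (partial P12 F)"

definition harmonic :: "(pl, 'a::field) mpoly \<Rightarrow> bool" where
  "harmonic F \<longleftrightarrow> laplacian F = 0"


section \<open>Cayley 3-folds and Cayley forms\<close>

definition honest_cayley_threefold :: "('a::field ^ 4) set \<Rightarrow> ('a ^ pl) set" where
  "honest_cayley_threefold C = plucker_vectors {L \<in> lines. L \<inter> C \<noteq> {}}"

text \<open>A surface is given by its (square-free) equation \<open>f\<close>; its smooth points are the zeros of
  \<open>f\<close> with non-vanishing gradient, and its tangent plane there is the kernel of the
  differential of \<open>f\<close>.\<close>

definition tangent_lines :: "(4, 'a::field) mpoly \<Rightarrow> ('a ^ 4) set set" where
  "tangent_lines f =
     {L \<in> lines. \<exists>x \<in> L \<inter> proj_zeros {f}. gradient f x \<noteq> 0 \<and>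
        (\<forall>v\<in>L. (\<Sum>i\<in>UNIV. gradient f x $ i * v $ i) = 0)}"

definition tangential_cayley_threefold :: "(4, 'a::field) mpoly \<Rightarrow> ('a ^ pl) set" where
  "tangential_cayley_threefold f = zariski_closure (plucker_vectors (tangent_lines f))"

definition ideal2 :: "'r::comm_ring_1 \<Rightarrow> 'r \<Rightarrow> 'r set" where
  "ideal2 P R = {A * P + B * R | A B. True}"

definition radical_ideal :: "'r::comm_ring_1 set \<Rightarrow> bool" where
  "radical_ideal I \<longleftrightarrow> (\<forall>H n. H ^ n \<in> I \<longrightarrow> H \<in> I)"

text \<open>The restriction of \<open>F\<close> to the quadric \<open>{Q = 0}\<close> defines \<open>Z\<close> as a reduced divisor: the zero
  locus of \<open>F\<close> on the quadric is \<open>Z\<close>, and the subscheme \<open>{Q = F = 0}\<close> is reduced. When \<open>Q\<close> does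
  not divide \<open>F\<close>, this subscheme is a complete intersection of dimension 3, so \<open>(Q, F)\<close> is its
  saturated ideal and reducedness means that \<open>(Q, F)\<close> is radical.\<close>

definition cuts_out :: "(pl, 'a::field) mpoly \<Rightarrow> ('a ^ pl) set \<Rightarrow> bool" where
  "cuts_out F Z \<longleftrightarrow> proj_zeros {pluckerQ, F} = Z \<and> radical_ideal (ideal2 pluckerQ F)"

definition honest_cayley_form ::
  "nat \<Rightarrow> ('a::field ^ 4) set \<Rightarrow> (pl, 'a) mpoly \<Rightarrow> bool" where
  "honest_cayley_form d C F \<longleftrightarrow> is_form d F \<and> cuts_out F (honest_cayley_threefold C)"

definition tangential_cayley_form ::
  "nat \<Rightarrow> (4, 'a::field) mpoly \<Rightarrow> (pl, 'a) mpoly \<Rightarrow> bool" where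
  "tangential_cayley_form d f F \<longleftrightarrow> is_form d F \<and> cuts_out F (tangential_cayley_threefold f)"

definition strong_cayley_eq :: "(pl, 'a::field) mpoly \<Rightarrow> bool" where
  "strong_cayley_eq F \<longleftrightarrow> cayley_bracket F F = 0"

definition weak_cayley_eq :: "(pl, 'a::field) mpoly \<Rightarrow> bool" where
  "weak_cayley_eq F \<longleftrightarrow> pluckerQ dvd cayley_bracket F F"

definition unique_up_to_scalar ::
  "(('v, 'a::field) mpoly \<Rightarrow> bool) \<Rightarrow> ('v, 'a) mpoly \<Rightarrow> bool" where
  "unique_up_to_scalar \<Phi> F \<longleftrightarrow> \<Phi> F \<and> (\<forall>G. \<Phi> G \<longrightarrow> (\<exists>c. c \<noteq> 0 \<and> G = Const c * F))"


section \<open>The curves and surfaces\<close>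

definition smooth_quadric :: "(4, 'a::field) mpoly \<Rightarrow> bool" where
  "smooth_quadric f \<longleftrightarrow> is_form 2 f \<and> (\<forall>x \<in> proj_zeros {f}. gradient f x \<noteq> 0)"

definition two_skew_lines :: "('a::field ^ 4) set \<Rightarrow> bool" where
  "two_skew_lines C \<longleftrightarrow>
     (\<exists>L \<in> lines. \<exists>M \<in> lines. L \<inter> M = {0} \<and> C = (L \<union> M) - {0})"

text \<open>A twisted cubic is a curve projectively equivalent to the image of
  \<open>(s : t) \<mapsto> (s\<^sup>3 : s\<^sup>2t : st\<^sup>2 : t\<^sup>3)\<close>. Over an algebraically closed field the set below is closed
  under non-zero scalars, since cube roots exist.\<close>

definition twisted_cubic :: "('a::field ^ 4) set \<Rightarrow> bool" where
  "twisted_cubic C \<longleftrightarrow>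
     (\<exists>A :: 'a ^ 4 ^ 4. invertible A \<and>
        C = {A *v vector [s ^ 3, s ^ 2 * t, s * t ^ 2, t ^ 3] | s t. (s, t) \<noteq> (0, 0)})"

text \<open>Smoothness of the conic \<open>{l = q = 0}\<close> is the Jacobian criterion.\<close>

definition smooth_plane_conic :: "('a::field ^ 4) set \<Rightarrow> bool" where
  "smooth_plane_conic C \<longleftrightarrow>
     (\<exists>l q. is_form 1 l \<and> l \<noteq> 0 \<and> is_form 2 q \<and> C = proj_zeros {l, q} \<and>
        (\<forall>x\<in>C. \<forall>a b. a *s gradient l x + b *s gradient q x = 0 \<longrightarrow> a = 0 \<and> b = 0))"

end

theory Submission
  imports Defs
begin

text \<open>After a linear change of coordinates of \<open>\<P>\<^sup>3\<close>, which rescales \<open>Q\<close>, the Cayley bracket and the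
  Laplacian by non-zero constants, the curve or surface is in normal form and one of its Cayley forms
  \<open>F\<close> can be written down. On the chart \<open>p\<^sub>0\<^sub>1 \<noteq> 0\<close> each of these \<open>F\<close> is a quadratic polynomial in
  \<open>p\<^sub>1\<^sub>3\<close> with generically distinct roots, so every polynomial vanishing on \<open>{Q = F = 0}\<close> lies in
  \<open>(Q, F)\<close>; this replaces the Nullstellensatz. Hence the Cayley forms are exactly the \<open>c F + B Q\<close> with
  \<open>c \<noteq> 0\<close> and \<open>B\<close> of degree \<open>d - 2\<close>. Since \<open>{F, Q} = d F\<close> and \<open>{Q, Q} = 2 Q\<close>, modulo \<open>Q\<close> the bracket
  of \<open>c F + B Q\<close> with itself is \<open>c\<^sup>2 {F, F} + 2 c d B F\<close>, so when \<open>F\<close> solves the weak equation, \<open>B\<close>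
  must vanish on the quadric and is therefore \<open>0\<close>. For a conic the form depends only on the three
  coordinates of the intersection point with its plane, and their mutual brackets vanish.\<close>

section \<open>Polynomials in finitely many variables\<close>

text \<open>Two points need more than the chart computation. Clearing the denominators
  \<open>p01 ^ N\<close> requires \<open>p01\<close> to be a nonzerodivisor modulo
  \<open>(Q, F)\<close>: the slice \<open>p01 = Q = 0\<close> is irreducible, so it is enough that
  \<open>F\<close> is nonzero at one of its points. Irreducibility, of the slice and of the whole
  quadric, is handled without prime ideals: any two points are joined by a polynomial curve inside
  the variety, and if a product of two polynomials vanishes along the curve, one factor does,
  because univariate polynomials form an integral domain. The passage from \<open>B\<close>
  vanishing on the quadric to \<open>B = 0\<close> is where the degrees matter: for
  \<open>d \<le> 3\<close> the form \<open>B\<close> is at most linear, and the quadric contains all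
  coordinate points. The same expansion explains the correction terms in the explicit forms: if
  \<open>{F, F}\<close> is congruent to \<open>2 A F\<close> modulo \<open>Q\<close>, then
  \<open>F - (A / d) Q\<close> solves the weak equation. Harmonicity is then a separate test on the
  corrected form.\<close>

lemma eval_poly_superset:
  assumes "finite K" "Poly_Mapping.keys F \<subseteq> K"
  shows "eval_poly F x =
    (\<Sum>m\<in>K. Poly_Mapping.lookup F m * (\<Prod>v\<in>UNIV. (x $ v) ^ Poly_Mapping.lookup m v))"
  unfolding eval_poly_def
  by (rule sum.mono_neutral_left) (use assms in \<open>auto simp: in_keys_iff\<close>)

lemma eval_poly_single:
  "eval_poly (Poly_Mapping.single m c) x = c * (\<Prod>v\<in>UNIV. (x $ v) ^ Poly_Mapping.lookup m v)"
  by (subst eval_poly_superset[where K = "{m}"]) auto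

lemma eval_poly_0 [simp]: "eval_poly 0 x = 0"
  by (simp add: eval_poly_def)

lemma eval_poly_add [simp]: "eval_poly (F + G) x = eval_poly F x + eval_poly G x"
proof -
  let ?K = "Poly_Mapping.keys F \<union> Poly_Mapping.keys G"
  have "Poly_Mapping.keys (F + G) \<subseteq> ?K" by (rule keys_add)
  then show ?thesis
    by (simp add: eval_poly_superset[where K = ?K] lookup_add distrib_right sum.distrib)
qed

lemma eval_poly_sum: "eval_poly (\<Sum>i\<in>I. F i) x = (\<Sum>i\<in>I. eval_poly (F i) x)"
  by (induction I rule: infinite_finite_induct) auto

lemma mpoly_sum_singles:
  fixes F :: "'b \<Rightarrow>\<^sub>0 'a::comm_monoid_add"
  shows "F = (\<Sum>m\<in>Poly_Mapping.keys F. Poly_Mapping.single m (Poly_Mapping.lookup F m))"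
proof (rule poly_mapping_eqI)
  fix k
  have "(\<Sum>m\<in>Poly_Mapping.keys F. if m = k then Poly_Mapping.lookup F m else 0) =
      Poly_Mapping.lookup F k"
    by (subst sum.delta) (auto simp: in_keys_iff)
  then show "Poly_Mapping.lookup F k = Poly_Mapping.lookup
      (\<Sum>m\<in>Poly_Mapping.keys F. Poly_Mapping.single m (Poly_Mapping.lookup F m)) k"
    by (simp add: lookup_sum lookup_single when_def)
qed

lemma mpoly_single_induct [case_names single add]:
  fixes F :: "'b \<Rightarrow>\<^sub>0 'a::comm_monoid_add"
  assumes "\<And>m c. P (Poly_Mapping.single m c)" and "\<And>F G. P F \<Longrightarrow> P G \<Longrightarrow> P (F + G)"
  shows "P F"
proof -
  have "P (\<Sum>m\<in>K. Poly_Mapping.single m (Poly_Mapping.lookup F m))" if "finite K" for K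
    using that
  proof (induction K)
    case empty
    \<comment> \<open>The zero polynomial is a \<open>single\<close> with coefficient 0, whatever
      its key.\<close>
    show ?case using assms(1)[of undefined 0] by simp
  qed (simp add: assms)
  then show ?thesis using mpoly_sum_singles[of F] by (metis finite_keys)
qed

lemma eval_poly_mult [simp]: "eval_poly (F * G) x = eval_poly F x * eval_poly G x"
proof (induction F rule: mpoly_single_induct)
  case (single m c)
  show ?case
  proof (induction G rule: mpoly_single_induct)
    case (single n d)
    show ?case
      by (simp add: mult_single eval_poly_single lookup_add power_add prod.distrib mult_ac)
  qed (simp add: distrib_left)
qed (simp add: distrib_right)

lemma eval_poly_Const [simp]: "eval_poly (Const c) x = c"
  by (simp add: Const_def eval_poly_single)

lemma eval_poly_Var [simp]: "eval_poly (Var v) x = x $ v"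
proof -
  have "(\<Prod>w\<in>UNIV. x $ w ^ (if v = w then Suc 0 else 0)) = x $ v"
    by (subst prod.remove[where x = v]) auto
  then show ?thesis
    by (simp add: Var_def eval_poly_single lookup_single when_def)
qed

lemma Const_0 [simp]: "Const 0 = 0"
  by (simp add: Const_def)

lemma Const_1 [simp]: "Const 1 = 1"
  by (simp add: Const_def)

lemma Const_mult: "Const (a * b) = Const a * Const b"
  by (simp add: Const_def mult_single)

lemma Const_numeral: "Const (numeral n) = numeral n"
  by (simp add: Const_def)

lemma eval_poly_1 [simp]: "eval_poly 1 x = 1"
  using eval_poly_Const[of 1 x] by simp

lemma eval_poly_uminus [simp]: "eval_poly (- F) x = - eval_poly F x"
  by (metis eval_poly_0 eval_poly_add add.right_inverse minus_unique)

lemma eval_poly_diff [simp]: "eval_poly (F - G) x = eval_poly F x - eval_poly G x"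
  using eval_poly_add[of F "- G" x] by simp

lemma eval_poly_power [simp]: "eval_poly (F ^ n) x = eval_poly F x ^ n"
  by (induction n) auto

lemma eval_poly_numeral [simp]: "eval_poly (numeral n) x = numeral n"
  using eval_poly_Const[of "numeral n" x] by (simp add: Const_numeral)

lemma single_eq_Const_times_Vars:
  "Poly_Mapping.single m c = Const c * (\<Prod>v\<in>UNIV. Var v ^ Poly_Mapping.lookup m v)"
  for m :: "'v::finite \<Rightarrow>\<^sub>0 nat"
proof -
  have pow: "Var v ^ n = Poly_Mapping.single (Poly_Mapping.single v n) (1::'a::comm_ring_1)" for v :: 'v and n
    by (induction n) (auto simp: Var_def mult_single simp flip: single_add)
  have "(\<Prod>v\<in>S. Poly_Mapping.single (f v) (1::'a)) = Poly_Mapping.single (\<Sum>v\<in>S. f v) 1"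
    for S :: "'v set" and f :: "'v \<Rightarrow> ('v \<Rightarrow>\<^sub>0 nat)"
    by (induction S rule: infinite_finite_induct) (auto simp: mult_single)
  moreover have "(\<Sum>v\<in>UNIV. Poly_Mapping.single v (Poly_Mapping.lookup m v)) = m"
    by (rule poly_mapping_eqI) (simp add: lookup_sum lookup_single when_def sum.delta)
  ultimately show ?thesis by (simp add: pow Const_def mult_single)
qed

lemma mpoly_induct [case_names Const Var add mult]:
  fixes F :: "('v::finite, 'a::comm_ring_1) mpoly"
  assumes C: "\<And>c. P (Const c)" and V: "\<And>v. P (Var v)"
    and A: "\<And>F G. P F \<Longrightarrow> P G \<Longrightarrow> P (F + G)" and M: "\<And>F G. P F \<Longrightarrow> P G \<Longrightarrow> P (F * G)"
  shows "P F"
proof (induction F rule: mpoly_single_induct)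
  case (single m c)
  have one: "P 1" using C[of 1] by simp
  have "P (Var v ^ n)" for v n by (induction n) (auto intro: one M V)
  then have "P (\<Prod>v\<in>S. Var v ^ Poly_Mapping.lookup m v)" for S
    by (induction S rule: infinite_finite_induct) (auto intro: one M)
  then show ?case unfolding single_eq_Const_times_Vars by (intro M C)
qed (rule A)

section \<open>Partial derivatives: linearity, Leibniz rule, commutation\<close>

lemma partial_superset:
  assumes "finite K" "Poly_Mapping.keys F \<subseteq> K"
  shows "partial v F = (\<Sum>m\<in>K. Poly_Mapping.single (m - Poly_Mapping.single v 1)
          (of_nat (Poly_Mapping.lookup m v) * Poly_Mapping.lookup F m))"
  unfolding partial_def
  by (rule sum.mono_neutral_left) (use assms in \<open>auto simp: in_keys_iff\<close>)

lemma partial_single: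
  "partial v (Poly_Mapping.single m c) =
     Poly_Mapping.single (m - Poly_Mapping.single v 1) (of_nat (Poly_Mapping.lookup m v) * c)"
  by (subst partial_superset[where K = "{m}"]) auto

lemma partial_add [simp]: "partial v (F + G) = partial v F + partial v G"
proof -
  let ?K = "Poly_Mapping.keys F \<union> Poly_Mapping.keys G"
  have "Poly_Mapping.keys (F + G) \<subseteq> ?K" by (rule keys_add)
  then show ?thesis
    by (simp add: partial_superset[where K = ?K] lookup_add distrib_left single_add sum.distrib)
qed

lemma partial_0 [simp]: "partial v 0 = 0"
  by (simp add: partial_def)

lemma partial_sum: "partial v (\<Sum>i\<in>I. F i) = (\<Sum>i\<in>I. partial v (F i))"
  by (induction I rule: infinite_finite_induct) auto

lemma partial_Const [simp]: "partial v (Const c) = 0"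
  by (simp add: Const_def partial_single)

lemma partial_1 [simp]: "partial v 1 = 0"
  using partial_Const[of v 1] by simp

lemma partial_numeral [simp]: "partial v (numeral n) = 0"
  using partial_Const[of v "numeral n"] by (simp add: Const_numeral)

lemma partial_Var: "partial v (Var w) = (if v = w then 1 else 0)"
  by (auto simp: Var_def partial_single lookup_single when_def)

lemma partial_uminus [simp]: "partial v (- F) = - partial v F"
  by (metis partial_0 partial_add add.right_inverse minus_unique)

lemma partial_diff [simp]: "partial v (F - G) = partial v F - partial v G"
  using partial_add[of v F "- G"] by simp

lemma partial_mult: "partial v (F * G) = partial v F * G + F * partial v G"
proof (induction F rule: mpoly_single_induct)
  case (single m c)
  show ?case
  proof (induction G rule: mpoly_single_induct)
    case (single n d)
    let ?e = "Poly_Mapping.single v (Suc 0)"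
    \<comment> \<open>Subtraction of exponents is truncated at 0, so it can be moved onto one factor
      only if the exponent of \<open>v\<close> there is positive; otherwise the corresponding
      coefficient is 0.\<close>
    have 1: "m + n - ?e = (m - ?e) + n" if "Poly_Mapping.lookup m v \<noteq> 0"
      using that by (intro poly_mapping_eqI) (auto simp: lookup_add lookup_minus lookup_single when_def)
    have 2: "m + n - ?e = m + (n - ?e)" if "Poly_Mapping.lookup n v \<noteq> 0"
      using that by (intro poly_mapping_eqI) (auto simp: lookup_add lookup_minus lookup_single when_def)
    have 3: "n + (m - ?e) = m + (n - ?e)" if "Poly_Mapping.lookup m v \<noteq> 0" "Poly_Mapping.lookup n v \<noteq> 0"
      using 1 2 that by (simp add: add.commute)
    show ?case
      using 1 2 3 by (cases "Poly_Mapping.lookup m v = 0"; cases "Poly_Mapping.lookup n v = 0")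
        (simp_all add: mult_single partial_single lookup_add single_add algebra_simps)
  qed (simp add: algebra_simps)
qed (simp add: algebra_simps)

lemma partial_commute: "partial v (partial w F) = partial w (partial v F)"
  for F :: "('v::finite, 'a::comm_ring_1) mpoly"
  by (induction F rule: mpoly_induct) (auto simp: partial_Var partial_mult algebra_simps)

section \<open>Restriction to curves; a polynomial is determined by its values\<close>

lemma eval_poly_along_curve:
  "\<exists>p. \<forall>t. poly p t = eval_poly F (\<chi> v. poly (\<gamma> v) t)"
proof (induction F rule: mpoly_induct)
  case (Const c)
  show ?case by (rule exI[of _ "[:c:]"]) simp
next
  case (Var v)
  show ?case by (rule exI[of _ "\<gamma> v"]) simp
next
  case (add F G)
  then show ?case by (metis poly_add eval_poly_add)
next
  case (mult F G)
  then show ?case by (metis poly_mult eval_poly_mult)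
qed

text \<open>Digits in base \<open>N\<close> are unique, the lowest being the residue modulo
  \<open>N\<close>. This recovers an exponent vector from its weight under the Kronecker
  substitution.\<close>

lemma base_expansion_inj:
  fixes a b :: "nat \<Rightarrow> nat"
  assumes "\<And>i. i < n \<Longrightarrow> a i < N" "\<And>i. i < n \<Longrightarrow> b i < N"
    and "(\<Sum>i<n. a i * N ^ i) = (\<Sum>i<n. b i * N ^ i)" "i < n"
  shows "a i = b i"
  using assms
proof (induction n arbitrary: a b i)
  case (Suc n)
  have split: "(\<Sum>i<Suc n. c i * N ^ i) = c 0 + N * (\<Sum>i<n. c (Suc i) * N ^ i)" for c :: "nat \<Rightarrow> nat"
    by (subst sum.lessThan_Suc_shift) (simp add: sum_distrib_left mult_ac)
  have eq: "a 0 + N * (\<Sum>i<n. a (Suc i) * N ^ i) = b 0 + N * (\<Sum>i<n. b (Suc i) * N ^ i)"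
    using Suc.prems(3) by (simp only: split)
  have less: "a 0 < N" "b 0 < N" using Suc.prems by auto
  have 0: "a 0 = b 0" using arg_cong[OF eq, of "\<lambda>k. k mod N"] less by simp
  then have "(\<Sum>i<n. a (Suc i) * N ^ i) = (\<Sum>i<n. b (Suc i) * N ^ i)"
    using eq less by simp
  then have tail: "a (Suc j) = b (Suc j)" if "j < n" for j
    using Suc.IH[of "\<lambda>i. a (Suc i)" "\<lambda>i. b (Suc i)" j] Suc.prems(1,2) that
    by (meson Suc_less_eq)
  show ?case using 0 tail \<open>i < Suc n\<close> by (cases i) auto
qed simp

text \<open>Kronecker substitution: \<open>x\<^sub>i = t\<^bsup>N^i\<^esup>\<close> with \<open>N\<close> larger than all exponents keeps the
  monomials apart.\<close>

lemma eval_poly_eq_0_imp_eq_0: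
  fixes F :: "('v::finite, 'a::field_char_0) mpoly"
  assumes "\<And>x. eval_poly F x = 0"
  shows "F = 0"
proof (rule ccontr)
  assume "F \<noteq> 0"
  then have "Poly_Mapping.keys F \<noteq> {}"
    using mpoly_sum_singles[of F] by fastforce
  then obtain m0 where m0: "m0 \<in> Poly_Mapping.keys F" by blast
  obtain h :: "'v \<Rightarrow> nat" where h: "bij_betw h UNIV {..<CARD('v)}"
    using ex_bij_betw_finite_nat[of "UNIV :: 'v set"] by (auto simp: lessThan_atLeast0)
  define N where "N = Suc (Max (\<Union>m\<in>Poly_Mapping.keys F. range (Poly_Mapping.lookup m)))"
  have N: "Poly_Mapping.lookup m v < N" if "m \<in> Poly_Mapping.keys F" for m v
    unfolding N_def using that by (intro le_imp_less_Suc Max_ge) auto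
  define wt where "wt m = (\<Sum>v\<in>UNIV. Poly_Mapping.lookup m v * N ^ h v)" for m
  define g where "g = inv_into UNIV h"
  have g: "bij_betw g {..<CARD('v)} UNIV" unfolding g_def using h by (rule bij_betw_inv_into)
  have hg: "h (g i) = i" if "i < CARD('v)" for i
    unfolding g_def using h that by (simp add: bij_betw_inv_into_right)
  have wt_alt: "wt m = (\<Sum>i<CARD('v). Poly_Mapping.lookup m (g i) * N ^ i)" for m
    unfolding wt_def by (subst sum.reindex_bij_betw[OF g, symmetric]) (simp add: hg)
  have inj: "m = m0" if "m \<in> Poly_Mapping.keys F" "wt m = wt m0" for m
  proof (rule poly_mapping_eqI)
    fix v
    obtain i where i: "i < CARD('v)" "v = g i" using g by (metis UNIV_I bij_betw_iff_bijections lessThan_iff)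
    show "Poly_Mapping.lookup m v = Poly_Mapping.lookup m0 v"
      using base_expansion_inj[of "CARD('v)" "\<lambda>i. Poly_Mapping.lookup m (g i)" N "\<lambda>i. Poly_Mapping.lookup m0 (g i)" i]
        N that m0 i by (simp add: wt_alt)
  qed
  define p where "p = (\<Sum>m\<in>Poly_Mapping.keys F. Polynomial.monom (Poly_Mapping.lookup F m) (wt m))"
  have "poly p t = eval_poly F (\<chi> v. t ^ (N ^ h v))" for t
    by (simp add: p_def poly_sum poly_monom eval_poly_def wt_def power_sum mult.commute flip: power_mult)
  then have "p = 0" using assms poly_all_0_iff_0 by metis
  moreover have "coeff p (wt m0) = (\<Sum>m\<in>Poly_Mapping.keys F. if m = m0 then Poly_Mapping.lookup F m else 0)"
    unfolding p_def coeff_sum coeff_monom by (rule sum.cong) (use inj in auto)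
  ultimately show False using m0 by (simp add: in_keys_iff)
qed

lemma eval_poly_eqI:
  fixes F G :: "('v::finite, 'a::field_char_0) mpoly"
  assumes "\<And>x. eval_poly F x = eval_poly G x"
  shows "F = G"
  using eval_poly_eq_0_imp_eq_0[of "F - G"] assms by simp

section \<open>Forms and linear substitutions\<close>

lemma is_form_0 [simp]: "is_form d 0"
  by (simp add: is_form_def)

lemma is_form_add: "is_form d F \<Longrightarrow> is_form d G \<Longrightarrow> is_form d (F + G)"
  unfolding is_form_def using keys_add[of F G] by blast

lemma is_form_sum: "(\<And>i. i \<in> I \<Longrightarrow> is_form d (F i)) \<Longrightarrow> is_form d (\<Sum>i\<in>I. F i)"
  by (induction I rule: infinite_finite_induct) (auto intro: is_form_add)

lemma is_form_uminus: "is_form d F \<Longrightarrow> is_form d (- F)"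
  by (simp add: is_form_def in_keys_iff)

lemma is_form_diff: "is_form d F \<Longrightarrow> is_form d G \<Longrightarrow> is_form d (F - G)"
  using is_form_add[of d F "- G"] by (simp add: is_form_uminus)

lemma is_form_mult:
  assumes "is_form d F" "is_form e G"
  shows "is_form (d + e) (F * G)"
  unfolding is_form_def
proof
  fix m assume "m \<in> Poly_Mapping.keys (F * G)"
  then obtain a b where "m = a + b" "a \<in> Poly_Mapping.keys F" "b \<in> Poly_Mapping.keys G"
    using keys_mult[of F G] by auto
  then show "(\<Sum>v\<in>UNIV. Poly_Mapping.lookup m v) = d + e"
    using assms by (simp add: is_form_def lookup_add sum.distrib)
qed

lemma is_form_single: "is_form (\<Sum>v\<in>UNIV. Poly_Mapping.lookup m v) (Poly_Mapping.single m c)"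
  by (simp add: is_form_def)

lemma is_form_Const [simp]: "is_form 0 (Const c)"
  using is_form_single[of 0 c] by (simp add: Const_def)

lemma is_form_Var [simp]: "is_form (Suc 0) (Var v)"
  by (simp add: is_form_def Var_def lookup_single when_def)

lemma is_form_Const_mult: "is_form d F \<Longrightarrow> is_form d (Const c * F)"
  using is_form_mult[OF is_form_Const] by fastforce

lemma is_form_1: "is_form 0 1"
  using is_form_Const[of 1] by simp

lemma is_form_power: "is_form d F \<Longrightarrow> is_form (d * n) (F ^ n)"
  by (induction n) (auto intro: is_form_mult is_form_1)

lemma is_form_prod:
  "(\<And>i. i \<in> I \<Longrightarrow> is_form (d i) (F i)) \<Longrightarrow> is_form (\<Sum>i\<in>I. d i) (\<Prod>i\<in>I. F i)"
  by (induction I rule: infinite_finite_induct) (auto intro: is_form_mult is_form_1)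

lemma is_form_numeral: "is_form 0 (numeral n)"
  using is_form_Const[of "numeral n"] by (simp add: Const_numeral)

lemma is_form_0_imp_Const:
  assumes "is_form 0 F"
  obtains c where "F = Const c"
proof -
  have "m = 0" if "m \<in> Poly_Mapping.keys F" for m
    using assms that by (intro poly_mapping_eqI) (auto simp: is_form_def)
  then have "F = Const (Poly_Mapping.lookup F 0)"
    by (intro poly_mapping_eqI) (auto simp: Const_def lookup_single when_def in_keys_iff)
  then show ?thesis using that by blast
qed

lemma eval_poly_scale:
  assumes "is_form d F"
  shows "eval_poly F (c *s x) = c ^ d * eval_poly F x"
proof -
  have "(\<Prod>v\<in>UNIV. (c * x $ v) ^ Poly_Mapping.lookup m v) =
      c ^ d * (\<Prod>v\<in>UNIV. (x $ v) ^ Poly_Mapping.lookup m v)" if "m \<in> Poly_Mapping.keys F" for m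
    using assms that by (simp add: power_mult_distrib prod.distrib is_form_def flip: power_sum)
  then show ?thesis
    by (simp add: eval_poly_def sum_distrib_left mult_ac)
qed

lemma eval_poly_form_0: "is_form d F \<Longrightarrow> d > 0 \<Longrightarrow> eval_poly F 0 = 0"
  using eval_poly_scale[of d F 0 0] by (simp add: power_0_left)

lemma is_form_partial:
  assumes "is_form (Suc d) F"
  shows "is_form d (partial v F)"
  unfolding partial_def
proof (rule is_form_sum)
  fix m assume m: "m \<in> Poly_Mapping.keys F"
  let ?e = "Poly_Mapping.single v (1::nat)"
  show "is_form d (Poly_Mapping.single (m - ?e) (of_nat (Poly_Mapping.lookup m v) * Poly_Mapping.lookup F m))"
  proof (cases "Poly_Mapping.lookup m v = 0")
    case False
    then have "(m - ?e) + ?e = m"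
      by (intro poly_mapping_eqI) (auto simp: lookup_add lookup_minus lookup_single when_def)
    then have "(\<Sum>w\<in>UNIV. Poly_Mapping.lookup ((m - ?e) + ?e) w) = Suc d"
      using assms m by (simp add: is_form_def)
    then have "(\<Sum>w\<in>UNIV. Poly_Mapping.lookup (m - ?e) w) = d"
      unfolding lookup_add sum.distrib by (simp add: lookup_single when_def)
    then show ?thesis using is_form_single by metis
  qed simp
qed

lemma euler_identity:
  assumes "is_form d F"
  shows "(\<Sum>v\<in>UNIV. Var v * partial v F) = of_nat d * F"
proof -
  have 1: "(\<Sum>v\<in>UNIV. Var v * partial v (Poly_Mapping.single m c)) =
      of_nat (\<Sum>v\<in>UNIV. Poly_Mapping.lookup m v) * Poly_Mapping.single m c" for m c
  proof -
    have "Var v * partial v (Poly_Mapping.single m c) =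
        of_nat (Poly_Mapping.lookup m v) * Poly_Mapping.single m c" for v
    proof (cases "Poly_Mapping.lookup m v = 0")
      case False
      then have "Poly_Mapping.single v (1::nat) + (m - Poly_Mapping.single v 1) = m"
        by (intro poly_mapping_eqI) (auto simp: lookup_add lookup_minus lookup_single when_def)
      then show ?thesis
        by (simp add: Var_def partial_single mult_single flip: single_of_nat)
    qed (simp add: partial_single)
    then show ?thesis by (simp add: sum_distrib_right)
  qed
  let ?s = "\<lambda>m. Poly_Mapping.single m (Poly_Mapping.lookup F m)"
  have "(\<Sum>v\<in>UNIV. Var v * partial v F) = (\<Sum>v\<in>UNIV. \<Sum>m\<in>Poly_Mapping.keys F. Var v * partial v (?s m))"
    by (subst mpoly_sum_singles[of F]) (simp add: partial_sum sum_distrib_left)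
  also have "\<dots> = (\<Sum>m\<in>Poly_Mapping.keys F. \<Sum>v\<in>UNIV. Var v * partial v (?s m))"
    by (rule sum.swap)
  also have "\<dots> = (\<Sum>m\<in>Poly_Mapping.keys F. of_nat d * ?s m)"
    by (rule sum.cong) (use assms in \<open>auto simp: 1 is_form_def\<close>)
  also have "\<dots> = of_nat d * F"
    by (subst (2) mpoly_sum_singles[of F]) (simp add: sum_distrib_left)
  finally show ?thesis .
qed

text \<open>The partial derivatives of a linear form are forms of degree 0, hence constants, and
  Euler's identity reassembles the form from them.\<close>

lemma linear_form_eval:
  assumes "is_form 1 F"
  obtains c where "\<And>v. partial v F = Const (c $ v)" "\<And>x. eval_poly F x = (\<Sum>v\<in>UNIV. c $ v * x $ v)"
proof -
  have "\<exists>a. partial v F = Const a" for v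
    using is_form_partial[of 0 F v] assms is_form_0_imp_Const by (metis One_nat_def)
  then obtain a where a: "\<And>v. partial v F = Const (a v)" by metis
  have "eval_poly F x = (\<Sum>v\<in>UNIV. (\<chi> v. a v) $ v * x $ v)" for x
  proof -
    have "eval_poly F x = eval_poly (\<Sum>v\<in>UNIV. Var v * partial v F) x"
      using euler_identity[OF assms] by simp
    then show ?thesis by (simp add: eval_poly_sum a mult.commute)
  qed
  then show ?thesis using that[of "\<chi> v. a v"] a by simp
qed

section \<open>Homogeneous parts\<close>

definition homogeneous_part :: "nat \<Rightarrow> ('v::finite, 'a::comm_ring_1) mpoly \<Rightarrow> ('v, 'a) mpoly" where
  "homogeneous_part d F =
     (\<Sum>m\<in>{m \<in> Poly_Mapping.keys F. (\<Sum>v\<in>UNIV. Poly_Mapping.lookup m v) = d}.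
        Poly_Mapping.single m (Poly_Mapping.lookup F m))"

lemma lookup_homogeneous_part:
  "Poly_Mapping.lookup (homogeneous_part d F) m =
     (if (\<Sum>v\<in>UNIV. Poly_Mapping.lookup m v) = d then Poly_Mapping.lookup F m else 0)"
proof -
  have "Poly_Mapping.lookup (homogeneous_part d F) m =
      (\<Sum>k\<in>{m \<in> Poly_Mapping.keys F. (\<Sum>v\<in>UNIV. Poly_Mapping.lookup m v) = d}.
        if k = m then Poly_Mapping.lookup F k else 0)"
    by (simp add: homogeneous_part_def lookup_sum lookup_single when_def)
  then show ?thesis by (subst (asm) sum.delta) (auto simp: in_keys_iff)
qed

lemma is_form_homogeneous_part: "is_form d (homogeneous_part d F)"
  by (auto simp: is_form_def in_keys_iff lookup_homogeneous_part split: if_splits)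

lemma homogeneous_part_add:
  "homogeneous_part d (F + G) = homogeneous_part d F + homogeneous_part d G"
  by (rule poly_mapping_eqI) (simp add: lookup_homogeneous_part lookup_add)

lemma homogeneous_part_form:
  assumes "is_form e F"
  shows "homogeneous_part d F = (if d = e then F else 0)"
  by (rule poly_mapping_eqI) (use assms in \<open>auto simp: lookup_homogeneous_part is_form_def in_keys_iff\<close>)

lemma homogeneous_part_0 [simp]: "homogeneous_part d 0 = 0"
  by (rule poly_mapping_eqI) (simp add: lookup_homogeneous_part)

text \<open>Lets a membership in \<open>(Q, F)\<close> be rewritten with homogeneous coefficients of
  the right degrees.\<close>

lemma homogeneous_part_mult_form:
  assumes "is_form e F" "e \<le> d"
  shows "homogeneous_part d (A * F) = homogeneous_part (d - e) A * F"
proof (induction A rule: mpoly_single_induct)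
  case (single m c)
  let ?n = "\<Sum>v\<in>UNIV. Poly_Mapping.lookup m v"
  have "is_form (?n + e) (Poly_Mapping.single m c * F)"
    using assms by (intro is_form_mult is_form_single)
  then show ?case
    using assms by (auto simp: homogeneous_part_form[OF is_form_single] homogeneous_part_form)
qed (simp add: homogeneous_part_add distrib_right)

text \<open>Formulated through values instead of exponents: the coordinates in \<open>V\<close> can
  then be overwritten when points are constructed, and closure under the ring operations is
  immediate.\<close>

definition indep_of :: "'v set \<Rightarrow> ('v::finite, 'a::comm_ring_1) mpoly \<Rightarrow> bool" where
  "indep_of V F \<longleftrightarrow> (\<forall>x y. (\<forall>w. w \<notin> V \<longrightarrow> x $ w = y $ w) \<longrightarrow> eval_poly F x = eval_poly F y)"

lemma indep_of_intros [simp]: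
  "indep_of V (Const c)" "indep_of V 0" "indep_of V 1" "indep_of V (numeral k)"
  "w \<notin> V \<Longrightarrow> indep_of V (Var w)"
  "indep_of V F \<Longrightarrow> indep_of V G \<Longrightarrow> indep_of V (F + G)"
  "indep_of V F \<Longrightarrow> indep_of V G \<Longrightarrow> indep_of V (F - G)"
  "indep_of V F \<Longrightarrow> indep_of V (- F)"
  "indep_of V F \<Longrightarrow> indep_of V G \<Longrightarrow> indep_of V (F * G)"
  "indep_of V F \<Longrightarrow> indep_of V (F ^ n)"
  unfolding indep_of_def eval_poly_add eval_poly_mult eval_poly_diff eval_poly_uminus
    eval_poly_power eval_poly_Const eval_poly_Var eval_poly_0 eval_poly_1 eval_poly_numeral
  by metis+

text \<open>Expansion to first order in \<open>v\<close>; \<open>F0\<close> takes the values of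
  \<open>F\<close> at \<open>v = 0\<close>.\<close>

lemma split_off_variable:
  "\<exists>F0 F1. F = F0 + Var v * F1 \<and> indep_of {v} F0"
proof (induction F rule: mpoly_induct)
  case (Const c)
  show ?case by (rule exI[of _ "Const c"], rule exI[of _ 0]) simp
next
  case (Var w)
  show ?case
  proof (cases "w = v")
    case True
    then show ?thesis by (intro exI[of _ 0] exI[of _ 1]) simp
  next
    case False
    then show ?thesis by (intro exI[of _ "Var w"] exI[of _ 0]) simp
  qed
next
  case (add F G)
  then obtain F0 F1 G0 G1 where "F = F0 + Var v * F1" "G = G0 + Var v * G1"
    and *: "indep_of {v} F0" "indep_of {v} G0" by blast
  then have "F + G = (F0 + G0) + Var v * (F1 + G1)" by (simp add: algebra_simps)
  then show ?case using * indep_of_intros(6) by blast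
next
  case (mult F G)
  then obtain F0 F1 G0 G1 where "F = F0 + Var v * F1" "G = G0 + Var v * G1"
    and *: "indep_of {v} F0" "indep_of {v} G0" by blast
  then have "F * G = (F0 * G0) + Var v * (F0 * G1 + F1 * G0 + Var v * F1 * G1)"
    by (simp add: algebra_simps)
  then show ?case using * indep_of_intros(9) by blast
qed

text \<open>Factor theorem for a coordinate hyperplane: the part free of \<open>v\<close> takes all
  its values already on the hyperplane, so it is zero.\<close>

lemma vanishing_on_hyperplane:
  fixes F :: "('v::finite, 'a::field_char_0) mpoly"
  assumes "\<And>x. x $ v = 0 \<Longrightarrow> eval_poly F x = 0"
  obtains G where "F = Var v * G"
proof -
  obtain F0 F1 where F: "F = F0 + Var v * F1" and F0: "indep_of {v} F0"
    using split_off_variable by blast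
  have "eval_poly F0 x = 0" for x
  proof -
    let ?y = "\<chi> w. if w = v then 0 else x $ w"
    have "eval_poly F ?y = 0" by (rule assms) simp
    then have "eval_poly F0 ?y = 0" by (simp add: F)
    moreover have "eval_poly F0 x = eval_poly F0 ?y"
      using F0 unfolding indep_of_def by simp
    ultimately show ?thesis by simp
  qed
  then have "F0 = 0" by (rule eval_poly_eq_0_imp_eq_0)
  then show ?thesis using that F by simp
qed

text \<open>The working substitute for irreducibility: along a polynomial curve both factors become
  univariate polynomials, and these have no zero divisors.\<close>

lemma zero_product_along_curve:
  fixes F G :: "('v::finite, 'a::field_char_0) mpoly"
  assumes "\<And>t. eval_poly F (\<chi> v. poly (\<gamma> v) t) * eval_poly G (\<chi> v. poly (\<gamma> v) t) = 0"
    and "eval_poly F (\<chi> v. poly (\<gamma> v) s) \<noteq> 0"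
  shows "eval_poly G (\<chi> v. poly (\<gamma> v) t) = 0"
proof -
  obtain p q where p: "\<And>t. poly p t = eval_poly F (\<chi> v. poly (\<gamma> v) t)"
    and q: "\<And>t. poly q t = eval_poly G (\<chi> v. poly (\<gamma> v) t)"
    using eval_poly_along_curve by metis
  have "poly (p * q) t = 0" for t using assms(1) by (simp add: p q)
  then have "p * q = 0" using poly_all_0_iff_0 by blast
  moreover have "p \<noteq> 0" using assms(2) p by force
  ultimately have "q = 0" by simp
  then show ?thesis using q by (metis poly_0)
qed

lemma zero_product_on_line:
  fixes F G :: "('v::finite, 'a::field_char_0) mpoly"
  assumes "\<And>t. eval_poly F (x + t *s (y - x)) * eval_poly G (x + t *s (y - x)) = 0"
    and "eval_poly F x \<noteq> 0"
  shows "eval_poly G y = 0"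
proof -
  let ?\<gamma> = "\<lambda>v. [:x $ v, y $ v - x $ v:]"
  have *: "(\<chi> v. poly (?\<gamma> v) t) = x + t *s (y - x)" for t
    by (simp add: vec_eq_iff)
  show ?thesis
    using zero_product_along_curve[of F ?\<gamma> G 0 1] assms unfolding * by simp
qed

text \<open>A point where \<open>G\<close> is nonzero is joined by a line to an arbitrary point, at
  which \<open>F\<close> must then vanish.\<close>

lemma mpoly_mult_eq_0_imp:
  fixes F G :: "('v::finite, 'a::field_char_0) mpoly"
  assumes "F * G = 0"
  shows "F = 0 \<or> G = 0"
proof (rule disjCI)
  assume "G \<noteq> 0"
  then obtain x where x: "eval_poly G x \<noteq> 0" using eval_poly_eq_0_imp_eq_0 by blast
  have 0: "eval_poly G z * eval_poly F z = 0" for z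
    using arg_cong[OF assms, of "\<lambda>H. eval_poly H z"] by (simp add: mult.commute)
  show "F = 0"
    using zero_product_on_line[of G x _ F] 0 x by (intro eval_poly_eq_0_imp_eq_0) blast
qed

lemma mpoly_mult_left_cancel:
  fixes F G H :: "('v::finite, 'a::field_char_0) mpoly"
  assumes "F * G = F * H" "F \<noteq> 0"
  shows "G = H"
  using mpoly_mult_eq_0_imp[of F "G - H"] assms by (simp add: algebra_simps)

lemma Var_neq_0: "Var v \<noteq> (0 :: ('v::finite, 'a::comm_ring_1) mpoly)"
proof
  assume "Var v = (0 :: ('v, 'a) mpoly)"
  then have "eval_poly (Var v) ((\<chi> v. 1) :: 'a ^ 'v) = 0" by simp
  then show False by simp
qed

lemma Const_eq_iff [simp]: "Const a = Const b \<longleftrightarrow> a = b"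
  by (metis Const_def lookup_single_eq)

section \<open>Linear substitutions and the chain rule\<close>

definition pullback :: "'a ^ 'v ^ 'v \<Rightarrow> ('v::finite, 'a::comm_ring_1) mpoly \<Rightarrow> ('v, 'a) mpoly" where
  "pullback M F = (\<Sum>m\<in>Poly_Mapping.keys F. Const (Poly_Mapping.lookup F m) *
     (\<Prod>v\<in>UNIV. (\<Sum>w\<in>UNIV. Const (M $ v $ w) * Var w) ^ Poly_Mapping.lookup m v))"

lemma eval_poly_prod: "eval_poly (\<Prod>i\<in>I. F i) x = (\<Prod>i\<in>I. eval_poly (F i) x)"
  by (induction I rule: infinite_finite_induct) auto

lemma eval_poly_pullback [simp]: "eval_poly (pullback M F) x = eval_poly F (M *v x)"
  by (simp add: pullback_def eval_poly_sum eval_poly_prod eval_poly_def[of F] matrix_vector_mult_def)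

lemma is_form_pullback:
  assumes "is_form d F"
  shows "is_form d (pullback M F)"
  unfolding pullback_def
proof (intro is_form_sum is_form_Const_mult)
  fix m assume "m \<in> Poly_Mapping.keys F"
  then have d: "(\<Sum>v\<in>UNIV. 1 * Poly_Mapping.lookup m v) = d" using assms by (simp add: is_form_def)
  show "is_form d (\<Prod>v\<in>UNIV. (\<Sum>w\<in>UNIV. Const (M $ v $ w) * Var w) ^ Poly_Mapping.lookup m v)"
    unfolding d[symmetric]
    by (intro is_form_prod is_form_power is_form_sum is_form_Const_mult) simp
qed

context
  fixes M :: "'a::field_char_0 ^ 'v::finite ^ 'v"
begin

lemma pullback_add: "pullback M (F + G) = pullback M F + pullback M G"
  by (rule eval_poly_eqI) simp

lemma pullback_mult: "pullback M (F * G) = pullback M F * pullback M G"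
  by (rule eval_poly_eqI) simp

lemma pullback_Const [simp]: "pullback M (Const c) = Const c"
  by (rule eval_poly_eqI) simp

lemma pullback_0 [simp]: "pullback M 0 = 0"
  by (rule eval_poly_eqI) simp

lemma pullback_1 [simp]: "pullback M 1 = 1"
  by (rule eval_poly_eqI) simp

lemma pullback_Var: "pullback M (Var v) = (\<Sum>w\<in>UNIV. Const (M $ v $ w) * Var w)"
  by (rule eval_poly_eqI) (simp add: eval_poly_sum matrix_vector_mult_def)

lemma pullback_pullback: "pullback N (pullback M F) = pullback (M ** N) F"
  by (rule eval_poly_eqI) (simp add: matrix_vector_mul_assoc)

lemma pullback_mat_1 [simp]: "pullback (mat 1) F = (F :: ('v, 'a) mpoly)"
  by (rule eval_poly_eqI) simp

lemma partial_pullback: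
  "partial v (pullback M F) = (\<Sum>w\<in>UNIV. Const (M $ w $ v) * pullback M (partial w F))"
proof (induction F rule: mpoly_induct)
  case (Var u)
  have "partial v (pullback M (Var u)) = (\<Sum>w\<in>UNIV. if w = v then Const (M $ u $ w) else 0)"
    by (simp add: pullback_Var partial_sum partial_mult partial_Var if_distrib cong: if_cong)
  also have "\<dots> = Const (M $ u $ v)" by simp
  also have "\<dots> = (\<Sum>w\<in>UNIV. if w = u then Const (M $ w $ v) else 0)" by simp
  also have "\<dots> = (\<Sum>w\<in>UNIV. Const (M $ w $ v) * pullback M (partial w (Var u)))"
    by (rule sum.cong) (auto simp: partial_Var)
  finally show ?case .
next
  case (mult F G)
  then show ?case
    by (simp add: pullback_mult pullback_add partial_mult algebra_simps sum.distrib sum_distrib_left)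
qed (simp_all add: pullback_add distrib_left sum.distrib)

end

section \<open>Reducedness on the Pluecker quadric\<close>

lemma UNIV_pl: "(UNIV :: pl set) = {P01, P02, P03, P12, P13, P23}"
  using pl.exhaust by blast

lemma sum_pl: "(\<Sum>I\<in>UNIV. f I) = f P01 + f P02 + f P03 + f P12 + f P13 + f P23"
  for f :: "pl \<Rightarrow> 'b::comm_monoid_add"
  by (simp add: UNIV_pl add.assoc)

lemma all_pl: "(\<forall>I. R I) \<longleftrightarrow> R P01 \<and> R P02 \<and> R P03 \<and> R P12 \<and> R P13 \<and> R P23"
  by (metis pl.exhaust)

lemma eval_pluckerQ [simp]:
  "eval_poly pluckerQ x = x $ P01 * x $ P23 - x $ P02 * x $ P13 + x $ P03 * x $ P12"
  by (simp add: pluckerQ_def)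

definition pl_vec :: "'a \<Rightarrow> 'a \<Rightarrow> 'a \<Rightarrow> 'a \<Rightarrow> 'a \<Rightarrow> 'a \<Rightarrow> 'a ^ pl" where
  "pl_vec a b c d e f = (\<chi> I. case I of
     P01 \<Rightarrow> a | P02 \<Rightarrow> b | P03 \<Rightarrow> c | P12 \<Rightarrow> d | P13 \<Rightarrow> e | P23 \<Rightarrow> f)"

lemma pl_vec_nth [simp]:
  "pl_vec a b c d e f $ P01 = a" "pl_vec a b c d e f $ P02 = b" "pl_vec a b c d e f $ P03 = c"
  "pl_vec a b c d e f $ P12 = d" "pl_vec a b c d e f $ P13 = e" "pl_vec a b c d e f $ P23 = f"
  by (simp_all add: pl_vec_def)

lemma ideal2_add: "x \<in> ideal2 P R \<Longrightarrow> y \<in> ideal2 P R \<Longrightarrow> x + y \<in> ideal2 P R"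
proof -
  assume "x \<in> ideal2 P R" "y \<in> ideal2 P R"
  then obtain a b c d where "x = a * P + b * R" "y = c * P + d * R" by (auto simp: ideal2_def)
  then have "x + y = (a + c) * P + (b + d) * R" by (simp add: algebra_simps)
  then show ?thesis by (auto simp: ideal2_def)
qed

lemma ideal2_mult: "x \<in> ideal2 P R \<Longrightarrow> c * x \<in> ideal2 P R"
proof -
  assume "x \<in> ideal2 P R"
  then obtain a b where "x = a * P + b * R" by (auto simp: ideal2_def)
  then have "c * x = (c * a) * P + (c * b) * R" by (simp add: algebra_simps)
  then show ?thesis by (auto simp: ideal2_def)
qed

lemma ideal2_mult': "x \<in> ideal2 P R \<Longrightarrow> x * c \<in> ideal2 P R"
  using ideal2_mult[of x P R c] by (simp add: mult.commute)

lemma ideal2_0 [simp]: "0 \<in> ideal2 P R"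
  unfolding ideal2_def by (rule CollectI, rule exI[of _ 0], rule exI[of _ 0]) simp

text \<open>The conclusion of the Nullstellensatz for a radical ideal \<open>(Q, F)\<close>. It
  gives radicality and also expresses every other form with the same zeros through \<open>Q\<close>
  and \<open>F\<close>.\<close>

definition reduced_section :: "(pl, 'a::field) mpoly \<Rightarrow> bool" where
  "reduced_section F \<longleftrightarrow>
     (\<forall>H. (\<forall>x. eval_poly pluckerQ x = 0 \<longrightarrow> eval_poly F x = 0 \<longrightarrow> eval_poly H x = 0) \<longrightarrow>
        H \<in> ideal2 pluckerQ F)"

text \<open>On the slice \<open>p01 = 0\<close> the equation \<open>Q = 0\<close> reads
  \<open>p02 * p13 = p03 * p12\<close>, so \<open>p13\<close> can be eliminated at the cost of a
  power of \<open>p02\<close>.\<close>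

lemma P01_P02_slice_reduce:
  fixes Y :: "(pl, 'a::field_char_0) mpoly"
  shows "\<exists>N A U W. Var P02 ^ N * Y = A + Var P01 * U + pluckerQ * W \<and> indep_of {P01, P13} A"
proof (induction Y rule: mpoly_induct)
  case (Const c)
  show ?case by (rule exI[of _ 0], rule exI[of _ "Const c"], rule exI[of _ 0], rule exI[of _ 0]) simp
next
  case (Var v)
  consider "v = P01" | "v = P13" | "v \<noteq> P01" "v \<noteq> P13" by blast
  then show ?case
  proof cases
    case 1
    then show ?thesis
      by (intro exI[of _ 0] exI[of _ 1] conjI) (auto intro: exI[of _ 0])
  next
    case 2
    then have "Var P02 ^ 1 * Var v = Var P03 * Var P12 + Var P01 * Var P23 + pluckerQ * (- 1 :: (pl, 'a) mpoly)"
      by (simp add: pluckerQ_def)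
    moreover have "indep_of {P01, P13} (Var P03 * Var P12 :: (pl, 'a) mpoly)" by simp
    ultimately show ?thesis by blast
  next
    case 3
    then show ?thesis
      by (intro exI[of _ 0] exI[of _ "Var v"]) (auto intro: exI[of _ 0])
  qed
next
  case (add F G)
  then obtain N A U W N' A' U' W' where
    "Var P02 ^ N * F = A + Var P01 * U + pluckerQ * W" "indep_of {P01, P13} A"
    "Var P02 ^ N' * G = A' + Var P01 * U' + pluckerQ * W'" "indep_of {P01, P13} A'"
    by blast
  note * = this
  have "Var P02 ^ (N + N') * (F + G) =
      Var P02 ^ N' * (Var P02 ^ N * F) + Var P02 ^ N * (Var P02 ^ N' * G)"
    by (simp add: algebra_simps power_add)
  also have "\<dots> = (Var P02 ^ N' * A + Var P02 ^ N * A') +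
      Var P01 * (Var P02 ^ N' * U + Var P02 ^ N * U') + pluckerQ * (Var P02 ^ N' * W + Var P02 ^ N * W')"
    unfolding * by (simp add: algebra_simps)
  finally have "Var P02 ^ (N + N') * (F + G) = \<dots>" .
  moreover have "indep_of {P01, P13} (Var P02 ^ N' * A + Var P02 ^ N * A')"
    using * by simp
  ultimately show ?case by blast
next
  case (mult F G)
  then obtain N A U W N' A' U' W' where
    "Var P02 ^ N * F = A + Var P01 * U + pluckerQ * W" "indep_of {P01, P13} A"
    "Var P02 ^ N' * G = A' + Var P01 * U' + pluckerQ * W'" "indep_of {P01, P13} A'"
    by blast
  note * = this
  have "Var P02 ^ (N + N') * (F * G) = (Var P02 ^ N * F) * (Var P02 ^ N' * G)"
    by (simp add: algebra_simps power_add)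
  also have "\<dots> = A * A' + Var P01 * (U * A' + (A + Var P01 * U + pluckerQ * W) * U') +
      pluckerQ * (W * A' + (A + Var P01 * U + pluckerQ * W) * W')"
    unfolding * by (simp add: algebra_simps)
  finally have "Var P02 ^ (N + N') * (F * G) = \<dots>" .
  moreover have "indep_of {P01, P13} (A * A')"
    using * by simp
  ultimately show ?case by blast
qed

text \<open>\<open>p02\<close> is a nonzerodivisor modulo \<open>(p01, Q)\<close>: since
  \<open>Q\<close> does not vanish identically on \<open>p01 = p02 = 0\<close>, the coefficient
  \<open>W\<close> vanishes there and is divisible by \<open>p02\<close> modulo
  \<open>p01\<close>.\<close>

lemma P02_cancel_in_slice:
  fixes Y :: "(pl, 'a::field_char_0) mpoly"
  assumes eq: "Var P02 * Y = Var P01 * U + pluckerQ * W"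
  shows "\<exists>U W. Y = Var P01 * U + pluckerQ * W"
proof -
  obtain W0 W1 where W: "W = W0 + Var P01 * W1" and W0: "indep_of {P01} W0"
    using split_off_variable by blast
  have "eval_poly W0 x = 0" if "x $ P02 = 0" for x
  proof -
    define y where "y = (\<chi> I. if I = P01 then 0 else x $ I)"
    have y: "y $ P01 = 0" "y $ P02 = 0" using that by (auto simp: y_def)
    have "eval_poly W y = 0"
    \<comment> \<open>On \<open>p01 = p02 = 0\<close> the polynomial \<open>Q\<close> is
      \<open>p03 * p12\<close>, which is 1 at the base point.\<close>
    proof (rule zero_product_on_line[of "Var P03 * Var P12" "pl_vec 0 0 1 1 0 0"])
      fix t
      let ?z = "pl_vec 0 0 1 1 0 0 + t *s (y - pl_vec 0 0 1 1 0 0)"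
      show "eval_poly (Var P03 * Var P12) ?z * eval_poly W ?z = 0"
        using arg_cong[OF eq, of "\<lambda>H. eval_poly H ?z"] y by simp
    qed simp
    moreover have "eval_poly W0 x = eval_poly W0 y"
      using W0 unfolding indep_of_def by (simp add: y_def)
    ultimately show ?thesis by (simp add: W y)
  qed
  then obtain Z where Z: "W0 = Var P02 * Z" by (rule vanishing_on_hyperplane)
  have eq2: "Var P02 * (Y - pluckerQ * Z) = Var P01 * (U + pluckerQ * W1)"
    using eq by (simp add: W Z algebra_simps)
  have "eval_poly (U + pluckerQ * W1) x = 0" if "x $ P02 = 0" for x
  proof (rule zero_product_on_line[of "Var P01" "pl_vec 1 0 0 0 0 0"])
    fix t
    let ?z = "pl_vec 1 0 0 0 0 0 + t *s (x - pl_vec 1 0 0 0 0 0)"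
    show "eval_poly (Var P01) ?z * eval_poly (U + pluckerQ * W1) ?z = 0"
      using arg_cong[OF eq2, of "\<lambda>H. eval_poly H ?z"] that by simp
  qed simp
  then obtain V where "U + pluckerQ * W1 = Var P02 * V" by (rule vanishing_on_hyperplane)
  then have "Var P02 * (Y - pluckerQ * Z) = Var P02 * (Var P01 * V)"
    using eq2 by (simp add: mult_ac)
  then have "Y - pluckerQ * Z = Var P01 * V"
    by (rule mpoly_mult_left_cancel) (rule Var_neq_0)
  then have "Y = Var P01 * V + pluckerQ * Z" by (simp add: algebra_simps)
  then show ?thesis by blast
qed

text \<open>The remainder \<open>A\<close> vanishes wherever \<open>p02 \<noteq> 0\<close>, because
  a suitable \<open>p13\<close> puts the point on the slice and \<open>A\<close> does not depend on
  it. So \<open>A = 0\<close>, and the power of \<open>p02\<close> cancels.\<close>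

lemma P01_slice_ideal:
  fixes Y :: "(pl, 'a::field_char_0) mpoly"
  assumes "\<And>x. x $ P01 = 0 \<Longrightarrow> eval_poly pluckerQ x = 0 \<Longrightarrow> eval_poly Y x = 0"
  shows "\<exists>U W. Y = Var P01 * U + pluckerQ * W"
proof -
  obtain N A U W where eq: "Var P02 ^ N * Y = A + Var P01 * U + pluckerQ * W"
    and A: "indep_of {P01, P13} A"
    using P01_P02_slice_reduce by blast
  have "eval_poly (Var P02 * A) x = 0" for x
  proof (cases "x $ P02 = 0")
    case False
    define y where "y = (\<chi> I. if I = P01 then 0 else if I = P13 then x $ P03 * x $ P12 / x $ P02 else x $ I)"
    have y: "y $ P01 = 0" "eval_poly pluckerQ y = 0"
      using False by (auto simp: y_def)
    then have "eval_poly A y = 0"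
      using assms[of y] arg_cong[OF eq, of "\<lambda>H. eval_poly H y"] by simp
    moreover have "eval_poly A x = eval_poly A y"
      using A unfolding indep_of_def by (simp add: y_def)
    ultimately show ?thesis by simp
  qed simp
  then have "A = 0"
    using eval_poly_eq_0_imp_eq_0 mpoly_mult_eq_0_imp Var_neq_0 by metis
  then have "\<exists>U W. Var P02 ^ N * Y = Var P01 * U + pluckerQ * W"
    using eq by auto
  then show ?thesis
  proof (induction N)
    case (Suc N)
    then show ?case using P02_cancel_in_slice[of "Var P02 ^ N * Y"] by (auto simp: mult.assoc)
  qed simp
qed

text \<open>A singular 2x2 matrix is a column times a row. On \<open>p01 = 0\<close> the points of
  the quadric are such matrices with entries \<open>p02, p03, p12, p13\<close>, together with a free
  \<open>p23\<close>.\<close>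

lemma rank_one_factorization:
  fixes a b c d :: "'a::field"
  assumes "a * d = b * c"
  shows "\<exists>x y s t. a = x * s \<and> b = x * t \<and> c = y * s \<and> d = y * t"
proof (cases "a = 0")
  case False
  then show ?thesis
    using assms by (intro exI[of _ a] exI[of _ c] exI[of _ 1] exI[of _ "b / a"]) (simp add: field_simps)
next
  case True
  show ?thesis
  proof (cases "b = 0")
    case False
    then have "c = 0" using True assms by simp
    then show ?thesis
      using True False by (intro exI[of _ b] exI[of _ "d / b"] exI[of _ 0] exI[of _ 1]) simp
  next
    case b: True
    then show ?thesis
      using True by (intro exI[of _ 0] exI[of _ 1] exI[of _ c] exI[of _ d]) simp
  qed
qed

text \<open>In \<open>p01 * H = X * Q + Y * F\<close> the product \<open>Y * F\<close> vanishes on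
  the irreducible slice, so \<open>Y\<close> does and lies in \<open>(p01, Q)\<close>. What is left
  is a multiple of \<open>Q\<close>, from which \<open>p01\<close> cancels because \<open>Q\<close>
  is nonzero on \<open>p01 = 0\<close>.\<close>

lemma P01_cancel:
  fixes F H :: "(pl, 'a::field_char_0) mpoly"
  assumes mem: "Var P01 * H \<in> ideal2 pluckerQ F"
    and x: "x $ P01 = 0" "eval_poly pluckerQ x = 0" "eval_poly F x \<noteq> 0"
  shows "H \<in> ideal2 pluckerQ F"
proof -
  obtain X Y where eq: "Var P01 * H = X * pluckerQ + Y * F"
    using mem by (auto simp: ideal2_def)
  have "eval_poly Y y = 0" if y: "y $ P01 = 0" "eval_poly pluckerQ y = 0" for y
  proof -
    obtain a b s t where x': "x $ P02 = a * s" "x $ P03 = a * t" "x $ P12 = b * s" "x $ P13 = b * t"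
      using x rank_one_factorization[of "x $ P02" "x $ P13" "x $ P03" "x $ P12"] by auto
    obtain a' b' s' t' where y': "y $ P02 = a' * s'" "y $ P03 = a' * t'" "y $ P12 = b' * s'" "y $ P13 = b' * t'"
      using y rank_one_factorization[of "y $ P02" "y $ P13" "y $ P03" "y $ P12"] by auto
    \<comment> \<open>Column and row factors move linearly, so the matrix keeps rank at most one and
      the curve stays on the slice.\<close>
    define \<gamma> where "\<gamma> I = (case I of P01 \<Rightarrow> 0 | P02 \<Rightarrow> [:a, a' - a:] * [:s, s' - s:]
      | P03 \<Rightarrow> [:a, a' - a:] * [:t, t' - t:] | P12 \<Rightarrow> [:b, b' - b:] * [:s, s' - s:]
      | P13 \<Rightarrow> [:b, b' - b:] * [:t, t' - t:] | P23 \<Rightarrow> [:x $ P23, y $ P23 - x $ P23:])" for I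
    have 0: "(\<chi> I. poly (\<gamma> I) 0) = x" and 1: "(\<chi> I. poly (\<gamma> I) 1) = y"
      using x y by (simp_all add: vec_eq_iff all_pl \<gamma>_def x' y' algebra_simps)
    have "eval_poly F (\<chi> I. poly (\<gamma> I) r) * eval_poly Y (\<chi> I. poly (\<gamma> I) r) = 0" for r
    proof -
      let ?w = "\<chi> I. poly (\<gamma> I) r"
      have w: "?w $ P01 = 0" "eval_poly pluckerQ ?w = 0"
        by (simp_all add: \<gamma>_def algebra_simps)
      have "eval_poly (Var P01 * H) ?w = eval_poly (X * pluckerQ + Y * F) ?w"
        by (simp only: eq)
      then show ?thesis
        unfolding eval_poly_add eval_poly_mult w eval_poly_Var by (auto simp: mult.commute)
    qed
    from zero_product_along_curve[OF this, of 0 1] x show ?thesis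
      by (simp add: 0 1)
  qed
  then obtain U W where Y: "Y = Var P01 * U + pluckerQ * W"
    using P01_slice_ideal by blast
  have eq2: "Var P01 * (H - U * F) = pluckerQ * (X + W * F)"
    using eq by (simp add: Y algebra_simps)
  have "eval_poly (X + W * F) y = 0" if "y $ P01 = 0" for y
  \<comment> \<open>The base point has \<open>p01 = 0\<close> and \<open>p02 = p13 = 1\<close>, so
    \<open>Q\<close> is -1 there.\<close>
  proof (rule zero_product_on_line[of pluckerQ "pl_vec 0 1 0 0 1 0"])
    fix r
    let ?z = "pl_vec 0 1 0 0 1 0 + r *s (y - pl_vec 0 1 0 0 1 0)"
    show "eval_poly pluckerQ ?z * eval_poly (X + W * F) ?z = 0"
      using arg_cong[OF eq2, of "\<lambda>H. eval_poly H ?z"] that unfolding eval_poly_mult by simp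
  qed simp
  then obtain V where "X + W * F = Var P01 * V" by (rule vanishing_on_hyperplane)
  then have "Var P01 * (H - U * F) = Var P01 * (V * pluckerQ)"
    using eq2 by (simp add: mult_ac)
  then have "H - U * F = V * pluckerQ"
    by (rule mpoly_mult_left_cancel) (rule Var_neq_0)
  then have "H = V * pluckerQ + U * F" by (simp add: algebra_simps)
  then show ?thesis by (auto simp: ideal2_def)
qed

text \<open>Division with remainder with powers of \<open>p01\<close> as denominators:
  \<open>Q\<close> eliminates \<open>p23\<close>, and the quadratic relation lowers the degree in
  \<open>p13\<close> to at most 1.\<close>

lemma P01_chart_reduce:
  fixes F H :: "(pl, 'a::field_char_0) mpoly"
  assumes rel: "Var P01 ^ k * Var P13 ^ 2 - b * Var P13 - g \<in> ideal2 pluckerQ F"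
    and ind: "indep_of {P13, P23} b" "indep_of {P13, P23} g"
  shows "\<exists>N A B. Var P01 ^ N * H - (A + B * Var P13) \<in> ideal2 pluckerQ F \<and>
           indep_of {P13, P23} A \<and> indep_of {P13, P23} B"
proof (induction H rule: mpoly_induct)
  case (Const c)
  show ?case
    by (rule exI[of _ 0], rule exI[of _ "Const c"], rule exI[of _ 0]) simp
next
  case (Var v)
  consider "v = P13" | "v = P23" | "v \<noteq> P13" "v \<noteq> P23" by blast
  then show ?case
  proof cases
    case 1
    then show ?thesis
      by (intro exI[of _ 0] exI[of _ 0] exI[of _ 1]) simp
  next
    case 2
    have "Var P01 ^ 1 * Var v - (- Var P03 * Var P12 + Var P02 * Var P13) = 1 * pluckerQ + 0 * F"
      using 2 by (simp add: pluckerQ_def)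
    then have "Var P01 ^ 1 * Var v - (- Var P03 * Var P12 + Var P02 * Var P13) \<in> ideal2 pluckerQ F"
      unfolding ideal2_def by blast
    moreover have "indep_of {P13, P23} (- Var P03 * Var P12 :: (pl, 'a) mpoly)"
      "indep_of {P13, P23} (Var P02 :: (pl, 'a) mpoly)" by simp_all
    ultimately show ?thesis by blast
  next
    case 3
    then show ?thesis
      by (intro exI[of _ 0] exI[of _ "Var v"] exI[of _ 0]) simp
  qed
next
  case (add F1 F2)
  then obtain N A B N' A' B' where
    *: "Var P01 ^ N * F1 - (A + B * Var P13) \<in> ideal2 pluckerQ F"
    "Var P01 ^ N' * F2 - (A' + B' * Var P13) \<in> ideal2 pluckerQ F"
    "indep_of {P13, P23} A" "indep_of {P13, P23} B" "indep_of {P13, P23} A'" "indep_of {P13, P23} B'"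
    by blast
  let ?A = "Var P01 ^ N' * A + Var P01 ^ N * A'" and ?B = "Var P01 ^ N' * B + Var P01 ^ N * B'"
  have "Var P01 ^ (N + N') * (F1 + F2) - (?A + ?B * Var P13) =
      Var P01 ^ N' * (Var P01 ^ N * F1 - (A + B * Var P13)) +
      Var P01 ^ N * (Var P01 ^ N' * F2 - (A' + B' * Var P13))"
    by (simp add: algebra_simps power_add)
  also have "\<dots> \<in> ideal2 pluckerQ F"
    by (intro ideal2_add ideal2_mult *)
  finally show ?case
    using * by (intro exI[of _ "N + N'"] exI[of _ ?A] exI[of _ ?B]) simp
next
  case (mult F1 F2)
  then obtain N A B N' A' B' where
    *: "Var P01 ^ N * F1 - (A + B * Var P13) \<in> ideal2 pluckerQ F"
    "Var P01 ^ N' * F2 - (A' + B' * Var P13) \<in> ideal2 pluckerQ F"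
    "indep_of {P13, P23} A" "indep_of {P13, P23} B" "indep_of {P13, P23} A'" "indep_of {P13, P23} B'"
    by blast
  \<comment> \<open>The product of the two remainders, with \<open>p01 ^ k * p13 ^ 2\<close>
    replaced by \<open>b * p13 + g\<close>.\<close>
  let ?A = "Var P01 ^ k * A * A' + B * B' * g"
    and ?B = "Var P01 ^ k * (A * B' + A' * B) + B * B' * b"
  have "Var P01 ^ (k + (N + N')) * (F1 * F2) - (?A + ?B * Var P13) =
      Var P01 ^ k * ((Var P01 ^ N * F1 - (A + B * Var P13)) * (Var P01 ^ N' * F2)
        + (A + B * Var P13) * (Var P01 ^ N' * F2 - (A' + B' * Var P13)))
      + B * B' * (Var P01 ^ k * Var P13 ^ 2 - b * Var P13 - g)"
    by (simp add: algebra_simps power_add power2_eq_square)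
  also have "\<dots> \<in> ideal2 pluckerQ F"
    by (intro ideal2_add ideal2_mult ideal2_mult' rel *)
  finally show ?case
    using * ind by (intro exI[of _ "k + (N + N')"] exI[of _ ?A] exI[of _ ?B]) simp
qed

text \<open>On the chart \<open>p\<^sub>0\<^sub>1 \<noteq> 0\<close> the coordinate \<open>p\<^sub>2\<^sub>3\<close> is eliminated and \<open>F\<close> becomes a quadratic
  polynomial in \<open>p\<^sub>1\<^sub>3\<close> with generically distinct roots; a remainder of degree at most 1 that
  vanishes at both roots is zero.\<close>

lemma reduced_sectionI:
  fixes F :: "(pl, 'a::{alg_closed_field, field_char_0}) mpoly"
  assumes a: "a \<noteq> 0"
    and eq: "Const a * Var P01 ^ j * F = Var P01 ^ k * Var P13 ^ 2 - b * Var P13 - g + E * pluckerQ"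
    and ind: "indep_of {P13, P23} b" "indep_of {P13, P23} g"
    and disc: "eval_poly (b ^ 2 + 4 * g * Var P01 ^ k) z \<noteq> 0"
    and x: "x $ P01 = 0" "eval_poly pluckerQ x = 0" "eval_poly F x \<noteq> 0"
  shows "reduced_section F"
  unfolding reduced_section_def
proof (intro allI impI)
  fix H :: "(pl, 'a) mpoly"
  assume H: "\<forall>x. eval_poly pluckerQ x = 0 \<longrightarrow> eval_poly F x = 0 \<longrightarrow> eval_poly H x = 0"
  have "Var P01 ^ k * Var P13 ^ 2 - b * Var P13 - g = (- E) * pluckerQ + Const a * Var P01 ^ j * F"
    by (simp add: eq)
  then have "Var P01 ^ k * Var P13 ^ 2 - b * Var P13 - g \<in> ideal2 pluckerQ F"
    unfolding ideal2_def by blast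
  from P01_chart_reduce[OF this ind, of H] obtain N A B where
    mem: "Var P01 ^ N * H - (A + B * Var P13) \<in> ideal2 pluckerQ F"
    and AB: "indep_of {P13, P23} A" "indep_of {P13, P23} B" by blast
  obtain X Y where XY: "Var P01 ^ N * H - (A + B * Var P13) = X * pluckerQ + Y * F"
    using mem by (auto simp: ideal2_def)
  \<comment> \<open>Where \<open>D\<close> is nonzero the point lies in the chart and the quadratic
    polynomial has two distinct roots.\<close>
  define D where "D = Var P01 * (b ^ 2 + 4 * g * Var P01 ^ k)"
  have AB0: "eval_poly A y = 0 \<and> eval_poly B y = 0" if "eval_poly D y \<noteq> 0" for y
  proof -
    define c where "c = y $ P01 ^ k"
    have y01: "y $ P01 \<noteq> 0" and d: "eval_poly b y ^ 2 + 4 * eval_poly g y * c \<noteq> 0"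
      using that by (auto simp: D_def c_def)
    have c: "c \<noteq> 0" using y01 by (simp add: c_def)
    obtain r where r: "r ^ 2 = eval_poly b y ^ 2 + 4 * eval_poly g y * c"
      using nth_root_exists[of 2] by auto
    have r0: "r \<noteq> 0" using r d by auto
    have van: "eval_poly A y + eval_poly B y * \<rho> = 0"
      if \<rho>: "c * \<rho> ^ 2 - eval_poly b y * \<rho> - eval_poly g y = 0" for \<rho>
    proof -
      \<comment> \<open>The point above \<open>y\<close> with \<open>p13\<close> equal to the root
        and \<open>p23\<close> solved from \<open>Q = 0\<close>; it lies on
        \<open>Q = F = 0\<close>.\<close>
      define w where "w = (\<chi> I. if I = P13 then \<rho> else
        if I = P23 then (y $ P02 * \<rho> - y $ P03 * y $ P12) / y $ P01 else y $ I)"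
      have same: "eval_poly K w = eval_poly K y" if "indep_of {P13, P23} K" for K :: "(pl, 'a) mpoly"
        using that unfolding indep_of_def by (simp add: w_def)
      have w: "w $ P01 = y $ P01" "w $ P13 = \<rho>" by (simp_all add: w_def)
      have Qw: "eval_poly pluckerQ w = 0" using y01 by (simp add: w_def)
      have "a * w $ P01 ^ j * eval_poly F w = 0"
        using arg_cong[OF eq, of "\<lambda>H. eval_poly H w"] \<rho> Qw
        by (simp add: same ind w c_def del: eval_pluckerQ)
      then have Fw: "eval_poly F w = 0" using y01 w a by simp
      then have "eval_poly H w = 0" using H Qw by blast
      then have "eval_poly A w + eval_poly B w * \<rho> = 0"
        using arg_cong[OF XY, of "\<lambda>H. eval_poly H w"] Qw Fw w
        by (simp add: add_eq_0_iff del: eval_pluckerQ)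
      then show ?thesis by (simp add: same AB)
    qed
    let ?u = "(eval_poly b y + r) / (2 * c)" and ?v = "(eval_poly b y - r) / (2 * c)"
    have root: "c * (s / (2 * c)) ^ 2 - \<beta> * (s / (2 * c)) - \<gamma> = 0"
      if "(s - \<beta>) ^ 2 = \<beta> ^ 2 + 4 * \<gamma> * c" for s \<beta> \<gamma>
      using c that by (simp add: field_simps power2_eq_square)
    have "eval_poly A y + eval_poly B y * ?u = 0" "eval_poly A y + eval_poly B y * ?v = 0"
      by (intro van root; simp add: r)+
    moreover have "?u - ?v = r / c" using c by (simp add: field_simps)
    then have "?u - ?v \<noteq> 0" using r0 c by simp
    moreover have "eval_poly B y * (?u - ?v) = (eval_poly A y + eval_poly B y * ?u) - (eval_poly A y + eval_poly B y * ?v)"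
      by (simp only: right_diff_distrib) simp
    ultimately show ?thesis by auto
  qed
  have "D \<noteq> 0"
  proof
    assume "D = 0"
    then have "Var P01 = (0 :: (pl, 'a) mpoly) \<or> b ^ 2 + 4 * g * Var P01 ^ k = 0"
      unfolding D_def by (rule mpoly_mult_eq_0_imp)
    then show False using disc Var_neq_0 by (metis eval_poly_0)
  qed
  \<comment> \<open>At every point \<open>D\<close> vanishes or both \<open>A\<close> and
    \<open>B\<close> do, so the products are zero as polynomials.\<close>
  moreover have "D * A = 0" "D * B = 0"
    by (rule eval_poly_eq_0_imp_eq_0; use AB0 in auto)+
  ultimately have "A = 0" "B = 0" using mpoly_mult_eq_0_imp by blast+
  then have "Var P01 ^ N * H \<in> ideal2 pluckerQ F" using mem by simp
  then show "H \<in> ideal2 pluckerQ F"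
  proof (induction N)
    case (Suc N)
    then have "Var P01 * (Var P01 ^ N * H) \<in> ideal2 pluckerQ F" by (simp add: mult.assoc)
    then show ?case using P01_cancel[OF _ x] Suc.IH by blast
  qed simp
qed

section \<open>Pluecker coordinates and the Cayley bracket\<close>

text \<open>In the type \<open>4\<close> the numeral 4 equals 0, so 1, 2, 3, 4 is only another order
  of 0, 1, 2, 3.\<close>

lemma sum_4': "(\<Sum>i\<in>UNIV. f i) = f 0 + f 1 + f 2 + f (3 :: 4)"
  for f :: "4 \<Rightarrow> 'b::comm_monoid_add"
proof -
  have "(4 :: 4) = 0" by simp
  then show ?thesis unfolding sum_4 by (simp only: ac_simps)
qed

lemma all_4': "(\<forall>i::4. R i) \<longleftrightarrow> R 0 \<and> R 1 \<and> R 2 \<and> R 3"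
proof -
  have "(4 :: 4) = 0" by simp
  then show ?thesis unfolding forall_4 by (simp only:) blast
qed

definition vec4 :: "'a \<Rightarrow> 'a \<Rightarrow> 'a \<Rightarrow> 'a \<Rightarrow> 'a ^ 4" where
  "vec4 a b c d = (\<chi> i. if i = 0 then a else if i = 1 then b else if i = 2 then c else d)"

lemma vec4_nth [simp]:
  "vec4 a b c d $ 0 = a" "vec4 a b c d $ 1 = b" "vec4 a b c d $ 2 = c" "vec4 a b c d $ 3 = d"
  by (simp_all add: vec4_def)

lemma plucker_nth [simp]:
  "plucker x y $ P01 = x $ 0 * y $ 1 - x $ 1 * y $ 0"
  "plucker x y $ P02 = x $ 0 * y $ 2 - x $ 2 * y $ 0"
  "plucker x y $ P03 = x $ 0 * y $ 3 - x $ 3 * y $ 0"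
  "plucker x y $ P12 = x $ 1 * y $ 2 - x $ 2 * y $ 1"
  "plucker x y $ P13 = x $ 1 * y $ 3 - x $ 3 * y $ 1"
  "plucker x y $ P23 = x $ 2 * y $ 3 - x $ 3 * y $ 2"
  by (simp_all add: plucker_def)

lemma pluckerQ_plucker: "eval_poly pluckerQ (plucker x y) = 0"
  by (simp add: algebra_simps)

lemma pluckerQ_zero_imp_plucker:
  fixes p :: "'a::field ^ pl"
  assumes Q: "eval_poly pluckerQ p = 0"
  shows "\<exists>x y. p = plucker x y"
proof -
  \<comment> \<open>The rows of the skew-symmetric matrix of \<open>p\<close>. By
    \<open>Q = 0\<close> it has rank at most 2, and rows \<open>i\<close> and \<open>j\<close> have
    Pluecker vector \<open>p_ij * p\<close>.\<close>
  let ?r0 = "vec4 0 (p $ P01) (p $ P02) (p $ P03)"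
  let ?r1 = "vec4 (- p $ P01) 0 (p $ P12) (p $ P13)"
  let ?r2 = "vec4 (- p $ P02) (- p $ P12) 0 (p $ P23)"
  let ?r3 = "vec4 (- p $ P03) (- p $ P13) (- p $ P23) 0"
  have Q': "p $ P01 * p $ P23 = p $ P02 * p $ P13 - p $ P03 * p $ P12"
    using Q by (simp add: algebra_simps)
  note s = vec_eq_iff all_pl field_simps Q'
  consider "p = 0" | "p $ P01 \<noteq> 0" | "p $ P02 \<noteq> 0" | "p $ P03 \<noteq> 0" | "p $ P12 \<noteq> 0" | "p $ P13 \<noteq> 0" | "p $ P23 \<noteq> 0"
    by (auto simp: vec_eq_iff all_pl)
  then show ?thesis
  proof cases
    case 1
    then have "p = plucker 0 0" by (simp add: vec_eq_iff all_pl)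
    then show ?thesis by blast
  next
    case 2
    then have "p = plucker ((1 / p $ P01) *s ?r0) ?r1" by (simp add: s)
    then show ?thesis by blast
  next
    case 3
    then have "p = plucker ((1 / p $ P02) *s ?r0) ?r2" by (simp add: s)
    then show ?thesis by blast
  next
    case 4
    then have "p = plucker ((1 / p $ P03) *s ?r0) ?r3" by (simp add: s)
    then show ?thesis by blast
  next
    case 5
    then have "p = plucker ((1 / p $ P12) *s ?r1) ?r2" by (simp add: s)
    then show ?thesis by blast
  next
    case 6
    then have "p = plucker ((1 / p $ P13) *s ?r1) ?r3" by (simp add: s)
    then show ?thesis by blast
  next
    case 7
    then have "p = plucker ((1 / p $ P23) *s ?r2) ?r3" by (simp add: s)
    then show ?thesis by blast
  qed
qed

text \<open>Irreducibility of the Pluecker quadric, by joining two of its points inside it.\<close>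

lemma pluckerQ_prime:
  fixes F B :: "(pl, 'a::field_char_0) mpoly"
  assumes dvd: "pluckerQ dvd F * B"
    and x: "eval_poly pluckerQ x = 0" "eval_poly F x \<noteq> 0" and y: "eval_poly pluckerQ y = 0"
  shows "eval_poly B y = 0"
proof -
  obtain u v where u: "x = plucker u v" using pluckerQ_zero_imp_plucker[OF x(1)] by blast
  obtain u' v' where u': "y = plucker u' v'" using pluckerQ_zero_imp_plucker[OF y] by blast
  define l where "l a b i = [:a $ i, b $ i - a $ i:]" for a b :: "'a ^ 4" and i
  \<comment> \<open>The Pluecker vector of two linearly moving vectors; it satisfies
    \<open>Q = 0\<close> for every parameter, even where the vectors become dependent.\<close>
  define \<gamma> where "\<gamma> I = (case I of
       P01 \<Rightarrow> l u u' 0 * l v v' 1 - l u u' 1 * l v v' 0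
     | P02 \<Rightarrow> l u u' 0 * l v v' 2 - l u u' 2 * l v v' 0
     | P03 \<Rightarrow> l u u' 0 * l v v' 3 - l u u' 3 * l v v' 0
     | P12 \<Rightarrow> l u u' 1 * l v v' 2 - l u u' 2 * l v v' 1
     | P13 \<Rightarrow> l u u' 1 * l v v' 3 - l u u' 3 * l v v' 1
     | P23 \<Rightarrow> l u u' 2 * l v v' 3 - l u u' 3 * l v v' 2)" for I
  have \<gamma>: "(\<chi> I. poly (\<gamma> I) t) = plucker (\<chi> i. poly (l u u' i) t) (\<chi> i. poly (l v v' i) t)" for t
    by (simp add: vec_eq_iff all_pl \<gamma>_def)
  have 0: "(\<chi> I. poly (\<gamma> I) 0) = x" and 1: "(\<chi> I. poly (\<gamma> I) 1) = y"
    unfolding \<gamma> by (simp_all add: u u' l_def)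
  obtain X where X: "F * B = pluckerQ * X" using dvd by (elim dvdE)
  have "eval_poly F (\<chi> I. poly (\<gamma> I) t) * eval_poly B (\<chi> I. poly (\<gamma> I) t) = 0" for t
    unfolding \<gamma> eval_poly_mult[symmetric] X by (simp add: eval_poly_mult pluckerQ_plucker del: eval_pluckerQ)
  from zero_product_along_curve[OF this, of 0 1] x show ?thesis by (simp add: 0 1)
qed

text \<open>The six coordinate points lie on the quadric and detect every coefficient of a linear
  form; a constant is detected at the origin.\<close>

lemma low_degree_form_vanishing_on_pluckerQ:
  fixes B :: "(pl, 'a::field_char_0) mpoly"
  assumes B: "is_form d B" "d \<le> 1" and 0: "\<And>y. eval_poly pluckerQ y = 0 \<Longrightarrow> eval_poly B y = 0"
  shows "B = 0"
proof (cases "d = 0")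
  case True
  then obtain c where c: "B = Const c" using B is_form_0_imp_Const by blast
  then have "c = 0" using 0[of 0] by simp
  then show ?thesis using c by simp
next
  case False
  then have "d = 1" using B by simp
  then obtain c where c: "\<And>x. eval_poly B x = (\<Sum>v\<in>UNIV. c $ v * x $ v)"
    using linear_form_eval B by blast
  have "c $ v = 0" for v
  proof -
    have "eval_poly pluckerQ (axis v 1 :: 'a ^ pl) = 0" by (cases v) (simp_all add: axis_def)
    from 0[OF this] show ?thesis by (simp add: c axis_def if_distrib cong: if_cong)
  qed
  then show ?thesis by (intro eval_poly_eq_0_imp_eq_0) (simp add: c)
qed

text \<open>The polar form of \<open>Q\<close>. Applied to gradients it is the Cayley
  bracket.\<close>

definition pl_pairing :: "'a::comm_ring_1 ^ pl \<Rightarrow> 'a ^ pl \<Rightarrow> 'a" where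
  "pl_pairing a b = a $ P01 * b $ P23 + a $ P23 * b $ P01 - a $ P02 * b $ P13 - a $ P13 * b $ P02
     + a $ P03 * b $ P12 + a $ P12 * b $ P03"

lemma eval_cayley_bracket:
  "eval_poly (cayley_bracket F G) x = pl_pairing (gradient F x) (gradient G x)"
  by (simp add: cayley_bracket_def pl_pairing_def gradient_def)

lemma pl_pairing_self: "pl_pairing x x = 2 * eval_poly pluckerQ x" for x :: "'a::field ^ pl"
  by (simp add: pl_pairing_def algebra_simps)

lemma pl_pairing_linear:
  "pl_pairing (a + b) c = pl_pairing a c + pl_pairing b c"
  "pl_pairing c (a + b) = pl_pairing c a + pl_pairing c b"
  "pl_pairing (r *s a) c = r * pl_pairing a c"
  "pl_pairing c (r *s a) = r * pl_pairing c a"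
  by (simp_all add: pl_pairing_def algebra_simps)

section \<open>Second exterior powers of 4x4 matrices\<close>

fun fst_index snd_index :: "pl \<Rightarrow> 4" where
  "fst_index P01 = 0" | "fst_index P02 = 0" | "fst_index P03 = 0"
| "fst_index P12 = 1" | "fst_index P13 = 1" | "fst_index P23 = 2"
| "snd_index P01 = 1" | "snd_index P02 = 2" | "snd_index P03 = 3"
| "snd_index P12 = 2" | "snd_index P13 = 3" | "snd_index P23 = 3"

text \<open>The second exterior power of \<open>A\<close>, that is, the matrix of its 2x2 minors, by
  rows.\<close>

definition ext2 :: "'a::field ^ 4 ^ 4 \<Rightarrow> 'a ^ pl ^ pl" where
  "ext2 A = (\<chi> I. plucker (A $ fst_index I) (A $ snd_index I))"

lemma ext2_nth: "ext2 A $ I = plucker (A $ fst_index I) (A $ snd_index I)"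
  by (simp add: ext2_def)

text \<open>This is the determinant, in the form of the Laplace expansion along the first two
  rows.\<close>

definition ext2_det :: "'a::field ^ 4 ^ 4 \<Rightarrow> 'a" where
  "ext2_det A = pl_pairing (plucker (A $ 0) (A $ 1)) (plucker (A $ 2) (A $ 3))"

lemma plucker_matrix_vector: "plucker (A *v x) (A *v y) = ext2 A *v plucker x y"
  by (simp add: vec_eq_iff all_pl matrix_vector_mult_def sum_pl sum_4' ext2_def) (simp add: algebra_simps)

lemma ext2_transpose: "ext2 (transpose A) = transpose (ext2 A)"
  by (simp add: vec_eq_iff all_pl ext2_def transpose_def mult.commute)

lemma transpose_mult_vec: "transpose A *v (x :: 'a::comm_ring_1 ^ 'n) = (\<Sum>i\<in>UNIV. x $ i *s A $ i)"
  by (simp add: vec_eq_iff matrix_vector_mult_def transpose_def mult.commute)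

lemma row_matrix_mult: "(A ** B) $ i = transpose B *v (A $ i)" for A :: "'a::comm_ring_1 ^ 'n ^ 'm"
  by (simp add: vec_eq_iff matrix_vector_mult_def matrix_matrix_mult_def transpose_def mult.commute)

text \<open>The Cauchy-Binet formula for 2x2 minors, read off row by row.\<close>

lemma ext2_mult: "ext2 (A ** B) = ext2 A ** ext2 B"
proof -
  have "ext2 (A ** B) $ I = (ext2 A ** ext2 B) $ I" for I
    by (simp only: ext2_nth row_matrix_mult plucker_matrix_vector ext2_transpose)
  then show ?thesis by (simp add: vec_eq_iff)
qed

lemma ext2_mat_1 [simp]: "ext2 (mat 1) = mat 1"
  by (simp add: vec_eq_iff all_pl ext2_def mat_def)

lemma pl_pairing_plucker_repeated:
  "pl_pairing (plucker x y) (plucker x w) = 0" "pl_pairing (plucker x y) (plucker z x) = 0"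
  "pl_pairing (plucker x y) (plucker y w) = 0" "pl_pairing (plucker x y) (plucker z y) = 0"
  by (simp_all add: pl_pairing_def algebra_simps)

lemma pl_pairing_plucker_permuted:
  "pl_pairing (plucker z w) (plucker x y) = pl_pairing (plucker x y) (plucker z w)"
  "pl_pairing (plucker x z) (plucker y w) = - pl_pairing (plucker x y) (plucker z w)"
  "pl_pairing (plucker y w) (plucker x z) = - pl_pairing (plucker x y) (plucker z w)"
  "pl_pairing (plucker x w) (plucker y z) = pl_pairing (plucker x y) (plucker z w)"
  "pl_pairing (plucker y z) (plucker x w) = pl_pairing (plucker x y) (plucker z w)"
  by (simp_all add: pl_pairing_def algebra_simps)

text \<open>The rows of \<open>ext2 A\<close> are Pluecker vectors of pairs of rows of
  \<open>A\<close>. Two of them pair to 0 if they share a row, and otherwise to the determinant with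
  the sign that \<open>pl_pairing\<close> carries.\<close>

lemma pl_pairing_ext2:
  "pl_pairing (transpose (ext2 A) *v a) (transpose (ext2 A) *v b) = ext2_det A * pl_pairing a b"
proof -
  have 1: "pl_pairing (transpose (ext2 A) *v a) (transpose (ext2 A) *v b) =
      (\<Sum>I\<in>UNIV. \<Sum>J\<in>UNIV. a $ I * (b $ J * pl_pairing (ext2 A $ I) (ext2 A $ J)))"
    unfolding transpose_mult_vec sum_pl pl_pairing_linear by (simp add: algebra_simps)
  have 2: "pl_pairing (ext2 A $ I) (ext2 A $ J) = (case (I, J) of
      (P01, P23) \<Rightarrow> ext2_det A | (P23, P01) \<Rightarrow> ext2_det A | (P02, P13) \<Rightarrow> - ext2_det A
    | (P13, P02) \<Rightarrow> - ext2_det A | (P03, P12) \<Rightarrow> ext2_det A | (P12, P03) \<Rightarrow> ext2_det A | _ \<Rightarrow> 0)" for I J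
    by (cases I; cases J; simp add: ext2_def ext2_det_def pl_pairing_plucker_repeated;
      rule pl_pairing_plucker_permuted)
  show ?thesis
    unfolding 1 2 sum_pl by (simp add: pl_pairing_def algebra_simps)
qed

lemma pl_pairing_ext2':
  "pl_pairing (ext2 A *v a) (ext2 A *v b) = ext2_det (transpose A) * pl_pairing a b"
  using pl_pairing_ext2[of "transpose A"] by (simp add: ext2_transpose)

lemma invertible_ext2:
  assumes "invertible A"
  obtains B where "ext2 A ** ext2 B = mat 1" "ext2 B ** ext2 A = mat 1" "A ** B = mat 1" "B ** A = mat 1"
proof -
  obtain B where "A ** B = mat 1" "B ** A = mat 1" using assms by (auto simp: invertible_def)
  then show ?thesis using that by (metis ext2_mult ext2_mat_1)
qed

text \<open>With factor 0 the surjective map \<open>transpose (ext2 A)\<close> would make the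
  pairing identically zero.\<close>

lemma ext2_det_nonzero:
  assumes "invertible A"
  shows "ext2_det A \<noteq> 0"
proof
  assume 0: "ext2_det A = 0"
  obtain B where B: "ext2 B ** ext2 A = mat 1" using invertible_ext2[OF assms] by metis
  then have "transpose (ext2 A) ** transpose (ext2 B) = mat 1"
    by (metis matrix_transpose_mul transpose_mat)
  then have *: "transpose (ext2 A) *v (transpose (ext2 B) *v x) = x" for x
    by (simp add: matrix_vector_mul_assoc del: transpose_matrix_vector)
  have "pl_pairing x y = 0" for x y :: "'a ^ pl"
    using pl_pairing_ext2[of A "transpose (ext2 B) *v x" "transpose (ext2 B) *v y"]
    unfolding * 0 by simp
  then have "pl_pairing (pl_vec 1 0 0 0 0 0) (pl_vec 0 0 0 0 0 1 :: 'a ^ pl) = 0" .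
  then show False by (simp add: pl_pairing_def)
qed

section \<open>The bracket, \<open>Q\<close> and the Laplacian under coordinate changes\<close>

lemma gradient_pullback:
  fixes F :: "('v::finite, 'a::field_char_0) mpoly"
  shows "gradient (pullback M F) x = transpose M *v gradient F (M *v x)"
  by (simp add: vec_eq_iff gradient_def partial_pullback eval_poly_sum matrix_vector_mult_def transpose_def)

lemma cayley_bracket_pullback:
  fixes F G :: "(pl, 'a::field_char_0) mpoly"
  shows "cayley_bracket (pullback (ext2 A) F) (pullback (ext2 A) G) =
    Const (ext2_det A) * pullback (ext2 A) (cayley_bracket F G)"
  by (rule eval_poly_eqI) (simp add: eval_cayley_bracket gradient_pullback pl_pairing_ext2 del: transpose_matrix_vector)

text \<open>\<open>Q\<close> is half the pairing of a point with itself. Points move by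
  \<open>ext2 A\<close> and gradients by its transpose, hence the transpose in the factor.\<close>

lemma pluckerQ_pullback:
  fixes A :: "'a::field_char_0 ^ 4 ^ 4"
  shows "pullback (ext2 A) pluckerQ = Const (ext2_det (transpose A)) * pluckerQ"
proof (rule eval_poly_eqI)
  fix x
  have "2 * eval_poly pluckerQ (ext2 A *v x) = 2 * (ext2_det (transpose A) * eval_poly pluckerQ x)"
    unfolding pl_pairing_self[symmetric] pl_pairing_ext2' by (simp add: pl_pairing_self)
  then show "eval_poly (pullback (ext2 A) pluckerQ) x = eval_poly (Const (ext2_det (transpose A)) * pluckerQ) x"
    unfolding eval_poly_pullback eval_poly_mult eval_poly_Const by (simp del: eval_pluckerQ)
qed

text \<open>The bracket measures how far the Laplacian is from being a derivation; this makes
  induction over products possible in \<open>laplacian_pullback\<close>.\<close>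

lemma laplacian_mult:
  "laplacian (F * G) = F * laplacian G + G * laplacian F + cayley_bracket F G"
  by (simp add: laplacian_def cayley_bracket_def partial_mult algebra_simps)

lemma laplacian_add: "laplacian (F + G) = laplacian F + laplacian G"
  by (simp add: laplacian_def)

lemma laplacian_Const [simp]: "laplacian (Const c) = 0"
  by (simp add: laplacian_def)

lemma laplacian_Const_mult: "laplacian (Const c * F) = Const c * laplacian F"
  by (simp add: laplacian_mult cayley_bracket_def)

lemma laplacian_pullback:
  fixes F :: "(pl, 'a::field_char_0) mpoly"
  shows "laplacian (pullback (ext2 A) F) = Const (ext2_det A) * pullback (ext2 A) (laplacian F)"
proof (induction F rule: mpoly_induct)
  case (Var v)
  have "partial w (partial u (Var v :: (pl, 'a) mpoly)) = 0" for u w v by (simp add: partial_Var)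
  then show ?case
    by (simp add: laplacian_def pullback_Var partial_sum partial_mult)
next
  case (mult F G)
  then show ?case
    by (simp add: pullback_mult pullback_add laplacian_mult cayley_bracket_pullback algebra_simps)
qed (simp_all add: pullback_add laplacian_add distrib_left)

lemma partial_pluckerQ:
  "partial P01 pluckerQ = Var P23" "partial P23 pluckerQ = Var P01"
  "partial P02 pluckerQ = - Var P13" "partial P13 pluckerQ = - Var P02"
  "partial P03 pluckerQ = Var P12" "partial P12 pluckerQ = Var P03"
  by (simp_all add: pluckerQ_def partial_mult partial_Var)

text \<open>The partial derivatives of \<open>Q\<close> are the complementary coordinates up to
  sign, so the bracket with \<open>Q\<close> is the Euler operator.\<close>

lemma cayley_bracket_pluckerQ:
  assumes "is_form d F"
  shows "cayley_bracket F pluckerQ = of_nat d * F"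
  unfolding euler_identity[OF assms, symmetric]
  by (simp add: cayley_bracket_def partial_pluckerQ sum_pl algebra_simps)

lemma cayley_bracket_commute: "cayley_bracket F G = cayley_bracket G F"
  by (simp add: cayley_bracket_def algebra_simps)

lemma cayley_bracket_add: "cayley_bracket F (G + H) = cayley_bracket F G + cayley_bracket F H"
  by (simp add: cayley_bracket_def algebra_simps)

lemma cayley_bracket_mult: "cayley_bracket F (G * H) = cayley_bracket F G * H + G * cayley_bracket F H"
  by (simp add: cayley_bracket_def partial_mult algebra_simps)

lemma is_form_pluckerQ: "is_form 2 pluckerQ"
proof -
  have "is_form (Suc 0 + Suc 0) pluckerQ"
    unfolding pluckerQ_def by (intro is_form_add is_form_diff is_form_mult is_form_Var)
  then show ?thesis by (simp add: numeral_2_eq_2)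
qed

lemma laplacian_pluckerQ: "laplacian pluckerQ = 3"
  by (simp add: laplacian_def partial_pluckerQ partial_Var)

section \<open>Uniqueness of Cayley forms\<close>

lemma cayley_bracket_add_left:
  "cayley_bracket (F + G) H = cayley_bracket F H + cayley_bracket G H"
  by (simp add: cayley_bracket_def algebra_simps)

lemma cayley_bracket_Const_mult_left: "cayley_bracket (Const c * F) G = Const c * cayley_bracket F G"
  by (simp add: cayley_bracket_def partial_mult algebra_simps)

lemma cayley_bracket_Const_mult_right: "cayley_bracket F (Const c * G) = Const c * cayley_bracket F G"
  by (simp add: cayley_bracket_def partial_mult algebra_simps)

lemma reduced_section_cuts_out:
  assumes "reduced_section F"
  shows "cuts_out F (proj_zeros {pluckerQ, F})"
  unfolding cuts_out_def radical_ideal_def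
proof (intro conjI allI impI)
  fix H n assume "H ^ n \<in> ideal2 pluckerQ F"
  then obtain A B where AB: "H ^ n = A * pluckerQ + B * F" by (auto simp: ideal2_def)
  have "eval_poly H x = 0" if "eval_poly pluckerQ x = 0" "eval_poly F x = 0" for x
    using arg_cong[OF AB, of "\<lambda>K. eval_poly K x"] that
    unfolding eval_poly_power eval_poly_add eval_poly_mult by (auto simp del: eval_pluckerQ)
  then show "H \<in> ideal2 pluckerQ F" using assms unfolding reduced_section_def by blast
qed simp

text \<open>\<open>G\<close> vanishes on the zeros of \<open>Q\<close> and \<open>F\<close>, so it
  lies in \<open>(Q, F)\<close>. Comparing parts of degree \<open>d\<close> leaves a constant in
  front of \<open>F\<close>.\<close>

lemma cuts_out_same_divisor:
  fixes F G :: "(pl, 'a::field_char_0) mpoly"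
  assumes F: "is_form d F" "2 \<le> d" "reduced_section F"
    and x: "eval_poly pluckerQ x = 0" "eval_poly F x \<noteq> 0"
    and G: "is_form d G" "cuts_out G (proj_zeros {pluckerQ, F})"
  obtains c B where "c \<noteq> 0" "is_form (d - 2) B" "G = Const c * F + B * pluckerQ"
proof -
  have zeros: "proj_zeros {pluckerQ, G} = proj_zeros {pluckerQ, F}"
    using G(2) by (simp add: cuts_out_def)
  \<comment> \<open>\<open>proj_zeros\<close> leaves out the origin, where \<open>G\<close> vanishes
    because its degree is positive.\<close>
  have "eval_poly G y = 0" if "eval_poly pluckerQ y = 0" "eval_poly F y = 0" for y
  proof (cases "y = 0")
    case False
    then have "y \<in> proj_zeros {pluckerQ, G}"
      unfolding zeros using that by (simp add: proj_zeros_def)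
    then show ?thesis by (simp add: proj_zeros_def)
  qed (use eval_poly_form_0[OF G(1)] F(2) in auto)
  then have "G \<in> ideal2 pluckerQ F" using F(3) unfolding reduced_section_def by blast
  then obtain X Y where "G = X * pluckerQ + Y * F" by (auto simp: ideal2_def)
  then have "homogeneous_part d G = homogeneous_part (d - 2) X * pluckerQ + homogeneous_part 0 Y * F"
    using homogeneous_part_mult_form[OF is_form_pluckerQ F(2), of X]
      homogeneous_part_mult_form[OF F(1), of d Y] by (simp add: homogeneous_part_add)
  moreover obtain c where c: "homogeneous_part 0 Y = Const c"
    using is_form_0_imp_Const is_form_homogeneous_part by blast
  ultimately have eq: "G = Const c * F + homogeneous_part (d - 2) X * pluckerQ"
    using homogeneous_part_form[OF G(1), of d] by (simp add: add.commute)
  \<comment> \<open>Otherwise \<open>G\<close> would vanish on the whole quadric, but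
    \<open>F\<close> does not.\<close>
  have "c \<noteq> 0"
  proof
    assume "c = 0"
    then have "eval_poly G x = 0" using x(1) by (simp add: eq del: eval_pluckerQ)
    moreover have "x \<noteq> 0" using x(2) eval_poly_form_0[OF F(1)] F(2) by auto
    ultimately have "x \<in> proj_zeros {pluckerQ, F}"
      unfolding zeros[symmetric] using x(1) by (simp add: proj_zeros_def)
    then show False using x(2) by (simp add: proj_zeros_def)
  qed
  then show ?thesis using that eq is_form_homogeneous_part by blast
qed

text \<open>Collects what the uniqueness arguments use and coordinate changes preserve. In degrees 2
  and 3 the coefficient of \<open>Q\<close> is at most linear.\<close>

definition normal_cayley_form :: "nat \<Rightarrow> (pl, 'a::field) mpoly \<Rightarrow> bool" where
  "normal_cayley_form d F \<longleftrightarrow> is_form d F \<and> (d = 2 \<or> d = 3) \<and> reduced_section F \<and>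
     (\<exists>x. eval_poly pluckerQ x = 0 \<and> eval_poly F x \<noteq> 0)"

lemma weak_cayley_form_unique:
  fixes F :: "(pl, 'a::field_char_0) mpoly"
  assumes F: "normal_cayley_form d F" "weak_cayley_eq F" and Z: "proj_zeros {pluckerQ, F} = Z"
  shows "unique_up_to_scalar (\<lambda>G. (is_form d G \<and> cuts_out G Z) \<and> weak_cayley_eq G) F"
  unfolding unique_up_to_scalar_def
proof (intro conjI allI impI)
  show "is_form d F" "weak_cayley_eq F" using F by (auto simp: normal_cayley_form_def)
  show "cuts_out F Z" using F reduced_section_cuts_out Z by (auto simp: normal_cayley_form_def)
  fix G assume G: "(is_form d G \<and> cuts_out G Z) \<and> weak_cayley_eq G"
  have d: "d = 2 \<or> d = 3" and form: "is_form d F" and red: "reduced_section F"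
    using F by (auto simp: normal_cayley_form_def)
  have d2: "2 \<le> d" using d by auto
  obtain x where x: "eval_poly pluckerQ x = 0" "eval_poly F x \<noteq> 0"
    using F by (auto simp: normal_cayley_form_def)
  obtain c B where c: "c \<noteq> 0" and B: "is_form (d - 2) B" and eq: "G = Const c * F + B * pluckerQ"
    using cuts_out_same_divisor[OF form d2 red x, of G] G Z by blast
  let ?br = cayley_bracket
  have QF: "?br F pluckerQ = of_nat d * F" and QQ: "?br pluckerQ pluckerQ = of_nat 2 * pluckerQ"
    by (rule cayley_bracket_pluckerQ form is_form_pluckerQ)+
  \<comment> \<open>Sorted so that everything except \<open>{F, F}\<close> and \<open>F * B\<close>
    is an explicit multiple of \<open>Q\<close>.\<close>
  have expand: "?br G G = Const (c ^ 2) * ?br F F + (2 * Const c * of_nat d) * (F * B) + pluckerQ *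
      (2 * Const c * ?br F B + 2 * B * ?br B pluckerQ + 2 * B ^ 2 + pluckerQ * ?br B B)"
  proof -
    have "?br G G = Const c * Const c * ?br F F + 2 * Const c * ?br F (B * pluckerQ) + ?br (B * pluckerQ) (B * pluckerQ)"
      unfolding eq cayley_bracket_add cayley_bracket_add_left cayley_bracket_Const_mult_left
        cayley_bracket_Const_mult_right cayley_bracket_commute[of "B * pluckerQ" F]
      by (simp add: algebra_simps)
    moreover have "?br F (B * pluckerQ) = pluckerQ * ?br F B + of_nat d * (F * B)"
      by (simp add: cayley_bracket_mult QF algebra_simps)
    moreover have "?br (B * pluckerQ) (B * pluckerQ) =
        pluckerQ * (2 * B * ?br B pluckerQ + 2 * B ^ 2 + pluckerQ * ?br B B)"
      by (simp add: cayley_bracket_mult cayley_bracket_commute[of "B * pluckerQ"] QQ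
          cayley_bracket_commute[of pluckerQ B] algebra_simps power2_eq_square)
    ultimately show ?thesis
      by (simp add: Const_mult power2_eq_square algebra_simps)
  qed
  have "pluckerQ dvd ?br G G" "pluckerQ dvd ?br F F"
    using G F by (auto simp: weak_cayley_eq_def)
  then obtain K L where KL: "?br G G = pluckerQ * K" "?br F F = pluckerQ * L" by (elim dvdE)
  have dvd: "pluckerQ dvd (2 * Const c * of_nat d) * (F * B)"
  proof
    show "(2 * Const c * of_nat d) * (F * B) = pluckerQ * (K - Const (c ^ 2) * L -
      (2 * Const c * ?br F B + 2 * B * ?br B pluckerQ + 2 * B ^ 2 + pluckerQ * ?br B B))"
      using expand unfolding KL by (simp add: algebra_simps)
  qed
  \<comment> \<open>The scalar \<open>2 c d\<close> is invertible because \<open>c\<close> is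
    nonzero and the characteristic is 0.\<close>
  have unit: "Const (1 / (2 * c * of_nat d)) * (2 * Const c * of_nat d) = 1"
  proof -
    have *: "2 * Const c * of_nat d = Const (2 * c * of_nat d)"
      by (simp add: Const_def mult_single flip: single_of_nat single_numeral)
    show ?thesis unfolding * Const_mult[symmetric] using c d by auto
  qed
  from dvd have "pluckerQ dvd Const (1 / (2 * c * of_nat d)) * ((2 * Const c * of_nat d) * (F * B))"
    by (rule dvd_mult)
  then have "pluckerQ dvd F * B"
    unfolding mult.assoc[symmetric] unit[unfolded mult.assoc[symmetric]] by simp
  then have "eval_poly B y = 0" if "eval_poly pluckerQ y = 0" for y
    using pluckerQ_prime x that by blast
  then have "B = 0"
    using low_degree_form_vanishing_on_pluckerQ[OF B] d by auto
  then show "\<exists>c. c \<noteq> 0 \<and> G = Const c * F" using c eq by auto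
qed

lemma strong_imp_weak: "strong_cayley_eq F \<Longrightarrow> weak_cayley_eq F"
  by (simp add: strong_cayley_eq_def weak_cayley_eq_def)

lemma cayley_bracket_Const_mult:
  "cayley_bracket (Const c * F) (Const c * F) = Const (c ^ 2) * cayley_bracket F F"
  by (simp add: cayley_bracket_Const_mult_left cayley_bracket_Const_mult_right Const_mult power2_eq_square mult.assoc)

lemma Const_mult_eq_0_iff:
  fixes F :: "('v::finite, 'a::field_char_0) mpoly"
  assumes "c \<noteq> 0"
  shows "Const c * F = 0 \<longleftrightarrow> F = 0"
  using mpoly_mult_eq_0_imp[of "Const c" F] assms by (metis Const_0 Const_eq_iff mult_zero_right)

text \<open>A strong solution is a weak one, hence a nonzero multiple of \<open>F\<close>, which
  fails the strong equation.\<close>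

lemma no_strong_cayley_form:
  fixes F :: "(pl, 'a::field_char_0) mpoly"
  assumes F: "normal_cayley_form d F" "weak_cayley_eq F" "\<not> strong_cayley_eq F"
    and Z: "proj_zeros {pluckerQ, F} = Z"
  shows "\<nexists>G. (is_form d G \<and> cuts_out G Z) \<and> strong_cayley_eq G"
proof
  assume "\<exists>G. (is_form d G \<and> cuts_out G Z) \<and> strong_cayley_eq G"
  then obtain G where G: "is_form d G \<and> cuts_out G Z" "strong_cayley_eq G" by blast
  then obtain c where "c \<noteq> 0" "G = Const c * F"
    using weak_cayley_form_unique[OF F(1,2) Z] strong_imp_weak
    unfolding unique_up_to_scalar_def by blast
  then show False
    using G F(3) by (simp add: strong_cayley_eq_def cayley_bracket_Const_mult Const_mult_eq_0_iff)
qed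

text \<open>In degree 2 the multiple of \<open>Q\<close> is a constant one, and the Laplacian of
  \<open>Q\<close> is 3, so harmonicity excludes it.\<close>

lemma harmonic_cayley_form_unique:
  fixes F :: "(pl, 'a::field_char_0) mpoly"
  assumes F: "normal_cayley_form 2 F" "harmonic F" and Z: "proj_zeros {pluckerQ, F} = Z"
  shows "unique_up_to_scalar (\<lambda>G. (is_form 2 G \<and> cuts_out G Z) \<and> harmonic G) F"
  unfolding unique_up_to_scalar_def
proof (intro conjI allI impI)
  show "is_form 2 F" "harmonic F" using F by (auto simp: normal_cayley_form_def)
  show "cuts_out F Z" using F reduced_section_cuts_out Z by (auto simp: normal_cayley_form_def)
  fix G assume G: "(is_form 2 G \<and> cuts_out G Z) \<and> harmonic G"
  obtain x where x: "eval_poly pluckerQ x = 0" "eval_poly F x \<noteq> 0"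
    using F by (auto simp: normal_cayley_form_def)
  obtain c B where c: "c \<noteq> 0" and B: "is_form 0 B" and eq: "G = Const c * F + B * pluckerQ"
    using cuts_out_same_divisor[of 2 F x G] F x G Z by (auto simp: normal_cayley_form_def)
  obtain b where b: "B = Const b" using is_form_0_imp_Const[OF B] .
  have "Const b * (3 :: (pl, 'a) mpoly) = 0"
    using F(2) G by (simp add: harmonic_def eq b laplacian_add laplacian_Const_mult laplacian_pluckerQ)
  then have "eval_poly (Const b * (3 :: (pl, 'a) mpoly)) 0 = 0" by simp
  then have "b = 0" by simp
  then show "\<exists>c. c \<noteq> 0 \<and> G = Const c * F" using c eq b by auto
qed

section \<open>Transport of Cayley forms along coordinate changes\<close>

lemma pullback_cancel:
  fixes F :: "('v::finite, 'a::field_char_0) mpoly"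
  assumes "M ** N = mat 1"
  shows "pullback N (pullback M F) = F"
  by (simp add: pullback_pullback assms)

lemma pullback_eq_0_iff:
  fixes F :: "('v::finite, 'a::field_char_0) mpoly"
  assumes "M ** N = mat 1"
  shows "pullback M F = 0 \<longleftrightarrow> F = 0"
  using pullback_cancel[OF assms, of F] by auto

lemma normal_cayley_form_pullback:
  fixes F :: "(pl, 'a::field_char_0) mpoly"
  assumes A: "invertible A" and F: "normal_cayley_form d F"
  shows "normal_cayley_form d (pullback (ext2 A) F)"
proof -
  obtain B where B: "ext2 A ** ext2 B = mat 1" "ext2 B ** ext2 A = mat 1" "A ** B = mat 1" "B ** A = mat 1"
    using invertible_ext2[OF A] .
  have AB: "ext2 A *v (ext2 B *v y) = y" for y by (simp add: matrix_vector_mul_assoc B)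
  have BA: "ext2 B *v (ext2 A *v y) = y" for y by (simp add: matrix_vector_mul_assoc B)
  have Q0: "eval_poly pluckerQ (ext2 B *v y) = 0" if "eval_poly pluckerQ y = 0" for y
    using that unfolding eval_poly_pullback[symmetric] pluckerQ_pullback eval_poly_mult by simp
  obtain x where x: "eval_poly pluckerQ x = 0" "eval_poly F x \<noteq> 0"
    using F by (auto simp: normal_cayley_form_def)
  have "eval_poly pluckerQ (ext2 B *v x) = 0 \<and> eval_poly (pullback (ext2 A) F) (ext2 B *v x) \<noteq> 0"
    using Q0[OF x(1)] x(2) by (simp add: AB del: eval_pluckerQ)
  moreover have "reduced_section (pullback (ext2 A) F)"
    unfolding reduced_section_def
  proof (intro allI impI)
    fix H
    assume H: "\<forall>x. eval_poly pluckerQ x = 0 \<longrightarrow> eval_poly (pullback (ext2 A) F) x = 0 \<longrightarrow> eval_poly H x = 0"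
    have "eval_poly (pullback (ext2 B) H) y = 0"
      if "eval_poly pluckerQ y = 0" "eval_poly F y = 0" for y
      using H[rule_format, of "ext2 B *v y"] Q0 that by (simp add: AB del: eval_pluckerQ)
    then have "pullback (ext2 B) H \<in> ideal2 pluckerQ F"
      using F unfolding normal_cayley_form_def reduced_section_def by blast
    then obtain X Y where "pullback (ext2 B) H = X * pluckerQ + Y * F" by (auto simp: ideal2_def)
    then have "pullback (ext2 A) (pullback (ext2 B) H) = pullback (ext2 A) (X * pluckerQ + Y * F)" by simp
    \<comment> \<open>The pullback of \<open>Q\<close> is a constant times \<open>Q\<close>; the
      constant is absorbed into the coefficient.\<close>
    then have "H = (pullback (ext2 A) X * Const (ext2_det (transpose A))) * pluckerQ
        + pullback (ext2 A) Y * pullback (ext2 A) F"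
      by (simp add: pullback_cancel B pullback_add pullback_mult pluckerQ_pullback mult.assoc)
    then show "H \<in> ideal2 pluckerQ (pullback (ext2 A) F)" unfolding ideal2_def by blast
  qed
  ultimately show ?thesis
    using F is_form_pullback by (auto simp: normal_cayley_form_def simp del: eval_pluckerQ)
qed

lemma weak_cayley_eq_pullback:
  fixes F :: "(pl, 'a::field_char_0) mpoly"
  assumes "weak_cayley_eq F"
  shows "weak_cayley_eq (pullback (ext2 A) F)"
proof -
  obtain K where "cayley_bracket F F = pluckerQ * K" using assms by (auto simp: weak_cayley_eq_def)
  then have "cayley_bracket (pullback (ext2 A) F) (pullback (ext2 A) F) =
    pluckerQ * (Const (ext2_det A) * Const (ext2_det (transpose A)) * pullback (ext2 A) K)"
    by (simp add: cayley_bracket_pullback pullback_mult pluckerQ_pullback mult_ac)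
  then show ?thesis by (simp add: weak_cayley_eq_def)
qed

lemma strong_cayley_eq_pullback_iff:
  fixes F :: "(pl, 'a::field_char_0) mpoly"
  assumes "invertible A"
  shows "strong_cayley_eq (pullback (ext2 A) F) \<longleftrightarrow> strong_cayley_eq F"
proof -
  obtain B where "ext2 A ** ext2 B = mat 1" using invertible_ext2[OF assms] .
  then show ?thesis
    by (simp add: strong_cayley_eq_def cayley_bracket_pullback Const_mult_eq_0_iff
        ext2_det_nonzero[OF assms] pullback_eq_0_iff)
qed

lemma harmonic_pullback_iff:
  fixes F :: "(pl, 'a::field_char_0) mpoly"
  assumes "invertible A"
  shows "harmonic (pullback (ext2 A) F) \<longleftrightarrow> harmonic F"
proof -
  obtain B where "ext2 A ** ext2 B = mat 1" using invertible_ext2[OF assms] .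
  then show ?thesis
    by (simp add: harmonic_def laplacian_pullback Const_mult_eq_0_iff
        ext2_det_nonzero[OF assms] pullback_eq_0_iff)
qed

lemma normal_cayley_formI:
  fixes F :: "(pl, 'a::{alg_closed_field, field_char_0}) mpoly"
  assumes "is_form d F" "d = 2 \<or> d = 3"
    and "a \<noteq> 0" "Const a * Var P01 ^ j * F = Var P01 ^ k * Var P13 ^ 2 - b * Var P13 - g + E * pluckerQ"
    and "indep_of {P13, P23} b" "indep_of {P13, P23} g"
    and "eval_poly (b ^ 2 + 4 * g * Var P01 ^ k) z \<noteq> 0"
    and "x $ P01 = 0" "eval_poly pluckerQ x = 0" "eval_poly F x \<noteq> 0"
  shows "normal_cayley_form d F"
  unfolding normal_cayley_form_def using reduced_sectionI[OF assms(3-10)] assms by blast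

section \<open>Lines meeting a curve\<close>

lemma span_pair: "vec.span {x, y} = {s *s x + t *s y | s t. True}"
proof -
  have "z \<in> vec.span {x, y} \<longleftrightarrow> (\<exists>s t. z = s *s x + t *s y)" for z
  proof -
    have "z \<in> vec.span {x, y} \<longleftrightarrow> (\<exists>s. \<exists>t. z - s *s x = t *s y)"
      by (simp add: vec.span_insert[of x "{y}"] vec.span_singleton image_iff)
    then show ?thesis by (metis add.commute diff_add_cancel add_diff_cancel_left')
  qed
  then show ?thesis by blast
qed

lemma plucker_eq_0_iff:
  "plucker x y = 0 \<longleftrightarrow> (\<exists>s t. (s \<noteq> 0 \<or> t \<noteq> 0) \<and> s *s x + t *s y = 0)"
proof
  assume "plucker x y = 0"
  then have eq: "x $ i * y $ j = x $ j * y $ i" for i j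
  proof -
    have "\<forall>i j. x $ i * y $ j = x $ j * y $ i"
      using \<open>plucker x y = 0\<close> unfolding vec_eq_iff all_pl all_4' by (simp add: mult.commute)
    then show ?thesis by blast
  qed
  show "\<exists>s t. (s \<noteq> 0 \<or> t \<noteq> 0) \<and> s *s x + t *s y = 0"
  proof (cases "x = 0")
    case True
    then show ?thesis by (intro exI[of _ 1] exI[of _ 0]) simp
  next
    case False
    then obtain i where "x $ i \<noteq> 0" by (auto simp: vec_eq_iff)
    then show ?thesis
      by (intro exI[of _ "y $ i"] exI[of _ "- x $ i"]) (simp add: vec_eq_iff eq mult.commute)
  qed
next
  assume "\<exists>s t. (s \<noteq> 0 \<or> t \<noteq> 0) \<and> s *s x + t *s y = 0"
  then obtain s t where st: "s \<noteq> 0 \<or> t \<noteq> 0" and eq: "\<And>i. s * x $ i + t * y $ i = 0"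
    by (auto simp: vec_eq_iff)
  have "x $ i * y $ j - x $ j * y $ i = 0" for i j
  proof -
    have "s * (x $ i * y $ j - x $ j * y $ i) = 0" "t * (x $ i * y $ j - x $ j * y $ i) = 0"
      using eq[of i] eq[of j] by algebra+
    then show ?thesis using st by auto
  qed
  then show "plucker x y = 0" by (simp add: vec_eq_iff all_pl)
qed

lemma span_pair_in_lines_iff: "vec.span {x, y} \<in> lines \<longleftrightarrow> plucker x y \<noteq> 0"
proof
  assume l: "vec.span {x, y} \<in> lines"
  show "plucker x y \<noteq> 0"
  proof
    assume "plucker x y = 0"
    then obtain s t where st: "s \<noteq> 0 \<or> t \<noteq> 0" and eq: "s *s x + t *s y = 0"
      unfolding plucker_eq_0_iff by blast
    have dim: "vec.dim {x, y} = 2" using l by (simp add: lines_def)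
    have "vec.dependent {x, y} \<or> x = y"
    proof (rule ccontr)
      assume "\<not> ?thesis"
      then have ind: "vec.independent {x, y}" and "x \<noteq> y" by auto
      have "\<forall>v\<in>{x, y}. (if v = x then s else t) = 0"
        using vec.independentD[OF ind, of "{x, y}" "\<lambda>v. if v = x then s else t"] eq \<open>x \<noteq> y\<close>
        by fastforce
      then show False using st \<open>x \<noteq> y\<close> by (auto split: if_splits)
    qed
    then show False
    proof
      assume "x = y"
      then have "vec.dim {x, y} \<le> card {x}" using vec.dim_le_card'[of "{x}"] by simp
      then show False using dim by simp
    next
      assume dep: "vec.dependent {x, y}"
      have "card {x, y} \<le> 2" by (simp add: card_insert_if)
      then have "card {x, y} \<le> vec.dim (vec.span {x, y})" using dim by simp
      then have "vec.independent {x, y}"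
        by (intro vec.card_le_dim_spanning[of _ "vec.span {x, y}"]) (auto simp: vec.span_superset)
      then show False using dep by simp
    qed
  qed
next
  assume p: "plucker x y \<noteq> 0"
  have "plucker x x = 0" by (simp add: vec_eq_iff all_pl mult.commute)
  then have ne: "x \<noteq> y" using p by auto
  have "vec.independent {x, y}"
  proof (rule vec.independent_insertI)
    show "x \<notin> vec.span {y}"
    proof
      assume "x \<in> vec.span {y}"
      then obtain k where "x = k *s y" by (auto simp: vec.span_singleton)
      then have "1 *s x + (- k) *s y = 0" by (simp add: vec_eq_iff)
      then show False using p plucker_eq_0_iff by (metis zero_neq_one)
    qed
    have "plucker x 0 = 0" by (simp add: vec_eq_iff all_pl)
    then have "y \<noteq> 0" using p by auto
    then show "vec.independent {y}" by simp
  qed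
  then have "vec.dim {x, y} = 2" using ne by (simp add: vec.dim_eq_card_independent)
  then show "vec.span {x, y} \<in> lines" by (simp add: lines_def)
qed

lemma lines_basis:
  assumes "L \<in> lines"
  obtains a b where "L = {s *s a + t *s b | s t. True}" "plucker a b \<noteq> 0"
proof -
  obtain B where B: "B \<subseteq> L" "vec.independent B" "L \<subseteq> vec.span B" "card B = vec.dim L"
    using vec.basis_exists by blast
  have "card B = 2" using B assms by (simp add: lines_def)
  then obtain a b where "B = {a, b}" by (auto simp: card_2_iff)
  moreover have "L = vec.span B"
    using B assms by (simp add: lines_def vec.span_subspace)
  ultimately have L: "L = vec.span {a, b}" by simp
  show ?thesis
    by (rule that[of a b]) (use assms span_pair_in_lines_iff[of a b] in \<open>auto simp: L span_pair\<close>)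
qed

text \<open>Turns the vanishing of a 2x2 minor or of a Gram determinant into the existence of a
  point on a line.\<close>

lemma two_by_two_kernel:
  fixes a b c d :: "'a::field"
  shows "a * d = b * c \<longleftrightarrow> (\<exists>s t. (s \<noteq> 0 \<or> t \<noteq> 0) \<and> s * a + t * b = 0 \<and> s * c + t * d = 0)"
proof
  assume eq: "a * d = b * c"
  show "\<exists>s t. (s \<noteq> 0 \<or> t \<noteq> 0) \<and> s * a + t * b = 0 \<and> s * c + t * d = 0"
  proof (cases "a = 0 \<and> b = 0")
    case True
    show ?thesis
    proof (cases "c = 0 \<and> d = 0")
      case True
      with \<open>a = 0 \<and> b = 0\<close> show ?thesis by (intro exI[of _ 1] exI[of _ 0]) simp
    next
      case False
      with \<open>a = 0 \<and> b = 0\<close> show ?thesis by (intro exI[of _ d] exI[of _ "- c"]) (auto simp: mult.commute)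
    qed
  next
    case False
    with eq show ?thesis by (intro exI[of _ b] exI[of _ "- a"]) (auto simp: mult.commute)
  qed
next
  assume "\<exists>s t. (s \<noteq> 0 \<or> t \<noteq> 0) \<and> s * a + t * b = 0 \<and> s * c + t * d = 0"
  then obtain s t where st: "s \<noteq> 0 \<or> t \<noteq> 0" and eq: "s * a + t * b = 0" "s * c + t * d = 0" by blast
  have "s * (a * d - b * c) = 0" "t * (a * d - b * c) = 0" using eq by algebra+
  then show "a * d = b * c" using st by auto
qed

text \<open>The quadratic formula in homogeneous form; \<open>C = 0\<close> is the case with a root
  at \<open>s = 0\<close>.\<close>

lemma binary_quadratic_root:
  fixes A B C :: "'a::{alg_closed_field, field_char_0}"
  shows "\<exists>s t. (s \<noteq> 0 \<or> t \<noteq> 0) \<and> A * s ^ 2 + B * s * t + C * t ^ 2 = 0"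
proof (cases "C = 0")
  case True
  then show ?thesis by (intro exI[of _ 0] exI[of _ 1]) simp
next
  case False
  obtain r where r: "r ^ 2 = B ^ 2 - 4 * A * C" using nth_root_exists[of 2] by auto
  have "A * (2 * C) ^ 2 + B * (2 * C) * (r - B) + C * (r - B) ^ 2 = 0"
    using r by algebra
  then show ?thesis using False by (intro exI[of _ "2 * C"] exI[of _ "r - B"]) simp
qed

text \<open>Every zero of \<open>Q\<close> is a Pluecker vector, so \<open>F\<close> needs to be
  examined only on these.\<close>

lemma proj_zeros_pluckerQ_eq:
  fixes F :: "(pl, 'a::field) mpoly"
  assumes "\<And>x y. plucker x y \<noteq> 0 \<Longrightarrow> eval_poly F (plucker x y) = 0 \<longleftrightarrow> vec.span {x, y} \<in> \<L>"
  shows "proj_zeros {pluckerQ, F} = plucker_vectors \<L>"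
proof (rule set_eqI)
  fix p
  have "p \<in> proj_zeros {pluckerQ, F} \<longleftrightarrow>
      (\<exists>x y. p = plucker x y \<and> plucker x y \<noteq> 0 \<and> eval_poly F (plucker x y) = 0)"
    using pluckerQ_zero_imp_plucker[of p] pluckerQ_plucker
    unfolding proj_zeros_def by (auto simp del: eval_pluckerQ)
  also have "\<dots> \<longleftrightarrow> p \<in> plucker_vectors \<L>"
    by (auto simp: plucker_vectors_def span_pair_in_lines_iff assms cong: conj_cong)
  finally show "p \<in> proj_zeros {pluckerQ, F} \<longleftrightarrow> p \<in> plucker_vectors \<L>" .
qed

text \<open>The span of \<open>x\<close> and \<open>y\<close> meets the image of \<open>C\<close>
  under \<open>P\<close> exactly if the span of \<open>B *v x\<close> and \<open>B *v y\<close>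
  meets \<open>C\<close>, so the form is pulled back by the inverse matrix.\<close>

lemma honest_cayley_threefold_eq:
  fixes F :: "(pl, 'a::field_char_0) mpoly"
  assumes B: "P ** B = mat 1" "B ** P = mat 1"
    and F: "\<And>x y. plucker x y \<noteq> 0 \<Longrightarrow>
      eval_poly F (plucker x y) = 0 \<longleftrightarrow> (\<exists>s t. s *s x + t *s y \<in> C)"
  shows "proj_zeros {pluckerQ, pullback (ext2 B) F} = honest_cayley_threefold ((*v) P ` C)"
  unfolding honest_cayley_threefold_def
proof (rule proj_zeros_pluckerQ_eq)
  fix x y :: "'a ^ 4"
  assume p: "plucker x y \<noteq> 0"
  have PB: "P *v (B *v z) = z" "B *v (P *v z) = z" for z by (simp_all add: matrix_vector_mul_assoc B)
  have "ext2 P *v (ext2 B *v plucker x y) = plucker x y"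
    by (simp add: PB flip: plucker_matrix_vector)
  then have "plucker (B *v x) (B *v y) \<noteq> 0"
    using p by (auto simp: plucker_matrix_vector)
  then have "eval_poly (pullback (ext2 B) F) (plucker x y) = 0 \<longleftrightarrow>
      (\<exists>s t. s *s (B *v x) + t *s (B *v y) \<in> C)"
    using F by (simp flip: plucker_matrix_vector)
  also have "\<dots> \<longleftrightarrow> (\<exists>s t. s *s x + t *s y \<in> (*v) P ` C)"
  proof -
    have "s *s (B *v x) + t *s (B *v y) = B *v (s *s x + t *s y)" for s t
      by (simp add: matrix_vector_right_distrib vector_scalar_commute)
    moreover have "B *v z \<in> C \<longleftrightarrow> z \<in> (*v) P ` C" for z
    proof
      assume "B *v z \<in> C"
      then have "P *v (B *v z) \<in> (*v) P ` C" by (rule imageI)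
      then show "z \<in> (*v) P ` C" by (simp only: PB)
    next
      assume "z \<in> (*v) P ` C"
      then obtain c where "z = P *v c" "c \<in> C" by blast
      then show "B *v z \<in> C" by (simp add: PB)
    qed
    ultimately show ?thesis by (simp only:)
  qed
  also have "\<dots> \<longleftrightarrow> vec.span {x, y} \<inter> (*v) P ` C \<noteq> {}"
    unfolding span_pair by blast
  finally show "eval_poly (pullback (ext2 B) F) (plucker x y) = 0 \<longleftrightarrow>
      vec.span {x, y} \<in> {L \<in> lines. L \<inter> (*v) P ` C \<noteq> {}}"
    using p span_pair_in_lines_iff[of x y] by simp
qed

subsection \<open>Two skew lines\<close>

text \<open>The two factors vanish on the lines meeting \<open>\<langle>e\<^sub>0, e\<^sub>2\<rangle>\<close> and \<open>\<langle>e\<^sub>0 + e\<^sub>1, e\<^sub>2 + e\<^sub>3\<rangle>\<close>; the choice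
  of these skew lines makes the product quadratic in \<open>p\<^sub>1\<^sub>3\<close>.\<close>

definition skew_form :: "(pl, 'a::field) mpoly" where
  "skew_form = Var P13 * (Var P13 + Var P02 - Var P03 - Var P12) + Const (1/2) * pluckerQ"

lemma is_form_degree_2:
  "is_form 1 F \<Longrightarrow> is_form 1 G \<Longrightarrow> is_form 2 (F * G)"
  "is_form 1 F \<Longrightarrow> is_form 2 (F ^ 2)"
  using is_form_mult[of 1 F 1 G] is_form_power[of 1 F 2] by (simp_all add: numeral_2_eq_2)

lemma is_form_Var_1: "is_form 1 (Var v)"
  by simp

lemma is_form_numeral_mult: "is_form d F \<Longrightarrow> is_form d (numeral n * F)"
  using is_form_mult[OF is_form_numeral] by fastforce

lemmas is_form_intros = is_form_degree_2 is_form_Var_1 is_form_numeral_mult is_form_Const_mult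
  is_form_pluckerQ is_form_add is_form_diff

lemma skew_form_normal: "normal_cayley_form 2 (skew_form :: (pl, 'a::{alg_closed_field, field_char_0}) mpoly)"
\<comment> \<open>The quadratic polynomial is \<open>p13 * (p13 - b)\<close> with discriminant
  \<open>b ^ 2\<close>, which is 1 at \<open>z\<close>; at \<open>x\<close> the form is 1.\<close>
proof (rule normal_cayley_formI[where a = 1 and j = 0 and k = 0
      and b = "- (Var P02 - Var P03 - Var P12)" and g = 0 and E = "Const (1/2)"
      and z = "pl_vec 0 1 0 0 0 0" and x = "pl_vec 0 0 0 0 1 0"])
  show "is_form 2 (skew_form :: (pl, 'a) mpoly)"
    unfolding skew_form_def by (intro is_form_intros)
qed (auto simp: skew_form_def power2_eq_square algebra_simps)

text \<open>The two linear factors \<open>l\<close>, \<open>m\<close> satisfy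
  \<open>{l, l} = {m, m} = 0\<close> and \<open>{l, m} = -1\<close>, so
  \<open>{l m, l m} = -2 l m\<close>. Adding \<open>Q / 2\<close> cancels this and leaves
  \<open>{Q / 2, Q / 2} = Q / 2\<close>.\<close>

lemma skew_form_bracket:
  "cayley_bracket skew_form skew_form = Const (1/2) * (pluckerQ :: (pl, 'a::field_char_0) mpoly)"
  by (rule eval_poly_eqI)
    (simp add: cayley_bracket_def skew_form_def partial_mult partial_pluckerQ partial_Var field_simps)

lemma pluckerQ_nonzero: "pluckerQ \<noteq> (0 :: (pl, 'a::field) mpoly)"
proof
  assume "pluckerQ = (0 :: (pl, 'a) mpoly)"
  then have "eval_poly pluckerQ (pl_vec 1 0 0 0 0 1 :: 'a ^ pl) = 0" by simp
  then show False by simp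
qed

lemma skew_form_weak: "weak_cayley_eq (skew_form :: (pl, 'a::field_char_0) mpoly)"
  by (simp add: weak_cayley_eq_def skew_form_bracket)

lemma skew_form_not_strong: "\<not> strong_cayley_eq (skew_form :: (pl, 'a::field_char_0) mpoly)"
  by (simp add: strong_cayley_eq_def skew_form_bracket Const_mult_eq_0_iff pluckerQ_nonzero)

text \<open>The Laplacian is 1/2: the product of linear factors contributes -1 and
  \<open>Q / 2\<close> contributes 3/2.\<close>

lemma skew_form_not_harmonic: "\<not> harmonic (skew_form :: (pl, 'a::field_char_0) mpoly)"
proof
  assume "harmonic (skew_form :: (pl, 'a) mpoly)"
  then have "eval_poly (laplacian (skew_form :: (pl, 'a) mpoly)) 0 = 0" by (simp add: harmonic_def)
  then show False
    by (simp add: laplacian_def skew_form_def partial_mult partial_pluckerQ partial_Var)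
qed

text \<open>On Pluecker vectors each linear factor is the 2x2 minor of the two linear forms that cut
  out one of the lines: \<open>x_1, x_3\<close> and \<open>x_0 - x_1, x_2 - x_3\<close>.\<close>

lemma skew_form_zeros:
  fixes x y :: "'a::field_char_0 ^ 4"
  assumes p: "plucker x y \<noteq> 0"
  shows "eval_poly skew_form (plucker x y) = 0 \<longleftrightarrow>
    (\<exists>s t. s *s x + t *s y \<in> {c. c \<noteq> 0 \<and> (c $ 1 = 0 \<and> c $ 3 = 0 \<or> c $ 0 = c $ 1 \<and> c $ 2 = c $ 3)})"
proof -
  have Q: "eval_poly pluckerQ (plucker x y) = 0" by (rule pluckerQ_plucker)
  have nz: "s *s x + t *s y \<noteq> 0 \<longleftrightarrow> s \<noteq> 0 \<or> t \<noteq> 0" for s t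
    using p plucker_eq_0_iff[of x y] by (auto simp: vec_eq_iff)
  have "eval_poly skew_form (plucker x y) = plucker x y $ P13 *
      (plucker x y $ P13 + plucker x y $ P02 - plucker x y $ P03 - plucker x y $ P12)"
    using Q by (simp add: skew_form_def del: eval_pluckerQ plucker_nth)
  also have "\<dots> = 0 \<longleftrightarrow> x $ 1 * y $ 3 = y $ 1 * x $ 3 \<or>
      (x $ 0 - x $ 1) * (y $ 2 - y $ 3) = (y $ 0 - y $ 1) * (x $ 2 - x $ 3)"
  proof -
    have "plucker x y $ P13 = x $ 1 * y $ 3 - y $ 1 * x $ 3" by simp
    moreover have "plucker x y $ P13 + plucker x y $ P02 - plucker x y $ P03 - plucker x y $ P12 =
      (x $ 0 - x $ 1) * (y $ 2 - y $ 3) - (y $ 0 - y $ 1) * (x $ 2 - x $ 3)"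
      by (simp add: algebra_simps)
    ultimately show ?thesis by (simp only: mult_eq_0_iff right_minus_eq)
  qed
  also have "\<dots> \<longleftrightarrow> (\<exists>s t. (s \<noteq> 0 \<or> t \<noteq> 0) \<and> s * x $ 1 + t * y $ 1 = 0 \<and> s * x $ 3 + t * y $ 3 = 0) \<or>
      (\<exists>s t. (s \<noteq> 0 \<or> t \<noteq> 0) \<and> s * (x $ 0 - x $ 1) + t * (y $ 0 - y $ 1) = 0 \<and>
        s * (x $ 2 - x $ 3) + t * (y $ 2 - y $ 3) = 0)"
    unfolding two_by_two_kernel ..
  also have "\<dots> \<longleftrightarrow> (\<exists>s t. (s \<noteq> 0 \<or> t \<noteq> 0) \<and> (s * x $ 1 + t * y $ 1 = 0 \<and> s * x $ 3 + t * y $ 3 = 0 \<or>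
      s * x $ 0 + t * y $ 0 = s * x $ 1 + t * y $ 1 \<and> s * x $ 2 + t * y $ 2 = s * x $ 3 + t * y $ 3))"
  proof -
    have "s * (a - b) + t * (c - d) = 0 \<longleftrightarrow> s * a + t * c = s * b + t * d" for s t a b c d :: 'a
      by (auto simp: algebra_simps)
    then show ?thesis by auto
  qed
  finally show ?thesis by (simp add: nz)
qed

subsection \<open>Smooth quadrics\<close>

text \<open>Minus the Gram determinant, on a line, of the polar form of \<open>x\<^sub>0 x\<^sub>2 - x\<^sub>1 x\<^sub>3\<close>.\<close>

definition quadric_form :: "(pl, 'a::field) mpoly" where
  "quadric_form = Var P02 ^ 2 + Var P13 ^ 2 + 2 * (Var P01 * Var P23) - 2 * (Var P03 * Var P12)"

lemma quadric_form_normal: "normal_cayley_form 2 (quadric_form :: (pl, 'a::{alg_closed_field, field_char_0}) mpoly)"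
\<comment> \<open>Modulo \<open>Q\<close> the form is
  \<open>(p02 + p13) ^ 2 - 4 * p03 * p12\<close>, with discriminant \<open>16 * p03 * p12\<close> in
  \<open>p13\<close>.\<close>
proof (rule normal_cayley_formI[where a = 1 and j = 0 and k = 0
      and b = "- (2 * Var P02)" and g = "4 * (Var P03 * Var P12) - Var P02 ^ 2" and E = 2
      and z = "pl_vec 0 0 1 1 0 0" and x = "pl_vec 0 0 0 0 1 0"])
  show "is_form 2 (quadric_form :: (pl, 'a) mpoly)"
    unfolding quadric_form_def by (intro is_form_intros)
  show "Const 1 * Var P01 ^ 0 * (quadric_form :: (pl, 'a) mpoly) = Var P01 ^ 0 * Var P13 ^ 2
      - - (2 * Var P02) * Var P13 - (4 * (Var P03 * Var P12) - Var P02 ^ 2) + 2 * pluckerQ"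
    by (rule eval_poly_eqI) (simp add: quadric_form_def algebra_simps)
qed (auto simp: quadric_form_def)

text \<open>The gradient is linear in the point and multiplies \<open>Q\<close> by 4, and
  \<open>{F, F}\<close> is twice \<open>Q\<close> of the gradient.\<close>

lemma quadric_form_bracket:
  "cayley_bracket quadric_form quadric_form = Const 8 * (pluckerQ :: (pl, 'a::field_char_0) mpoly)"
  by (rule eval_poly_eqI)
    (simp add: cayley_bracket_def quadric_form_def power2_eq_square partial_mult partial_Var algebra_simps)

lemma quadric_form_weak: "weak_cayley_eq (quadric_form :: (pl, 'a::field_char_0) mpoly)"
  unfolding weak_cayley_eq_def quadric_form_bracket by simp

lemma quadric_form_not_strong: "\<not> strong_cayley_eq (quadric_form :: (pl, 'a::field_char_0) mpoly)"
  unfolding strong_cayley_eq_def quadric_form_bracket by (simp add: Const_mult_eq_0_iff pluckerQ_nonzero)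

lemma quadric_form_harmonic: "harmonic (quadric_form :: (pl, 'a::field_char_0) mpoly)"
  unfolding harmonic_def
  by (simp add: laplacian_def quadric_form_def power2_eq_square partial_mult partial_Var)

subsection \<open>Plane conics\<close>

text \<open>A line meets the plane \<open>x\<^sub>3 = 0\<close> in \<open>(p\<^sub>0\<^sub>3 : p\<^sub>1\<^sub>3 : p\<^sub>2\<^sub>3 : 0)\<close>; the conic is \<open>x\<^sub>1\<^sup>2 = x\<^sub>0 x\<^sub>2\<close>.\<close>

definition conic_form :: "(pl, 'a::field) mpoly" where
  "conic_form = Var P13 ^ 2 - Var P03 * Var P23"

lemma conic_form_normal: "normal_cayley_form 2 (conic_form :: (pl, 'a::{alg_closed_field, field_char_0}) mpoly)"
\<comment> \<open>The factor \<open>p01\<close> is needed to eliminate \<open>p23\<close> through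
  \<open>Q\<close>. The discriminant is \<open>p03 ^ 2 * (p02 ^ 2 - 4 * p01 * p12)\<close>, which is
  1 at \<open>z\<close>.\<close>
proof (rule normal_cayley_formI[where a = 1 and j = 1 and k = 1
      and b = "Var P03 * Var P02" and g = "- (Var P03 ^ 2 * Var P12)" and E = "- Var P03"
      and z = "pl_vec 0 1 1 0 0 0" and x = "pl_vec 0 0 0 0 1 0"])
  show "is_form 2 (conic_form :: (pl, 'a) mpoly)"
    unfolding conic_form_def by (intro is_form_intros)
  show "Const 1 * Var P01 ^ 1 * (conic_form :: (pl, 'a) mpoly) = Var P01 ^ 1 * Var P13 ^ 2
      - Var P03 * Var P02 * Var P13 - - (Var P03 ^ 2 * Var P12) + - Var P03 * pluckerQ"
    by (rule eval_poly_eqI) (simp add: conic_form_def algebra_simps power2_eq_square)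
qed (auto simp: conic_form_def)

lemma conic_form_strong: "strong_cayley_eq (conic_form :: (pl, 'a::field_char_0) mpoly)"
  unfolding strong_cayley_eq_def
  by (simp add: cayley_bracket_def conic_form_def power2_eq_square partial_mult partial_Var)

lemma conic_form_harmonic: "harmonic (conic_form :: (pl, 'a::field_char_0) mpoly)"
  unfolding harmonic_def
  by (simp add: laplacian_def conic_form_def power2_eq_square partial_mult partial_Var)

text \<open>If the line lies in the plane, all \<open>p_i3\<close> vanish, and the line does meet
  the conic, in a root of a binary quadratic form. Otherwise its only point in the plane is
  \<open>y_3 x - x_3 y\<close>, with coordinates \<open>p_i3\<close>.\<close>

lemma conic_form_zeros:
  fixes x y :: "'a::{alg_closed_field, field_char_0} ^ 4"
  assumes p: "plucker x y \<noteq> 0"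
  shows "eval_poly conic_form (plucker x y) = 0 \<longleftrightarrow>
    (\<exists>s t. s *s x + t *s y \<in> {c. c \<noteq> 0 \<and> c $ 3 = 0 \<and> (c $ 1) ^ 2 = c $ 0 * c $ 2})"
proof
  have nz: "s *s x + t *s y \<noteq> 0 \<longleftrightarrow> s \<noteq> 0 \<or> t \<noteq> 0" for s t
    using p plucker_eq_0_iff[of x y] by (auto simp: vec_eq_iff)
  assume 0: "eval_poly conic_form (plucker x y) = 0"
  show "\<exists>s t. s *s x + t *s y \<in> {c. c \<noteq> 0 \<and> c $ 3 = 0 \<and> (c $ 1) ^ 2 = c $ 0 * c $ 2}"
  proof (cases "x $ 3 = 0 \<and> y $ 3 = 0")
    case True
    obtain s t where st: "s \<noteq> 0 \<or> t \<noteq> 0" and eq: "((x $ 1) ^ 2 - x $ 0 * x $ 2) * s ^ 2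
      + (2 * x $ 1 * y $ 1 - x $ 0 * y $ 2 - x $ 2 * y $ 0) * s * t + ((y $ 1) ^ 2 - y $ 0 * y $ 2) * t ^ 2 = 0"
      using binary_quadratic_root by blast
    have "(s * x $ 1 + t * y $ 1) ^ 2 = (s * x $ 0 + t * y $ 0) * (s * x $ 2 + t * y $ 2)"
      using eq by algebra
    then show ?thesis using st nz True by (intro exI[of _ s] exI[of _ t]) simp
  next
    case False
    then have "y $ 3 *s x + (- x $ 3) *s y \<noteq> 0" by (subst nz) auto
    moreover have "(y $ 3 * x $ 1 - x $ 3 * y $ 1) ^ 2 =
        (y $ 3 * x $ 0 - x $ 3 * y $ 0) * (y $ 3 * x $ 2 - x $ 3 * y $ 2)"
      using 0 unfolding conic_form_def by simp algebra
    ultimately show ?thesis by (intro exI[of _ "y $ 3"] exI[of _ "- x $ 3"]) simp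
  qed
next
  assume "\<exists>s t. s *s x + t *s y \<in> {c. c \<noteq> 0 \<and> c $ 3 = 0 \<and> (c $ 1) ^ 2 = c $ 0 * c $ 2}"
  then obtain s t where nz: "s *s x + t *s y \<noteq> 0" and 3: "s * x $ 3 + t * y $ 3 = 0"
    and eq: "(s * x $ 1 + t * y $ 1) ^ 2 = (s * x $ 0 + t * y $ 0) * (s * x $ 2 + t * y $ 2)" by auto
  have st: "s \<noteq> 0 \<or> t \<noteq> 0" using nz by auto
  define w where "w i = s * x $ i + t * y $ i" for i
  \<comment> \<open>Both \<open>s\<close> and \<open>t\<close> times the vector of the
    \<open>p_i3\<close> are multiples of the common point \<open>w\<close>, so the conic equation
    passes from \<open>w\<close> to the \<open>p_i3\<close>.\<close>
  have s: "s * (x $ i * y $ 3 - x $ 3 * y $ i) = y $ 3 * w i" for i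
    using 3 unfolding w_def by algebra
  have t: "t * (x $ i * y $ 3 - x $ 3 * y $ i) = - x $ 3 * w i" for i
    using 3 unfolding w_def by algebra
  have w: "w 1 ^ 2 = w 0 * w 2" using eq by (simp add: w_def)
  let ?F = "eval_poly conic_form (plucker x y)"
  have F: "?F = (x $ 1 * y $ 3 - x $ 3 * y $ 1) ^ 2
      - (x $ 0 * y $ 3 - x $ 3 * y $ 0) * (x $ 2 * y $ 3 - x $ 3 * y $ 2)"
    by (simp add: conic_form_def)
  have "s ^ 2 * ?F = 0" unfolding F using s[of 0] s[of 1] s[of 2] w by algebra
  moreover have "t ^ 2 * ?F = 0" unfolding F using t[of 0] t[of 1] t[of 2] w by algebra
  ultimately show "?F = 0" using st by auto
qed

subsection \<open>Twisted cubics\<close>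

text \<open>Modulo \<open>Q\<close> this is three times the Bezout determinant of the two binary cubics that a line,
  as an intersection of two planes, cuts out on the curve.\<close>

definition twisted_form :: "(pl, 'a::field) mpoly" where
  "twisted_form =
     2 * (Var P01 * Var P03 * Var P23) + 6 * (Var P01 * Var P12 * Var P23)
     - 3 * (Var P01 * Var P13 * Var P13) - 3 * (Var P02 * Var P02 * Var P23)
     + Var P02 * Var P03 * Var P13 + 3 * (Var P02 * Var P12 * Var P13)
     - Var P03 * Var P03 * Var P12 - 3 * (Var P12 * Var P12 * Var P12)"

lemma is_form_degree_3: "is_form 1 F \<Longrightarrow> is_form 1 G \<Longrightarrow> is_form 1 H \<Longrightarrow> is_form 3 (F * G * H)"
  using is_form_mult[of 2 "F * G" 1 H] by (simp add: is_form_degree_2)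

lemma twisted_form_normal: "normal_cayley_form 3 (twisted_form :: (pl, 'a::{alg_closed_field, field_char_0}) mpoly)"
\<comment> \<open>The scalar -1/3 makes \<open>p01 ^ 2\<close> the leading coefficient in
  \<open>p13\<close>. At \<open>z\<close> one has \<open>b = 0\<close> and \<open>g = -1\<close>,
  hence discriminant -4; at \<open>x\<close> the form is -3.\<close>
proof (rule normal_cayley_formI[where a = "- (1/3)" and j = 1 and k = 2
      and b = "Var P02 * (Var P01 * (Var P12 + Var P03) - Var P02 ^ 2) + 2 * Var P01 * Var P02 * Var P12"
      and g = "- (Var P03 * Var P12 * (Var P01 * (Var P12 + Var P03) - Var P02 ^ 2)) - Var P01 * Var P12 ^ 2 * (Var P12 + Var P03)"
      and E = "Var P02 ^ 2 - Var P01 * (Var P12 + Var P03) - Const (1/3) * Var P01 * (3 * Var P12 - Var P03)"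
      and z = "pl_vec 1 0 0 1 0 0" and x = "pl_vec 0 0 0 1 0 0"])
  show "is_form 3 (twisted_form :: (pl, 'a) mpoly)"
    unfolding twisted_form_def
    by (intro is_form_add is_form_diff is_form_numeral_mult is_form_degree_3 is_form_Var_1)
  show "Const (- (1/3)) * Var P01 ^ 1 * (twisted_form :: (pl, 'a) mpoly) = Var P01 ^ 2 * Var P13 ^ 2
      - (Var P02 * (Var P01 * (Var P12 + Var P03) - Var P02 ^ 2) + 2 * Var P01 * Var P02 * Var P12) * Var P13
      - (- (Var P03 * Var P12 * (Var P01 * (Var P12 + Var P03) - Var P02 ^ 2)) - Var P01 * Var P12 ^ 2 * (Var P12 + Var P03))
      + (Var P02 ^ 2 - Var P01 * (Var P12 + Var P03) - Const (1/3) * Var P01 * (3 * Var P12 - Var P03)) * pluckerQ"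
    by (rule eval_poly_eqI) (simp add: twisted_form_def power2_eq_square field_simps)
qed (auto simp: twisted_form_def)

text \<open>The multiple \<open>(3 * p12 - p03) * Q\<close>, added to three times the Bezout
  determinant, is the correction that makes the bracket divisible by \<open>Q\<close>.\<close>

lemma twisted_form_bracket:
  "cayley_bracket twisted_form twisted_form = (pluckerQ :: (pl, 'a::field_char_0) mpoly) *
     (24 * (Var P01 * Var P23) - 24 * (Var P02 * Var P13) + 4 * Var P03 ^ 2 + 36 * Var P12 ^ 2)"
  by (rule eval_poly_eqI)
    (simp add: cayley_bracket_def twisted_form_def partial_mult partial_Var power2_eq_square algebra_simps)

lemma twisted_form_weak: "weak_cayley_eq (twisted_form :: (pl, 'a::field_char_0) mpoly)"
  unfolding weak_cayley_eq_def twisted_form_bracket by (rule dvd_triv_left)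

lemma twisted_form_not_strong: "\<not> strong_cayley_eq (twisted_form :: (pl, 'a::field_char_0) mpoly)"
proof
  assume "strong_cayley_eq (twisted_form :: (pl, 'a) mpoly)"
  then have "eval_poly (cayley_bracket twisted_form twisted_form) (pl_vec 1 0 0 0 0 1 :: 'a ^ pl) = 0"
    by (simp add: strong_cayley_eq_def)
  then show False unfolding twisted_form_bracket by simp
qed

text \<open>The Laplacian is \<open>3 * p12 - p03\<close>, which is -1 at the chosen point.\<close>

lemma twisted_form_not_harmonic: "\<not> harmonic (twisted_form :: (pl, 'a::field_char_0) mpoly)"
proof
  assume "harmonic (twisted_form :: (pl, 'a) mpoly)"
  then have "eval_poly (laplacian (twisted_form :: (pl, 'a) mpoly)) (pl_vec 0 0 1 0 0 0) = 0"
    by (simp add: harmonic_def)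
  then show False
    by (simp add: laplacian_def twisted_form_def partial_mult partial_Var)
qed

text \<open>The four equations are the components of the wedge product of \<open>x\<close>,
  \<open>y\<close> and \<open>c\<close>. Once some \<open>p_ij\<close> is nonzero, Cramer's rule on
  rows \<open>i\<close>, \<open>j\<close> gives the coefficients.\<close>

lemma in_line_iff_wedge_eq_0:
  fixes x y c :: "'a::field ^ 4"
  assumes p: "plucker x y \<noteq> 0"
  defines "q \<equiv> plucker x y"
  shows "(\<exists>s t. s *s x + t *s y = c) \<longleftrightarrow>
    q $ P01 * c $ 2 - q $ P02 * c $ 1 + q $ P12 * c $ 0 = 0 \<and>
    q $ P01 * c $ 3 - q $ P03 * c $ 1 + q $ P13 * c $ 0 = 0 \<and>
    q $ P02 * c $ 3 - q $ P03 * c $ 2 + q $ P23 * c $ 0 = 0 \<and>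
    q $ P12 * c $ 3 - q $ P13 * c $ 2 + q $ P23 * c $ 1 = 0" (is "_ \<longleftrightarrow> ?W")
proof
  assume "\<exists>s t. s *s x + t *s y = c"
  then obtain s t where "c = s *s x + t *s y" by blast
  then show ?W by (simp add: q_def algebra_simps)
next
  assume W: ?W
  have ex: "\<exists>s t. s *s x + t *s y = c" if "r \<noteq> 0" "\<And>k. r * c $ k = a * x $ k + b * y $ k" for r a b
    using that by (intro exI[of _ "a / r"] exI[of _ "b / r"]) (simp add: vec_eq_iff field_simps)
  \<comment> \<open>The 3x3 minor on rows \<open>i, j, k\<close>; being alternating, it vanishes for
    all indices once it does for the four increasing triples.\<close>
  define D where "D i j k = (x $ i * y $ j - x $ j * y $ i) * c $ k - (x $ i * y $ k - x $ k * y $ i) * c $ j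
    + (x $ j * y $ k - x $ k * y $ j) * c $ i" for i j k
  have alt: "D i j i = 0" "D i j j = 0" "D i k j = - D i j k" "D j k i = D i j k" for i j k
    by (simp_all add: D_def algebra_simps)
  have 0: "D 0 1 2 = 0" "D 0 1 3 = 0" "D 0 2 3 = 0" "D 1 2 3 = 0"
    using W unfolding q_def D_def plucker_nth by blast+
  have perm: "D 0 2 1 = 0" "D 0 3 1 = 0" "D 0 3 2 = 0" "D 1 3 2 = 0"
    "D 1 2 0 = 0" "D 1 3 0 = 0" "D 2 3 0 = 0" "D 2 3 1 = 0"
    using 0 alt(3)[of 0 2 1] alt(3)[of 0 3 1] alt(3)[of 0 3 2] alt(3)[of 1 3 2]
      alt(4)[of 1 2 0] alt(4)[of 1 3 0] alt(4)[of 2 3 0] alt(4)[of 2 3 1] by simp_all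
  have minor: "\<exists>s t. s *s x + t *s y = c"
    if "x $ i * y $ j - x $ j * y $ i \<noteq> 0" "\<forall>k. D i j k = 0" for i j
  proof (rule ex[OF that(1)])
    fix k
    show "(x $ i * y $ j - x $ j * y $ i) * c $ k =
        (c $ i * y $ j - c $ j * y $ i) * x $ k + (x $ i * c $ j - x $ j * c $ i) * y $ k"
      using that(2)[rule_format, of k] by (simp add: D_def algebra_simps)
  qed
  consider "q $ P01 \<noteq> 0" | "q $ P02 \<noteq> 0" | "q $ P03 \<noteq> 0" | "q $ P12 \<noteq> 0" | "q $ P13 \<noteq> 0" | "q $ P23 \<noteq> 0"
    using p unfolding q_def vec_eq_iff all_pl by (metis zero_index)
  then show "\<exists>s t. s *s x + t *s y = c"
  proof cases
    case 1
    then show ?thesis by (intro minor[of 0 1]) (simp_all add: q_def all_4' alt(1,2) 0 perm)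
  next
    case 2
    then show ?thesis by (intro minor[of 0 2]) (simp_all add: q_def all_4' alt(1,2) 0 perm)
  next
    case 3
    then show ?thesis by (intro minor[of 0 3]) (simp_all add: q_def all_4' alt(1,2) 0 perm)
  next
    case 4
    then show ?thesis by (intro minor[of 1 2]) (simp_all add: q_def all_4' alt(1,2) 0 perm)
  next
    case 5
    then show ?thesis by (intro minor[of 1 3]) (simp_all add: q_def all_4' alt(1,2) 0 perm)
  next
    case 6
    then show ?thesis by (intro minor[of 2 3]) (simp_all add: q_def all_4' alt(1,2) 0 perm)
  qed
qed

text \<open>The equations say that a point of the cubic lies on the line with Pluecker coordinates
  \<open>a, ..., f\<close>. For \<open>\<sigma> = 1\<close> the first one is quadratic in
  \<open>\<tau>\<close>, and modulo \<open>Q\<close> the expression \<open>- a * ?F\<close> is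
  \<open>a ^ 2\<close> times the product of the values of the second one at the two roots.\<close>

lemma bezout_common_root:
  fixes a b c d e f :: "'a::{alg_closed_field, field_char_0}"
  assumes Q: "a * f - b * e + c * d = 0"
  shows "a * f * (d + c) - f * b * b - e * e * a + 2 * d * e * b - d * d * (d + c) = 0 \<longleftrightarrow>
    (\<exists>\<sigma> \<tau>. (\<sigma> \<noteq> 0 \<or> \<tau> \<noteq> 0) \<and>
      a * (\<sigma> * \<tau> ^ 2) - b * (\<sigma> ^ 2 * \<tau>) + d * \<sigma> ^ 3 = 0 \<and>
      a * \<tau> ^ 3 - c * (\<sigma> ^ 2 * \<tau>) + e * \<sigma> ^ 3 = 0 \<and>
      b * \<tau> ^ 3 - c * (\<sigma> * \<tau> ^ 2) + f * \<sigma> ^ 3 = 0 \<and>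
      d * \<tau> ^ 3 - e * (\<sigma> * \<tau> ^ 2) + f * (\<sigma> ^ 2 * \<tau>) = 0)" (is "?F = 0 \<longleftrightarrow> ?R")
proof
  assume F: "?F = 0"
  \<comment> \<open>For \<open>\<sigma> = 1\<close> the first three equations are solved for
    \<open>d\<close>, \<open>e\<close>, \<open>f\<close>; the fourth then holds identically.\<close>
  have affine: ?R if "d = b * t - a * t ^ 2" "e = c * t - a * t ^ 3" "f = c * t ^ 2 - b * t ^ 3" for t
    by (rule exI[of _ 1], rule exI[of _ t]) (simp add: that power2_eq_square power3_eq_cube algebra_simps)
  show ?R
  proof (cases "a = 0")
    case False
    obtain r where r: "r ^ 2 = b ^ 2 - 4 * a * d" using nth_root_exists[of 2] by auto
    define t u where "t = (b + r) / (2 * a)" and "u = (b - r) / (2 * a)"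
    have sum: "a * (t + u) = b" unfolding t_def u_def using False by (simp add: field_simps)
    have prod: "a * (t * u) = d"
    proof -
      have "4 * a * (a * (t * u)) = (b + r) * (b - r)"
        unfolding t_def u_def using False by (simp add: field_simps)
      also have "\<dots> = 4 * a * d" using r by algebra
      finally show ?thesis using False by simp
    qed
    have "(e - (c * t - a * t ^ 3)) * (e - (c * u - a * u ^ 3)) * a ^ 2 = 0"
      using F Q sum[symmetric] prod[symmetric] by algebra
    then consider "e = c * t - a * t ^ 3" | "e = c * u - a * u ^ 3" using False by auto
    then show ?thesis
    proof cases
      case 1
      have d: "d = b * t - a * t ^ 2" by (simp add: algebra_simps power2_eq_square flip: sum prod)
      have "a * f = a * (c * t ^ 2 - b * t ^ 3)" using Q 1 d by algebra
      then have "f = c * t ^ 2 - b * t ^ 3" using False by simp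
      with d 1 show ?thesis by (rule affine)
    next
      case 2
      have d: "d = b * u - a * u ^ 2" by (simp add: algebra_simps power2_eq_square flip: sum prod)
      have "a * f = a * (c * u ^ 2 - b * u ^ 3)" using Q 2 d by algebra
      then have "f = c * u ^ 2 - b * u ^ 3" using False by simp
      with d 2 show ?thesis by (rule affine)
    qed
  next
    case a: True
    show ?thesis
    proof (cases "b = 0")
      case False
      define t where "t = d / b"
      have d: "d = b * t" using False by (simp add: t_def)
      have "b * e = b * (c * t)" using Q a d by algebra
      then have e: "e = c * t" using False by simp
      have "b ^ 2 * f = b ^ 2 * (c * t ^ 2 - b * t ^ 3)" using F a d e by algebra
      then have "f = c * t ^ 2 - b * t ^ 3" using False by simp
      with a d e show ?thesis by (intro affine) simp_all
    next
      case b: True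
      show ?thesis
      proof (cases "d = 0")
        case True
        \<comment> \<open>The line passes through \<open>(0 : 0 : 0 : 1)\<close>, the point of the
          cubic outside the chart \<open>\<sigma> = 1\<close>.\<close>
        then show ?thesis using a b by (intro exI[of _ 0] exI[of _ 1]) simp
      next
        case False
        then have "c = 0" using Q a b by simp
        then have "d * d * d = 0" using F a b by simp
        then show ?thesis using False by simp
      qed
    qed
  qed
next
  assume ?R
  then obtain \<sigma> \<tau> where nz: "\<sigma> \<noteq> 0 \<or> \<tau> \<noteq> 0"
    and eqs: "a * (\<sigma> * \<tau> ^ 2) - b * (\<sigma> ^ 2 * \<tau>) + d * \<sigma> ^ 3 = 0"
      "a * \<tau> ^ 3 - c * (\<sigma> ^ 2 * \<tau>) + e * \<sigma> ^ 3 = 0"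
      "b * \<tau> ^ 3 - c * (\<sigma> * \<tau> ^ 2) + f * \<sigma> ^ 3 = 0"
      "d * \<tau> ^ 3 - e * (\<sigma> * \<tau> ^ 2) + f * (\<sigma> ^ 2 * \<tau>) = 0" by blast
  show "?F = 0"
  proof (cases "\<sigma> = 0")
    case True
    then have "a = 0" "b = 0" "d = 0" using nz eqs by auto
    then show ?thesis by simp
  next
    case False
    define t where "t = \<tau> / \<sigma>"
    have \<tau>: "\<tau> = \<sigma> * t" using False by (simp add: t_def)
    have "\<sigma> ^ 3 * (a * t ^ 2 - b * t + d) = 0" "\<sigma> ^ 3 * (a * t ^ 3 - c * t + e) = 0"
      "\<sigma> ^ 3 * (b * t ^ 3 - c * t ^ 2 + f) = 0"
      using eqs(1-3) unfolding \<tau> by algebra+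
    then have "a * t ^ 2 - b * t + d = 0" "a * t ^ 3 - c * t + e = 0" "b * t ^ 3 - c * t ^ 2 + f = 0"
      using False by auto
    then show ?thesis by algebra
  qed
qed

lemma twisted_form_zeros:
  fixes x y :: "'a::{alg_closed_field, field_char_0} ^ 4"
  assumes p: "plucker x y \<noteq> 0"
  shows "eval_poly twisted_form (plucker x y) = 0 \<longleftrightarrow>
    (\<exists>s t. s *s x + t *s y \<in> {vec4 (\<sigma> ^ 3) (\<sigma> ^ 2 * \<tau>) (\<sigma> * \<tau> ^ 2) (\<tau> ^ 3) | \<sigma> \<tau>. (\<sigma>, \<tau>) \<noteq> (0, 0)})"
proof -
  let ?q = "plucker x y"
  have Q: "?q $ P01 * ?q $ P23 - ?q $ P02 * ?q $ P13 + ?q $ P03 * ?q $ P12 = 0"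
    using pluckerQ_plucker[of x y] by (simp del: plucker_nth)
  have "eval_poly twisted_form ?q = 3 * (?q $ P01 * ?q $ P23 * (?q $ P12 + ?q $ P03) - ?q $ P23 * ?q $ P02 * ?q $ P02
      - ?q $ P13 * ?q $ P13 * ?q $ P01 + 2 * ?q $ P12 * ?q $ P13 * ?q $ P02 - ?q $ P12 * ?q $ P12 * (?q $ P12 + ?q $ P03))
      + (3 * ?q $ P12 - ?q $ P03) * (?q $ P01 * ?q $ P23 - ?q $ P02 * ?q $ P13 + ?q $ P03 * ?q $ P12)"
    by (simp add: twisted_form_def algebra_simps del: plucker_nth)
  then have "eval_poly twisted_form ?q = 0 \<longleftrightarrow> ?q $ P01 * ?q $ P23 * (?q $ P12 + ?q $ P03) - ?q $ P23 * ?q $ P02 * ?q $ P02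
      - ?q $ P13 * ?q $ P13 * ?q $ P01 + 2 * ?q $ P12 * ?q $ P13 * ?q $ P02 - ?q $ P12 * ?q $ P12 * (?q $ P12 + ?q $ P03) = 0"
    unfolding Q mult_zero_right add_0_right by (simp only: mult_eq_0_iff) simp
  also have "\<dots> \<longleftrightarrow> (\<exists>\<sigma> \<tau>. (\<sigma> \<noteq> 0 \<or> \<tau> \<noteq> 0) \<and>
      (\<exists>s t. s *s x + t *s y = vec4 (\<sigma> ^ 3) (\<sigma> ^ 2 * \<tau>) (\<sigma> * \<tau> ^ 2) (\<tau> ^ 3)))"
    unfolding bezout_common_root[OF Q] in_line_iff_wedge_eq_0[OF p] vec4_nth ..
  also have "\<dots> \<longleftrightarrow> (\<exists>s t. s *s x + t *s y \<in>
      {vec4 (\<sigma> ^ 3) (\<sigma> ^ 2 * \<tau>) (\<sigma> * \<tau> ^ 2) (\<tau> ^ 3) | \<sigma> \<tau>. (\<sigma>, \<tau>) \<noteq> (0, 0)})"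
    by auto
  finally show ?thesis .
qed

section \<open>Reduction to normal forms\<close>

definition dotp :: "'a::comm_ring_1 ^ 'n \<Rightarrow> 'a ^ 'n \<Rightarrow> 'a" where
  "dotp a x = (\<Sum>i\<in>UNIV. a $ i * x $ i)"

lemma dotp_simps [simp]:
  "dotp (a + b) x = dotp a x + dotp b x" "dotp a (x + y) = dotp a x + dotp a y"
  "dotp (a - b) x = dotp a x - dotp b x" "dotp a (x - y) = dotp a x - dotp a y"
  "dotp (c *s a) x = c * dotp a x" "dotp a (c *s x) = c * dotp a x"
  "dotp (- a) x = - dotp a x" "dotp a (- x) = - dotp a x"
  "dotp 0 x = 0" "dotp a 0 = 0" "dotp (axis i 1) x = x $ i" "dotp a (axis i 1) = a $ i"
  by (simp_all add: dotp_def algebra_simps sum.distrib sum_subtractf sum_distrib_left sum_negf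
      axis_def if_distrib if_distribR cong: if_cong)

text \<open>A zero fourth row completes the functionals to a singular square matrix.\<close>

lemma three_functionals_kernel:
  fixes a b c :: "'a::field ^ 4"
  obtains x where "x \<noteq> 0" "dotp a x = 0" "dotp b x = 0" "dotp c x = 0"
proof -
  define M where "M = vec4 a b c (0 :: 'a ^ 4)"
  have "\<exists>x. x \<noteq> 0 \<and> M *v x = 0"
  proof (rule ccontr)
    assume "\<not> ?thesis"
    then have "\<exists>B. B ** M = mat 1" unfolding matrix_left_invertible_ker by blast
    then obtain B :: "'a ^ 4 ^ 4" where "M ** B = mat 1" using matrix_left_right_inverse by blast
    then have "(M ** B) $ 3 $ 3 = 1" by (simp add: mat_def)
    then show False by (simp add: matrix_matrix_mult_def M_def)
  qed
  then obtain x where "x \<noteq> 0" and x: "\<And>i. dotp (M $ i) x = 0"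
    by (auto simp: vec_eq_iff matrix_vector_mult_def dotp_def)
  then show ?thesis using that[of x] x[of 0] x[of 1] x[of 2] by (simp add: M_def)
qed

definition columns4 :: "'a ^ 4 \<Rightarrow> 'a ^ 4 \<Rightarrow> 'a ^ 4 \<Rightarrow> 'a ^ 4 \<Rightarrow> 'a ^ 4 ^ 4" where
  "columns4 a b c d = transpose (vec4 a b c d)"

lemma columns4_mult_vec:
  "columns4 a b c d *v x = x $ 0 *s a + x $ 1 *s b + x $ 2 *s c + x $ 3 *s d"
  for a :: "'a::comm_ring_1 ^ 4"
  unfolding columns4_def transpose_mult_vec sum_4' by simp

lemma invertible_if_trivial_kernel:
  fixes A :: "'a::field ^ 'n ^ 'n"
  assumes "\<And>x. A *v x = 0 \<Longrightarrow> x = 0"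
  shows "invertible A"
  using assms matrix_left_invertible_ker invertible_left_inverse by blast

lemma vec4_eq_0I: "x $ 0 = 0 \<Longrightarrow> x $ 1 = 0 \<Longrightarrow> x $ 2 = 0 \<Longrightarrow> x $ 3 = 0 \<Longrightarrow> x = (0 :: 'a::zero ^ 4)"
  by (simp add: vec_eq_iff all_4')

text \<open>\<open>M\<close> is the Hessian: symmetric because partial derivatives commute, and
  related to \<open>f\<close> by Euler's identity.\<close>

lemma quadratic_form_matrix:
  fixes f :: "('v::finite, 'a::comm_ring_1) mpoly"
  assumes f: "is_form 2 f"
  obtains M :: "'a ^ 'v ^ 'v" where "transpose M = M" "\<And>x. gradient f x = M *v x" "\<And>x. 2 * eval_poly f x = dotp (M *v x) x"
proof -
  have "is_form 1 (partial v f)" for v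
    using is_form_partial[of 1 f v] f by (simp add: numeral_2_eq_2)
  then have "\<exists>c. (\<forall>w. partial w (partial v f) = Const (c $ w)) \<and>
      (\<forall>x. eval_poly (partial v f) x = (\<Sum>w\<in>UNIV. c $ w * x $ w))" for v
    using linear_form_eval by metis
  then obtain c where c: "\<And>v w. partial w (partial v f) = Const (c v $ w)"
    "\<And>v x. eval_poly (partial v f) x = (\<Sum>w\<in>UNIV. c v $ w * x $ w)" by metis
  define M where "M = (\<chi> v w. c v $ w)"
  have "c v $ w = c w $ v" for v w
    using c(1) partial_commute[of w v f] by (metis Const_eq_iff)
  then have "transpose M = M" by (simp add: M_def transpose_def vec_eq_iff)
  moreover have grad: "gradient f x = M *v x" for x
    by (simp add: gradient_def vec_eq_iff c(2) M_def matrix_vector_mult_def)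
  moreover have "2 * eval_poly f x = dotp (M *v x) x" for x
  proof -
    have "2 * eval_poly f x = eval_poly (\<Sum>v\<in>UNIV. Var v * partial v f) x"
      using euler_identity[OF f] by simp
    also have "\<dots> = dotp (gradient f x) x"
      by (simp add: eval_poly_sum dotp_def gradient_def mult.commute)
    finally show ?thesis by (simp add: grad)
  qed
  ultimately show ?thesis using that by blast
qed

section \<open>Isotropic vectors and hyperbolic pairs of a symmetric bilinear form\<close>

locale symmetric_matrix =
  fixes M :: "'a::{alg_closed_field, field_char_0} ^ 4 ^ 4"
  assumes sym: "transpose M = M"
begin

definition g :: "'a ^ 4 \<Rightarrow> 'a ^ 4 \<Rightarrow> 'a" where
  "g x y = dotp (M *v x) y"

lemma g_commute: "g x y = g y x"
proof -
  have M: "M $ i $ j = M $ j $ i" for i j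
    using arg_cong[OF sym, of "\<lambda>A. A $ i $ j"] by (simp add: transpose_def)
  have "g x y = (\<Sum>i\<in>UNIV. \<Sum>j\<in>UNIV. M $ i $ j * x $ j * y $ i)"
    by (simp add: g_def dotp_def matrix_vector_mult_def sum_distrib_right)
  also have "\<dots> = (\<Sum>j\<in>UNIV. \<Sum>i\<in>UNIV. M $ i $ j * x $ j * y $ i)" by (rule sum.swap)
  also have "\<dots> = g y x"
    by (simp add: g_def dotp_def matrix_vector_mult_def sum_distrib_left sum_distrib_right M mult_ac)
  finally show ?thesis .
qed

lemma g_linear:
  "g (x + y) z = g x z + g y z" "g z (x + y) = g z x + g z y"
  "g (x - y) z = g x z - g y z" "g z (x - y) = g z x - g z y"
  "g (c *s x) z = c * g x z" "g z (c *s x) = c * g z x"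
  "g (- x) z = - g x z" "g z (- x) = - g z x" "g 0 z = 0" "g z 0 = 0"
proof -
  show r: "g z (x + y) = g z x + g z y" "g z (x - y) = g z x - g z y" "g z (c *s x) = c * g z x"
    "g z (- x) = - g z x" "g z 0 = 0" for x y z c by (simp_all add: g_def)
  show "g (x + y) z = g x z + g y z" "g (x - y) z = g x z - g y z" "g (c *s x) z = c * g x z"
    "g (- x) z = - g x z" "g 0 z = 0"
    using r by (simp_all add: g_commute[of _ z])
qed

text \<open>Two functionals leave at least a plane, and a binary quadratic form has a zero. Choosing
  \<open>v2\<close> with zero \<open>i\<close>-th coordinate makes it independent of
  \<open>v1\<close>.\<close>

lemma isotropic_in_kernel:
  obtains w where "w \<noteq> 0" "dotp a w = 0" "dotp b w = 0" "g w w = 0"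
proof -
  obtain v1 where v1: "v1 \<noteq> 0" "dotp a v1 = 0" "dotp b v1 = 0"
    using three_functionals_kernel[of a b 0] by blast
  obtain i where i: "v1 $ i \<noteq> 0" using v1(1) by (auto simp: vec_eq_iff)
  obtain v2 where v2: "v2 \<noteq> 0" "dotp a v2 = 0" "dotp b v2 = 0" "dotp (axis i 1) v2 = 0"
    using three_functionals_kernel[of a b "axis i 1"] by blast
  obtain s t where st: "s \<noteq> 0 \<or> t \<noteq> 0" and eq: "g v1 v1 * s ^ 2 + (2 * g v1 v2) * s * t + g v2 v2 * t ^ 2 = 0"
    using binary_quadratic_root by blast
  show ?thesis
  proof (rule that[of "s *s v1 + t *s v2"])
    show "s *s v1 + t *s v2 \<noteq> 0"
    proof
      assume 0: "s *s v1 + t *s v2 = 0"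
      from arg_cong[OF this, of "\<lambda>v. v $ i"] have "s = 0" using i v2(4) by simp
      with 0 v2(1) st show False by simp
    qed
    show "g (s *s v1 + t *s v2) (s *s v1 + t *s v2) = 0"
      using eq by (simp add: g_linear g_commute[of v2 v1] algebra_simps power2_eq_square)
  qed (simp_all add: v1 v2)
qed

lemma hyperbolic_partner:
  assumes "g e e = 0" "g e y \<noteq> 0"
  obtains \<alpha> \<beta> where "g e (\<alpha> *s y + \<beta> *s e) = 1" "g (\<alpha> *s y + \<beta> *s e) (\<alpha> *s y + \<beta> *s e) = 0"
\<comment> \<open>\<open>y\<close> is scaled to pair to 1 with \<open>e\<close>; the multiple of
  \<open>e\<close> then removes its norm without changing that pairing.\<close>
proof (rule that[of "1 / g e y" "- g y y / (2 * g e y ^ 2)"])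
  show "g e ((1 / g e y) *s y + (- g y y / (2 * g e y ^ 2)) *s e) = 1"
    using assms by (simp add: g_linear)
  show "g ((1 / g e y) *s y + (- g y y / (2 * g e y ^ 2)) *s e)
      ((1 / g e y) *s y + (- g y y / (2 * g e y ^ 2)) *s e) = 0"
    using assms by (simp add: g_linear g_commute[of y e] field_simps power2_eq_square)
qed

text \<open>\<open>w\<close> is projected to the orthogonal complement of \<open>e\<close> and
  \<open>e'\<close> before its partner is formed. The explicit combination shows later that
  \<open>z'\<close> stays in a given hyperplane.\<close>

lemma second_hyperbolic_pair:
  assumes e: "g e e = 0" "g e' e' = 0" "g e e' = 1"
    and z: "g e z = 0" "g e' z = 0" "g z z = 0" "g z w \<noteq> 0"
  obtains \<alpha> \<beta> \<gamma> \<delta> z' where "z' = \<alpha> *s w + \<beta> *s z + \<gamma> *s e + \<delta> *s e'"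
    "g z z' = 1" "g z' z' = 0" "g e z' = 0" "g e' z' = 0"
proof -
  define w' where "w' = w - g e' w *s e - g e w *s e'"
  have w': "g z w' = g z w" "g e w' = 0" "g e' w' = 0"
    by (simp_all add: w'_def g_linear e z g_commute[of z e] g_commute[of z e'] g_commute[of e' e])
  obtain \<alpha> \<beta> where ab: "g z (\<alpha> *s w' + \<beta> *s z) = 1" "g (\<alpha> *s w' + \<beta> *s z) (\<alpha> *s w' + \<beta> *s z) = 0"
    using hyperbolic_partner[of z w'] z w' by auto
  show ?thesis
  proof (rule that)
    show "\<alpha> *s w' + \<beta> *s z = \<alpha> *s w + \<beta> *s z + (- (\<alpha> * g e' w)) *s e + (- (\<alpha> * g e w)) *s e'"
      by (simp add: w'_def vec_eq_iff algebra_simps)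
  qed (use ab in \<open>simp_all add: g_linear w' z\<close>)
qed

text \<open>The sign in the last column gives the polar form of \<open>x_0 x_2 - x_1 x_3\<close>;
  its nondegeneracy forces the columns to be independent.\<close>

lemma hyperbolic_basis:
  assumes "g e e = 0" "g e' e' = 0" "g e e' = 1" "g z z = 0" "g z' z' = 0" "g z z' = 1"
    "g e z = 0" "g e' z = 0" "g e z' = 0" "g e' z' = 0"
  defines "P \<equiv> columns4 e z e' (- z')"
  shows "invertible P"
    and "g (P *v x) (P *v y) = x $ 0 * y $ 2 + x $ 2 * y $ 0 - x $ 1 * y $ 3 - x $ 3 * y $ 1"
proof -
  note assms' = assms(1-10) g_commute[of e' e] g_commute[of z e] g_commute[of z' e] g_commute[of z e']
    g_commute[of z' e'] g_commute[of z' z]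
  show eq: "g (P *v x) (P *v y) = x $ 0 * y $ 2 + x $ 2 * y $ 0 - x $ 1 * y $ 3 - x $ 3 * y $ 1" for x y
    unfolding P_def columns4_mult_vec by (simp add: g_linear assms' algebra_simps)
  show "invertible P"
  proof (rule invertible_if_trivial_kernel)
    fix x assume "P *v x = 0"
    then have 0: "x $ 0 * y $ 2 + x $ 2 * y $ 0 - x $ 1 * y $ 3 - x $ 3 * y $ 1 = 0" for y :: "'a ^ 4"
      using eq[of x y] by (simp add: g_linear)
    show "x = 0"
      using 0[of "vec4 1 0 0 0"] 0[of "vec4 0 1 0 0"] 0[of "vec4 0 0 1 0"] 0[of "vec4 0 0 0 1"]
      by (intro vec4_eq_0I) simp_all
  qed
qed

lemma nondegenerate_normal_form:
  assumes nd: "\<And>x. M *v x = 0 \<Longrightarrow> x = 0"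
  obtains P :: "'a ^ 4 ^ 4" where "invertible P"
    "\<And>x y. g (P *v x) (P *v y) = x $ 0 * y $ 2 + x $ 2 * y $ 0 - x $ 1 * y $ 3 - x $ 3 * y $ 1"
proof -
  have nd': "\<exists>y. g x y \<noteq> 0" if "x \<noteq> 0" for x
  proof -
    have "M *v x \<noteq> 0" using nd that by blast
    then obtain i where "(M *v x) $ i \<noteq> 0" by (auto simp: vec_eq_iff)
    then show ?thesis by (intro exI[of _ "axis i 1"]) (simp add: g_def)
  qed
  obtain e where e: "e \<noteq> 0" "g e e = 0" using isotropic_in_kernel[of 0 0] by blast
  obtain y where "g e y \<noteq> 0" using nd' e by blast
  then obtain e' where e': "g e e' = 1" "g e' e' = 0" using hyperbolic_partner e(2) by metis
  obtain z where z: "z \<noteq> 0" "g e z = 0" "g e' z = 0" "g z z = 0"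
    using isotropic_in_kernel[of "M *v e" "M *v e'"] unfolding g_def[of e] g_def[of e'] by blast
  obtain w where "g z w \<noteq> 0" using nd' z by blast
  then obtain z' where "g z z' = 1" "g z' z' = 0" "g e z' = 0" "g e' z' = 0"
    using second_hyperbolic_pair[OF e(2) e'(2,1) z(2-4)] by metis
  then show ?thesis
    using that[OF hyperbolic_basis(1) hyperbolic_basis(2)] e e' z by blast
qed

lemma plane_normal_form:
  assumes l: "l \<noteq> 0" and nd: "\<And>x. dotp l x = 0 \<Longrightarrow> x \<noteq> 0 \<Longrightarrow> \<exists>w. dotp l w = 0 \<and> g x w \<noteq> 0"
  obtains P :: "'a ^ 4 ^ 4" where "invertible P" "\<And>x. dotp l (P *v x) = x $ 3"
    "\<And>x. x $ 3 = 0 \<Longrightarrow> g (P *v x) (P *v x) = 2 * ((x $ 1) ^ 2 - x $ 0 * x $ 2)"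
proof -
  obtain e where e: "e \<noteq> 0" "dotp l e = 0" "g e e = 0" using isotropic_in_kernel[of l 0] by blast
  obtain y where y: "dotp l y = 0" "g e y \<noteq> 0" using nd e by blast
  obtain \<alpha> \<beta> where ab: "g e (\<alpha> *s y + \<beta> *s e) = 1"
    "g (\<alpha> *s y + \<beta> *s e) (\<alpha> *s y + \<beta> *s e) = 0"
    using hyperbolic_partner[OF e(3) y(2)] .
  define e' where "e' = \<alpha> *s y + \<beta> *s e"
  have e': "dotp l e' = 0" "g e e' = 1" "g e' e' = 0"
    using ab by (simp_all add: e'_def y e)
  obtain z where z: "z \<noteq> 0" "dotp l z = 0" "g e z = 0" "g e' z = 0"
    using three_functionals_kernel[of l "M *v e" "M *v e'"] unfolding g_def[of e] g_def[of e'] by blast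
  \<comment> \<open>Otherwise \<open>z\<close> would extend to a second hyperbolic pair inside
    \<open>l = 0\<close>, placing four independent vectors in a three-dimensional space.\<close>
  have zz: "g z z \<noteq> 0"
  proof
    assume zz: "g z z = 0"
    obtain w where w: "dotp l w = 0" "g z w \<noteq> 0" using nd z by blast
    obtain \<alpha> \<beta> \<gamma> \<delta> z' where z': "z' = \<alpha> *s w + \<beta> *s z + \<gamma> *s e + \<delta> *s e'"
      "g z z' = 1" "g z' z' = 0" "g e z' = 0" "g e' z' = 0"
      using second_hyperbolic_pair[OF e(3) e'(3,2) z(3,4) zz w(2)] .
    have "dotp l z' = 0" by (simp add: z'(1) w z e e')
    then have 0: "dotp l (columns4 e z e' (- z') *v x) = 0" for x
      by (simp add: columns4_mult_vec e e' z)
    have "invertible (columns4 e z e' (- z'))"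
      using hyperbolic_basis(1) e e' z zz z' by blast
    then obtain B :: "'a ^ 4 ^ 4" where B: "columns4 e z e' (- z') ** B = mat 1" unfolding invertible_def by blast
    have "dotp l x = 0" for x
      using 0[of "B *v x"] by (simp add: matrix_vector_mul_assoc B)
    then have "l $ i = 0" for i by (metis dotp_simps(12))
    then show False using l by (simp add: vec_eq_iff)
  qed
  \<comment> \<open>Scales \<open>z\<close> to norm 2, matching the factor 2 that
    \<open>g e e' = 1\<close> puts in front of \<open>x_0 x_2\<close>.\<close>
  obtain r where r: "r ^ 2 = 2 / g z z" using nth_root_exists[of 2] by auto
  have r0: "r \<noteq> 0" using r zz by auto
  obtain i where i: "l $ i \<noteq> 0" using l by (auto simp: vec_eq_iff)
  define b where "b = (1 / l $ i) *s axis i 1"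
  have b: "dotp l b = 1" using i by (simp add: b_def)
  define P where "P = columns4 e (r *s z) (- e') b"
  have lP: "dotp l (P *v x) = x $ 3" for x
    by (simp add: P_def columns4_mult_vec e e' z b)
  have Px: "P *v x = x $ 0 *s e + x $ 1 *s (r *s z) + x $ 2 *s (- e')" if "x $ 3 = 0" for x
    using that by (simp add: P_def columns4_mult_vec)
  note gs = e(3) e'(2,3) z(3,4) g_commute[of e' e] g_commute[of z e] g_commute[of z e']
  show ?thesis
  proof (rule that[of P])
    show "invertible P"
    proof (rule invertible_if_trivial_kernel)
      fix x assume 0: "P *v x = 0"
      then have 3: "x $ 3 = 0" using lP[of x] by simp
      have "g e (P *v x) = - x $ 2" "g e' (P *v x) = x $ 0" "g z (P *v x) = x $ 1 * r * g z z"
        unfolding Px[OF 3] by (simp_all add: g_linear gs)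
      then show "x = 0"
        using 3 0 r0 zz by (intro vec4_eq_0I) (auto simp: g_linear)
    qed
    fix x :: "'a ^ 4" assume 3: "x $ 3 = 0"
    have "g (P *v x) (P *v x) = (x $ 1) ^ 2 * (r ^ 2 * g z z) - 2 * (x $ 0 * x $ 2)"
      unfolding Px[OF 3] by (simp add: g_linear gs power2_eq_square algebra_simps)
    also have "r ^ 2 * g z z = 2" using r zz by simp
    finally show "g (P *v x) (P *v x) = 2 * ((x $ 1) ^ 2 - x $ 0 * x $ 2)"
      by (simp add: algebra_simps)
  qed (rule lP)
qed

end

text \<open>Handles the closure in the tangential 3-fold: for a smooth quadric the tangent lines
  already form a zero set of forms.\<close>

lemma zariski_closure_proj_zeros:
  assumes "\<And>F. F \<in> S \<Longrightarrow> \<exists>d. is_form d F"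
  shows "zariski_closure (proj_zeros S) = proj_zeros S"
proof
  show "proj_zeros S \<subseteq> zariski_closure (proj_zeros S)"
    by (auto simp: zariski_closure_def proj_zeros_def)
  show "zariski_closure (proj_zeros S) \<subseteq> proj_zeros S"
  proof
    fix x assume x: "x \<in> zariski_closure (proj_zeros S)"
    have "eval_poly F x = 0" if "F \<in> S" for F
      using x assms[OF that] that unfolding zariski_closure_def proj_zeros_def by blast
    moreover have "x \<noteq> 0" using x by (simp add: zariski_closure_def proj_zeros_def)
    ultimately show "x \<in> proj_zeros S" by (simp add: proj_zeros_def)
  qed
qed

lemma quadric_form_plucker:
  "eval_poly quadric_form (plucker a b) =
     (a $ 0 * b $ 2 + a $ 2 * b $ 0 - a $ 1 * b $ 3 - a $ 3 * b $ 1) ^ 2 -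
     (a $ 0 * a $ 2 + a $ 2 * a $ 0 - a $ 1 * a $ 3 - a $ 3 * a $ 1) *
     (b $ 0 * b $ 2 + b $ 2 * b $ 0 - b $ 1 * b $ 3 - b $ 3 * b $ 1)"
  by (simp add: quadric_form_def power2_eq_square algebra_simps)

text \<open>The Gram determinant on a line vanishes exactly if some point of the line is orthogonal
  to the whole line. Such a point is isotropic, so it lies on the quadric, and the line lies in its
  tangent plane.\<close>

lemma smooth_quadric_tangential_threefold:
  fixes f :: "(4, 'a::{alg_closed_field, field_char_0}) mpoly"
  assumes f: "smooth_quadric f"
  obtains B :: "'a ^ 4 ^ 4" where "invertible B"
    "proj_zeros {pluckerQ, pullback (ext2 B) quadric_form} = tangential_cayley_threefold f"
proof -
  obtain M :: "'a ^ 4 ^ 4" where M: "transpose M = M" and grad: "\<And>x. gradient f x = M *v x"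
    and f2: "\<And>x. 2 * eval_poly f x = dotp (M *v x) x"
    using quadratic_form_matrix f unfolding smooth_quadric_def by blast
  interpret symmetric_matrix M by unfold_locales (rule M)
  have smooth: "gradient f x \<noteq> 0" if "x \<noteq> 0" "eval_poly f x = 0" for x
    using f that by (simp add: smooth_quadric_def proj_zeros_def)
  \<comment> \<open>A nonzero kernel vector of \<open>M\<close> would be a singular point of the
    quadric.\<close>
  have nd: "x = 0" if "M *v x = 0" for x
    using smooth[of x] f2[of x] that by (auto simp: grad)
  obtain P :: "'a ^ 4 ^ 4" where P: "invertible P"
    "\<And>x y. g (P *v x) (P *v y) = x $ 0 * y $ 2 + x $ 2 * y $ 0 - x $ 1 * y $ 3 - x $ 3 * y $ 1"
    by (rule nondegenerate_normal_form[OF nd]) blast+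
  obtain B :: "'a ^ 4 ^ 4" where B: "P ** B = mat 1" "B ** P = mat 1" using P(1) by (auto simp: invertible_def)
  have gB: "(B *v x) $ 0 * (B *v y) $ 2 + (B *v x) $ 2 * (B *v y) $ 0
      - (B *v x) $ 1 * (B *v y) $ 3 - (B *v x) $ 3 * (B *v y) $ 1 = g x y" for x y
    unfolding P(2)[symmetric] by (simp add: matrix_vector_mul_assoc B)
  let ?F = "pullback (ext2 B) quadric_form :: (pl, 'a) mpoly"
  have zeros: "proj_zeros {pluckerQ, ?F} = plucker_vectors (tangent_lines f)"
  proof (rule proj_zeros_pluckerQ_eq)
    fix x y :: "'a ^ 4" assume p: "plucker x y \<noteq> 0"
    have nz: "s *s x + t *s y \<noteq> 0 \<longleftrightarrow> s \<noteq> 0 \<or> t \<noteq> 0" for s t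
      using p plucker_eq_0_iff[of x y] by auto
    have "eval_poly ?F (plucker x y) = g x y ^ 2 - g x x * g y y"
      by (simp only: eval_poly_pullback plucker_matrix_vector[symmetric] quadric_form_plucker gB)
    also have "\<dots> = 0 \<longleftrightarrow> g x x * g y y = g x y * g x y"
      by (auto simp: power2_eq_square)
    also have "\<dots> \<longleftrightarrow> (\<exists>s t. (s \<noteq> 0 \<or> t \<noteq> 0) \<and> s * g x x + t * g x y = 0 \<and> s * g x y + t * g y y = 0)"
      by (rule two_by_two_kernel)
    also have "\<dots> \<longleftrightarrow> (\<exists>s t. s *s x + t *s y \<in> proj_zeros {f} \<and> gradient f (s *s x + t *s y) \<noteq> 0 \<and>
        (\<forall>a b. g (s *s x + t *s y) (a *s x + b *s y) = 0))"
    proof -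
      have "(s \<noteq> 0 \<or> t \<noteq> 0) \<and> s * g x x + t * g x y = 0 \<and> s * g x y + t * g y y = 0 \<longleftrightarrow>
        s *s x + t *s y \<in> proj_zeros {f} \<and> gradient f (s *s x + t *s y) \<noteq> 0 \<and>
        (\<forall>a b. g (s *s x + t *s y) (a *s x + b *s y) = 0)" (is "?L \<longleftrightarrow> ?R") for s t
      proof
        assume L: ?L
        let ?w = "s *s x + t *s y"
        have wx: "g ?w x = 0" and wy: "g ?w y = 0"
          using L by (simp_all add: g_linear g_commute[of y x])
        then have g0: "\<forall>a b. g ?w (a *s x + b *s y) = 0" by (simp add: g_linear(2,6))
        have "2 * eval_poly f ?w = 0" using g0 unfolding f2 g_def[symmetric] by blast
        then have "eval_poly f ?w = 0" by simp
        moreover have "?w \<noteq> 0" using L nz by blast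
        ultimately show ?R using g0 smooth by (simp add: proj_zeros_def)
      next
        assume R: ?R
        then have "s *s x + t *s y \<noteq> 0" by (simp add: proj_zeros_def)
        moreover have "g (s *s x + t *s y) (1 *s x + 0 *s y) = 0" "g (s *s x + t *s y) (0 *s x + 1 *s y) = 0"
          using R by blast+
        ultimately show ?L using nz by (simp add: g_linear g_commute[of y x])
      qed
      then show ?thesis by simp
    qed
    also have "\<dots> \<longleftrightarrow> vec.span {x, y} \<in> tangent_lines f"
    proof -
      have "vec.span {x, y} \<in> lines" using p span_pair_in_lines_iff by blast
      then show ?thesis
        unfolding tangent_lines_def span_pair g_def dotp_def grad[symmetric] by blast
    qed
    finally show "eval_poly ?F (plucker x y) = 0 \<longleftrightarrow> vec.span {x, y} \<in> tangent_lines f" .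
  qed
  have "is_form 2 ?F"
    using is_form_pullback quadric_form_normal unfolding normal_cayley_form_def by blast
  then have "zariski_closure (proj_zeros {pluckerQ, ?F}) = proj_zeros {pluckerQ, ?F}"
    using is_form_pluckerQ by (intro zariski_closure_proj_zeros) blast
  moreover have "invertible B" using B unfolding invertible_def by blast
  ultimately show ?thesis using that[of B] by (simp add: tangential_cayley_threefold_def zeros)
qed

text \<open>The Jacobian criterion makes the form nondegenerate on the plane: a vector orthogonal to
  the whole plane would be a point of the conic at which the gradient of \<open>q\<close> is
  proportional to that of \<open>l\<close>.\<close>

lemma smooth_plane_conic_normal_form:
  fixes D :: "('a::{alg_closed_field, field_char_0} ^ 4) set"
  assumes "smooth_plane_conic D"
  obtains P :: "'a ^ 4 ^ 4" where "invertible P"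
    "D = (*v) P ` {c. c \<noteq> 0 \<and> c $ 3 = 0 \<and> (c $ 1) ^ 2 = c $ 0 * c $ 2}"
proof -
  obtain l q where l: "is_form 1 l" "l \<noteq> 0" and q: "is_form 2 q" and D: "D = proj_zeros {l, q}"
    and smooth: "\<And>x a b. x \<in> D \<Longrightarrow> a *s gradient l x + b *s gradient q x = 0 \<Longrightarrow> a = 0 \<and> b = 0"
    using assms unfolding smooth_plane_conic_def by blast
  obtain M :: "'a ^ 4 ^ 4" where M: "transpose M = M" and grad: "\<And>x. gradient q x = M *v x"
    and q2: "\<And>x. 2 * eval_poly q x = dotp (M *v x) x"
    using quadratic_form_matrix[OF q] by blast
  interpret symmetric_matrix M by unfold_locales (rule M)
  obtain \<mu> where "\<And>v. partial v l = Const (\<mu> $ v)" and lev: "\<And>x. eval_poly l x = (\<Sum>v\<in>UNIV. \<mu> $ v * x $ v)"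
    using linear_form_eval[OF l(1)] by blast
  then have lgrad: "gradient l x = \<mu>" for x by (simp add: gradient_def vec_eq_iff)
  have leval: "eval_poly l x = dotp \<mu> x" for x by (simp add: lev dotp_def)
  have \<mu>: "\<mu> \<noteq> 0"
    using l(2) eval_poly_eq_0_imp_eq_0[of l] leval by auto
  have nd: "\<exists>w. dotp \<mu> w = 0 \<and> g x w \<noteq> 0" if x: "dotp \<mu> x = 0" "x \<noteq> 0" for x
  proof (rule ccontr)
    assume "\<not> ?thesis"
    then have 0: "g x w = 0" if "dotp \<mu> w = 0" for w using that by blast
    have "2 * eval_poly q x = 0" unfolding q2 g_def[symmetric] by (rule 0) (rule x)
    then have xD: "x \<in> D" using x by (simp add: D proj_zeros_def leval)
    obtain i where i: "\<mu> $ i \<noteq> 0" using \<mu> by (auto simp: vec_eq_iff)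
    define c where "c = (M *v x) $ i / \<mu> $ i"
    have "(M *v x) $ j = c * \<mu> $ j" for j
    proof -
      have "g x (axis j 1 - (\<mu> $ j / \<mu> $ i) *s axis i 1) = 0"
        using i by (intro 0) simp
      then show ?thesis using i by (simp add: g_def c_def field_simps)
    qed
    then have "(- c) *s gradient l x + 1 *s gradient q x = 0"
      by (simp add: lgrad grad vec_eq_iff)
    from smooth[OF xD this] show False by simp
  qed
  obtain P :: "'a ^ 4 ^ 4" where P: "invertible P" "\<And>x. dotp \<mu> (P *v x) = x $ 3"
    "\<And>x. x $ 3 = 0 \<Longrightarrow> g (P *v x) (P *v x) = 2 * ((x $ 1) ^ 2 - x $ 0 * x $ 2)"
    by (rule plane_normal_form[OF \<mu> nd]) blast+
  obtain B :: "'a ^ 4 ^ 4" where B: "P ** B = mat 1" "B ** P = mat 1" using P(1) by (auto simp: invertible_def)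
  have PB: "P *v (B *v z) = z" "B *v (P *v z) = z" for z by (simp_all add: matrix_vector_mul_assoc B)
  have mem: "P *v c \<in> D \<longleftrightarrow> c \<noteq> 0 \<and> c $ 3 = 0 \<and> (c $ 1) ^ 2 = c $ 0 * c $ 2" for c
  proof -
    have "P *v c \<noteq> 0 \<longleftrightarrow> c \<noteq> 0" using PB(2)[of c] by auto
    moreover have "eval_poly q (P *v c) = 0 \<longleftrightarrow> (c $ 1) ^ 2 = c $ 0 * c $ 2" if "c $ 3 = 0"
    proof -
      have "2 * eval_poly q (P *v c) = 2 * ((c $ 1) ^ 2 - c $ 0 * c $ 2)"
        using P(3)[OF that] unfolding q2 g_def .
      then have "eval_poly q (P *v c) = (c $ 1) ^ 2 - c $ 0 * c $ 2"
        by (simp only: mult_cancel_left) simp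
      then show ?thesis by simp
    qed
    ultimately show ?thesis by (auto simp: D proj_zeros_def leval P(2))
  qed
  have "D = (*v) P ` {c. c \<noteq> 0 \<and> c $ 3 = 0 \<and> (c $ 1) ^ 2 = c $ 0 * c $ 2}" (is "_ = _ ` ?C")
  proof
    show "D \<subseteq> (*v) P ` ?C"
    proof
      fix z assume "z \<in> D"
      then have "B *v z \<in> ?C" using mem[of "B *v z"] by (simp add: PB)
      then have "P *v (B *v z) \<in> (*v) P ` ?C" by (rule imageI)
      then show "z \<in> (*v) P ` ?C" by (simp only: PB)
    qed
    show "(*v) P ` ?C \<subseteq> D" using mem by blast
  qed
  then show ?thesis using that P(1) by blast
qed

lemma two_skew_lines_normal_form:
  fixes C :: "('a::{alg_closed_field, field_char_0} ^ 4) set"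
  assumes "two_skew_lines C"
  obtains P :: "'a ^ 4 ^ 4" where "invertible P"
    "C = (*v) P ` {c. c \<noteq> 0 \<and> (c $ 1 = 0 \<and> c $ 3 = 0 \<or> c $ 0 = c $ 1 \<and> c $ 2 = c $ 3)}"
proof -
  obtain L N where LN: "L \<in> lines" "N \<in> lines" "L \<inter> N = {0}" and C: "C = (L \<union> N) - {0}"
    using assms unfolding two_skew_lines_def by blast
  obtain a b where L: "L = {s *s a + t *s b | s t. True}" and ab: "plucker a b \<noteq> 0"
    using lines_basis[OF LN(1)] .
  obtain c d where N: "N = {s *s c + t *s d | s t. True}" and cd: "plucker c d \<noteq> 0"
    using lines_basis[OF LN(2)] .
  have ab0: "s = 0 \<and> t = 0" if "s *s a + t *s b = 0" for s t
    using that ab plucker_eq_0_iff[of a b] by blast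
  have cd0: "s = 0 \<and> t = 0" if "s *s c + t *s d = 0" for s t
    using that cd plucker_eq_0_iff[of c d] by blast
  \<comment> \<open>Sends \<open>e_0\<close>, \<open>e_2\<close> to the basis of \<open>L\<close>
    and \<open>e_0 + e_1\<close>, \<open>e_2 + e_3\<close> to the basis of \<open>N\<close>.\<close>
  define P where "P = columns4 a (c - a) b (d - b)"
  have P: "P *v x = ((x $ 0 - x $ 1) *s a + (x $ 2 - x $ 3) *s b) + (x $ 1 *s c + x $ 3 *s d)" for x
    unfolding P_def columns4_mult_vec by (simp add: vec_eq_iff algebra_simps)
  have ker: "x = 0" if "P *v x = 0" for x
  proof -
    let ?u = "(x $ 0 - x $ 1) *s a + (x $ 2 - x $ 3) *s b"
    have "?u = (- x $ 1) *s c + (- x $ 3) *s d"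
      using that unfolding P by (simp add: vec_eq_iff algebra_simps add_eq_0_iff)
    then have "?u \<in> L \<inter> N" unfolding L N by blast
    then have u: "?u = 0" using LN(3) by blast
    then have "x $ 1 *s c + x $ 3 *s d = 0" using that unfolding P by simp
    then show ?thesis using ab0[OF u] cd0 by (intro vec4_eq_0I) auto
  qed
  have inv: "invertible P" using ker by (rule invertible_if_trivial_kernel)
  have nz: "P *v x = 0 \<longleftrightarrow> x = 0" for x using ker by auto
  let ?C = "{c. c \<noteq> 0 \<and> (c $ 1 = 0 \<and> c $ 3 = 0 \<or> c $ 0 = c $ 1 \<and> c $ 2 = c $ 3)}"
  have "C = (*v) P ` ?C"
  proof
    show "C \<subseteq> (*v) P ` ?C"
    proof
      fix z assume z: "z \<in> C"
      then have z0: "z \<noteq> 0" by (simp add: C)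
      from z consider s t where "z = s *s a + t *s b" | s t where "z = s *s c + t *s d"
        unfolding C L N by blast
      then show "z \<in> (*v) P ` ?C"
      proof cases
        case 1
        then have Pz: "z = P *v vec4 s 0 t 0" unfolding P by simp
        then have "vec4 s 0 t 0 \<in> ?C" using z0 nz by auto
        then show ?thesis using Pz by blast
      next
        case 2
        then have Pz: "z = P *v vec4 s s t t" unfolding P by simp
        then have "vec4 s s t t \<in> ?C" using z0 nz by auto
        then show ?thesis using Pz by blast
      qed
    qed
    show "(*v) P ` ?C \<subseteq> C"
    proof
      fix z assume "z \<in> (*v) P ` ?C"
      then obtain x where z: "z = P *v x" and x: "x \<noteq> 0"
        and or: "x $ 1 = 0 \<and> x $ 3 = 0 \<or> x $ 0 = x $ 1 \<and> x $ 2 = x $ 3" by blast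
      have "z \<noteq> 0" using x nz z by simp
      moreover have "z \<in> L \<union> N"
        using or
      proof
        assume "x $ 1 = 0 \<and> x $ 3 = 0"
        then have "z = x $ 0 *s a + x $ 2 *s b" unfolding z P by simp
        then show ?thesis unfolding L by blast
      next
        assume "x $ 0 = x $ 1 \<and> x $ 2 = x $ 3"
        then have "z = x $ 1 *s c + x $ 3 *s d" unfolding z P by simp
        then show ?thesis unfolding N by blast
      qed
      ultimately show "z \<in> C" by (simp add: C)
    qed
  qed
  then show ?thesis using that inv by blast
qed

text \<open>In \<open>vector [a, b, c, d] :: 'a ^ 4\<close> the entries are the components \<open>1, 2, 3, 4\<close>, and
  \<open>4 = 0\<close>, so a cyclic permutation of the coordinates intervenes.\<close>

lemma twisted_cubic_normal_form:
  fixes C :: "('a::{alg_closed_field, field_char_0} ^ 4) set"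
  assumes "twisted_cubic C"
  obtains P :: "'a ^ 4 ^ 4" where "invertible P"
    "C = (*v) P ` {vec4 (\<sigma> ^ 3) (\<sigma> ^ 2 * \<tau>) (\<sigma> * \<tau> ^ 2) (\<tau> ^ 3) | \<sigma> \<tau>. (\<sigma>, \<tau>) \<noteq> (0, 0)}"
proof -
  obtain A :: "'a ^ 4 ^ 4" where A: "invertible A"
    and C: "C = {A *v vector [s ^ 3, s ^ 2 * t, s * t ^ 2, t ^ 3] | s t. (s, t) \<noteq> (0, 0)}"
    using assms unfolding twisted_cubic_def by blast
  define R :: "'a ^ 4 ^ 4" where "R = columns4 (axis 1 1) (axis 2 1) (axis 3 1) (axis 0 1)"
  have R: "(R *v x) $ 0 = x $ 3" "(R *v x) $ 1 = x $ 0" "(R *v x) $ 2 = x $ 1" "(R *v x) $ 3 = x $ 2" for x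
    unfolding R_def columns4_mult_vec by (simp_all add: axis_def)
  have "invertible R"
  proof (rule invertible_if_trivial_kernel)
    fix x assume "R *v x = 0"
    then show "x = 0" using R[of x] by (intro vec4_eq_0I) auto
  qed
  then have inv: "invertible (A ** R)" using A invertible_mult by blast
  have "(vector [a, b, c, d] :: 'a ^ 4) = R *v vec4 a b c d" for a b c d :: 'a
    by (simp add: vec_eq_iff all_4' R) (simp add: vector_def)
  then have "C = (*v) (A ** R) ` {vec4 (\<sigma> ^ 3) (\<sigma> ^ 2 * \<tau>) (\<sigma> * \<tau> ^ 2) (\<tau> ^ 3) | \<sigma> \<tau>. (\<sigma>, \<tau>) \<noteq> (0, 0)}"
    unfolding C by (auto simp: image_iff simp flip: matrix_vector_mul_assoc)
  then show ?thesis using that inv by blast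
qed

section \<open>Conclusion for curves in normal form\<close>

lemma honest_weak_conclusion:
  fixes F0 :: "(pl, 'a::field_char_0) mpoly"
  assumes P: "invertible P" "C = (*v) P ` C0"
    and F0: "normal_cayley_form d F0" "weak_cayley_eq F0" "\<not> strong_cayley_eq F0" "\<not> harmonic F0"
    and zeros: "\<And>x y. plucker x y \<noteq> 0 \<Longrightarrow>
      eval_poly F0 (plucker x y) = 0 \<longleftrightarrow> (\<exists>s t. s *s x + t *s y \<in> C0)"
  shows "(\<nexists>F. honest_cayley_form d C F \<and> strong_cayley_eq F) \<and>
    (\<exists>F2. unique_up_to_scalar (\<lambda>F. honest_cayley_form d C F \<and> weak_cayley_eq F) F2 \<and> \<not> harmonic F2)"
proof -
  obtain B :: "'a ^ 4 ^ 4" where B: "P ** B = mat 1" "B ** P = mat 1" using P(1) by (auto simp: invertible_def)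
  then have invB: "invertible B" by (auto simp: invertible_def)
  let ?F = "pullback (ext2 B) F0"
  have Z: "proj_zeros {pluckerQ, ?F} = honest_cayley_threefold C"
    unfolding P(2) by (rule honest_cayley_threefold_eq[OF B zeros])
  have F: "normal_cayley_form d ?F" "weak_cayley_eq ?F" "\<not> strong_cayley_eq ?F" "\<not> harmonic ?F"
    using F0 invB normal_cayley_form_pullback weak_cayley_eq_pullback strong_cayley_eq_pullback_iff
      harmonic_pullback_iff by blast+
  show ?thesis
    unfolding honest_cayley_form_def
    using no_strong_cayley_form[OF F(1-3) Z] weak_cayley_form_unique[OF F(1,2) Z] F(4) by blast
qed

theorem corollary21:
  fixes S :: "(4, 'a :: {alg_closed_field, field_char_0}) mpoly"
    and C D :: "('a ^ 4) set"
    and d :: nat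
  shows "(smooth_quadric S \<longrightarrow>
            (\<nexists>F. tangential_cayley_form 2 S F \<and> strong_cayley_eq F) \<and>
            (\<exists>F2. unique_up_to_scalar (\<lambda>F. tangential_cayley_form 2 S F \<and> weak_cayley_eq F) F2 \<and>
                  harmonic F2))
       \<and> ((two_skew_lines C \<and> d = 2 \<or> twisted_cubic C \<and> d = 3) \<longrightarrow>
            (\<nexists>F. honest_cayley_form d C F \<and> strong_cayley_eq F) \<and>
            (\<exists>F2. unique_up_to_scalar (\<lambda>F. honest_cayley_form d C F \<and> weak_cayley_eq F) F2 \<and>
                  \<not> harmonic F2))
       \<and> (smooth_plane_conic D \<longrightarrow>
            (\<exists>F. unique_up_to_scalar (\<lambda>F. honest_cayley_form 2 D F \<and> harmonic F) F \<and>
                 strong_cayley_eq F))"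
proof (intro conjI[of "_ \<longrightarrow> _"] impI)
  assume "smooth_quadric S"
  then obtain B :: "'a ^ 4 ^ 4" where B: "invertible B"
    and Z: "proj_zeros {pluckerQ, pullback (ext2 B) quadric_form} = tangential_cayley_threefold S"
    by (rule smooth_quadric_tangential_threefold)
  let ?F = "pullback (ext2 B) quadric_form :: (pl, 'a) mpoly"
  have F: "normal_cayley_form 2 ?F" "weak_cayley_eq ?F" "\<not> strong_cayley_eq ?F" "harmonic ?F"
    using B quadric_form_normal quadric_form_weak quadric_form_not_strong quadric_form_harmonic
      normal_cayley_form_pullback weak_cayley_eq_pullback strong_cayley_eq_pullback_iff
      harmonic_pullback_iff by blast+
  show "(\<nexists>F. tangential_cayley_form 2 S F \<and> strong_cayley_eq F) \<and>
      (\<exists>F2. unique_up_to_scalar (\<lambda>F. tangential_cayley_form 2 S F \<and> weak_cayley_eq F) F2 \<and> harmonic F2)"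
    unfolding tangential_cayley_form_def
    using no_strong_cayley_form[OF F(1-3) Z] weak_cayley_form_unique[OF F(1,2) Z] F(4) by blast
next
  assume "two_skew_lines C \<and> d = 2 \<or> twisted_cubic C \<and> d = 3"
  then show "(\<nexists>F. honest_cayley_form d C F \<and> strong_cayley_eq F) \<and>
      (\<exists>F2. unique_up_to_scalar (\<lambda>F. honest_cayley_form d C F \<and> weak_cayley_eq F) F2 \<and> \<not> harmonic F2)"
  proof (elim disjE conjE)
    assume "two_skew_lines C" and d: "d = 2"
    obtain P :: "'a ^ 4 ^ 4" where P: "invertible P"
      "C = (*v) P ` {c. c \<noteq> 0 \<and> (c $ 1 = 0 \<and> c $ 3 = 0 \<or> c $ 0 = c $ 1 \<and> c $ 2 = c $ 3)}"
      using two_skew_lines_normal_form[OF \<open>two_skew_lines C\<close>] .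
    show ?thesis
      unfolding d by (rule honest_weak_conclusion[OF P skew_form_normal skew_form_weak
          skew_form_not_strong skew_form_not_harmonic skew_form_zeros])
  next
    assume "twisted_cubic C" and d: "d = 3"
    obtain P :: "'a ^ 4 ^ 4" where P: "invertible P"
      "C = (*v) P ` {vec4 (\<sigma> ^ 3) (\<sigma> ^ 2 * \<tau>) (\<sigma> * \<tau> ^ 2) (\<tau> ^ 3) | \<sigma> \<tau>. (\<sigma>, \<tau>) \<noteq> (0, 0)}"
      using twisted_cubic_normal_form[OF \<open>twisted_cubic C\<close>] .
    show ?thesis
      unfolding d by (rule honest_weak_conclusion[OF P twisted_form_normal twisted_form_weak
          twisted_form_not_strong twisted_form_not_harmonic twisted_form_zeros])
  qed
next
  assume "smooth_plane_conic D"
  obtain P :: "'a ^ 4 ^ 4" where P: "invertible P"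
    "D = (*v) P ` {c. c \<noteq> 0 \<and> c $ 3 = 0 \<and> (c $ 1) ^ 2 = c $ 0 * c $ 2}"
    using smooth_plane_conic_normal_form[OF \<open>smooth_plane_conic D\<close>] .
  obtain B :: "'a ^ 4 ^ 4" where B: "P ** B = mat 1" "B ** P = mat 1" using P(1) by (auto simp: invertible_def)
  then have invB: "invertible B" by (auto simp: invertible_def)
  let ?F = "pullback (ext2 B) conic_form :: (pl, 'a) mpoly"
  have Z: "proj_zeros {pluckerQ, ?F} = honest_cayley_threefold D"
    unfolding P(2) by (rule honest_cayley_threefold_eq[OF B conic_form_zeros])
  have F: "normal_cayley_form 2 ?F" "strong_cayley_eq ?F" "harmonic ?F"
    using invB conic_form_normal conic_form_strong conic_form_harmonic
      normal_cayley_form_pullback strong_cayley_eq_pullback_iff harmonic_pullback_iff by blast+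
  show "\<exists>F. unique_up_to_scalar (\<lambda>F. honest_cayley_form 2 D F \<and> harmonic F) F \<and> strong_cayley_eq F"
    unfolding honest_cayley_form_def
    using harmonic_cayley_form_unique[OF F(1,3) Z] F(2) by blast
qed

end
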